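(* Let $\Omega\subset\mathbb{R}^N$ be an open and bounded set, and let $C$ be a Cheeger set for $\Omega$. If $C$ is perimeter-regular, then $$J(\Omega)\le\frac{\pi^2}{4}.$$ Moreover, if $C$ is strictly perimeter-regular, then the inequality is strict.
   Context: For a nonempty bounded open set $\Omega\subset\mathbb{R}^N$, $$h(\Omega)=\inf\Big\{\frac{\mathrm{Per}(E)}{|E|}: E\subset\Omega,\ |E|>0\Big\},\qquad \lambda_1(\Omega)=\inf\Big\{\frac{\|\nabla v\|_2^2}{\|v\|_2^2}: v\in H^1_0(\Omega)\setminus\{0\}\Big\},\qquad J(\Omega)=\frac{\lambda_1(\Omega)}{h(\Omega)^2},$$ where $\mathrm{Per}$ is the variational (De Giorgi) perimeter and $|\cdot|$ is Lebesgue measure. A Cheeger set of $\Omega$ is any set $C\subset\Omega$ attaining the infimum defining $h(\Omega)$. For a Borel set $E\subset\mathbb{R}^N$, the inradius is $\rho(E)=\sup\{\mathrm{dist}(x,\partial E): x\in E\}$. If $\rho(E)>0$, then for $0<t<\rho(E)$ the inner parallel set is $E^t=\{x\in E:\mathrm{dist}(x,\partial E)\ge t\}$. A Borel set $E$ with $\rho(E)>0$ is called perimeter-regular if $\mathrm{Per}(E^t)\le\mathrm{Per}(E)$ for almost every $t\in(0,\rho(E))$, and strictly perimeter-regular if the strict inequality $\mathrm{Per}(E^t)<\mathrm{Per}(E)$ holds for almost every such $t$.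
   Formalization: The formal theorem also assumes that C ∩ ∂C is Lebesgue-null; without this, altering a Cheeger set on a null set can make it strictly perimeter-regular even when J(Ω) > π²/4, so the statement fails for arbitrary representatives. *)

theory Defs
  imports "HOL-Analysis.Analysis"
begin

section \<open>Differentiable functions and test functions\<close>

text \<open>A differentiable function is of class \<open>C\<^sup>k\<^sup>+\<^sup>1\<close> iff all its partial derivatives are of class \<open>C\<^sup>k\<close>.\<close>

primrec C_k :: "nat \<Rightarrow> ('a::euclidean_space \<Rightarrow> 'b::real_normed_vector) \<Rightarrow> bool" where
  "C_k 0 f \<longleftrightarrow> continuous_on UNIV f"
| "C_k (Suc k) f \<longleftrightarrow>
     (\<forall>x. f differentiable (at x)) \<and> (\<forall>i\<in>Basis. C_k k (\<lambda>x. frechet_derivative f (at x) i))"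

definition compact_support_in :: "'a::euclidean_space set \<Rightarrow> ('a \<Rightarrow> 'b::real_normed_vector) \<Rightarrow> bool" where
  "compact_support_in U f \<longleftrightarrow> compact (closure {x. f x \<noteq> 0}) \<and> closure {x. f x \<noteq> 0} \<subseteq> U"

definition test_functions :: "'a::euclidean_space set \<Rightarrow> ('a \<Rightarrow> real) set" where
  "test_functions U = {\<phi>. (\<forall>k. C_k k \<phi>) \<and> compact_support_in U \<phi>}"

definition gradient :: "('a::euclidean_space \<Rightarrow> real) \<Rightarrow> 'a \<Rightarrow> 'a" where
  "gradient \<phi> x = (\<Sum>i\<in>Basis. frechet_derivative \<phi> (at x) i *\<^sub>R i)"

definition divergence :: "('a::euclidean_space \<Rightarrow> 'a) \<Rightarrow> 'a \<Rightarrow> real" where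
  "divergence \<phi> x = (\<Sum>i\<in>Basis. frechet_derivative \<phi> (at x) i \<bullet> i)"

section \<open>Perimeter and Cheeger constant\<close>

definition perimeter :: "'a::euclidean_space set \<Rightarrow> ereal" where
  "perimeter E =
     (SUP \<phi>\<in>{\<phi>::'a \<Rightarrow> 'a. C_k 1 \<phi> \<and> compact_support_in UNIV \<phi> \<and> (\<forall>x. norm (\<phi> x) \<le> 1)}.
        ereal (LINT x:E|lebesgue. divergence \<phi> x))"

text \<open>Only used for bounded \<open>\<Omega>\<close>, where all competitors have finite measure.\<close>

definition cheeger_competitors :: "'a::euclidean_space set \<Rightarrow> 'a set set" where
  "cheeger_competitors \<Omega> = {E. E \<subseteq> \<Omega> \<and> E \<in> sets lebesgue \<and> measure lebesgue E > 0}"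

definition cheeger_constant :: "'a::euclidean_space set \<Rightarrow> ereal" where
  "cheeger_constant \<Omega> =
     (INF E\<in>cheeger_competitors \<Omega>. perimeter E / ereal (measure lebesgue E))"

definition is_cheeger_set :: "'a::euclidean_space set \<Rightarrow> 'a set \<Rightarrow> bool" where
  "is_cheeger_set \<Omega> C \<longleftrightarrow>
     C \<in> cheeger_competitors \<Omega> \<and> perimeter C / ereal (measure lebesgue C) = cheeger_constant \<Omega>"

section \<open>Sobolev space and first Dirichlet eigenvalue\<close>

definition L2_on :: "'a::euclidean_space set \<Rightarrow> ('a \<Rightarrow> 'b::euclidean_space) \<Rightarrow> bool" where
  "L2_on \<Omega> f \<longleftrightarrow>
     set_borel_measurable lebesgue \<Omega> f \<and> set_integrable lebesgue \<Omega> (\<lambda>x. (norm (f x))\<^sup>2)"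

definition locally_integrable_on :: "'a::euclidean_space set \<Rightarrow> ('a \<Rightarrow> 'b::euclidean_space) \<Rightarrow> bool" where
  "locally_integrable_on \<Omega> f \<longleftrightarrow> (\<forall>K. compact K \<and> K \<subseteq> \<Omega> \<longrightarrow> set_integrable lebesgue K f)"

definition has_weak_gradient_on ::
    "'a::euclidean_space set \<Rightarrow> ('a \<Rightarrow> real) \<Rightarrow> ('a \<Rightarrow> 'a) \<Rightarrow> bool" where
  "has_weak_gradient_on \<Omega> v g \<longleftrightarrow>
     locally_integrable_on \<Omega> v \<and> locally_integrable_on \<Omega> g \<and>
     (\<forall>\<phi>\<in>test_functions \<Omega>. \<forall>i\<in>Basis.
        (LINT x:\<Omega>|lebesgue. v x * frechet_derivative \<phi> (at x) i) =
        - (LINT x:\<Omega>|lebesgue. (g x \<bullet> i) * \<phi> x))"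

text \<open>\<open>H\<^sup>1\<^sub>0(\<Omega>)\<close> is the closure of the test functions in \<open>H\<^sup>1(\<Omega>)\<close>. Its elements are represented by
  functions on the whole space, of which only the restriction to \<open>\<Omega>\<close> matters.\<close>

definition H1_0 :: "'a::euclidean_space set \<Rightarrow> ('a \<Rightarrow> real) set" where
  "H1_0 \<Omega> = {v. \<exists>g. L2_on \<Omega> v \<and> L2_on \<Omega> g \<and> has_weak_gradient_on \<Omega> v g \<and>
     (\<exists>\<phi>::nat \<Rightarrow> 'a \<Rightarrow> real. (\<forall>n. \<phi> n \<in> test_functions \<Omega>) \<and>
        (\<lambda>n. (LINT x:\<Omega>|lebesgue. (\<phi> n x - v x)\<^sup>2)
           + (LINT x:\<Omega>|lebesgue. (norm (gradient (\<phi> n) x - g x))\<^sup>2)) \<longlonglongrightarrow> 0)}"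

text \<open>The weak gradient \<open>g\<close> is determined by \<open>v\<close> almost everywhere on \<open>\<Omega>\<close>, so letting it range over
  all weak gradients of \<open>v\<close> does not enlarge the set of quotients.\<close>

definition lambda1 :: "'a::euclidean_space set \<Rightarrow> ereal" where
  "lambda1 \<Omega> =
     (INF (v, g)\<in>{(v, g). v \<in> H1_0 \<Omega> \<and> has_weak_gradient_on \<Omega> v g \<and>
                          \<not> (AE x\<in>\<Omega> in lebesgue. v x = 0)}.
        ereal ((LINT x:\<Omega>|lebesgue. (norm (g x))\<^sup>2) / (LINT x:\<Omega>|lebesgue. (v x)\<^sup>2)))"

definition J :: "'a::euclidean_space set \<Rightarrow> ereal" where
  "J \<Omega> = lambda1 \<Omega> / (cheeger_constant \<Omega>)\<^sup>2"

section \<open>Inner parallel sets and perimeter-regularity\<close>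

text \<open>The boundary is the topological one, so these notions are not invariant under modification of
  \<open>E\<close> on a null set. The convention \<open>infdist x {} = 0\<close> only concerns \<open>E = UNIV\<close>.\<close>

definition inradius :: "'a::euclidean_space set \<Rightarrow> ereal" where
  "inradius E = (SUP x\<in>E. ereal (infdist x (frontier E)))"

definition inner_parallel :: "'a::euclidean_space set \<Rightarrow> real \<Rightarrow> 'a set" where
  "inner_parallel E t = {x \<in> E. infdist x (frontier E) \<ge> t}"

definition perimeter_regular :: "'a::euclidean_space set \<Rightarrow> bool" where
  "perimeter_regular E \<longleftrightarrow> E \<in> sets borel \<and> inradius E > 0 \<and>
     (AE t in (lebesgue :: real measure).
        0 < t \<and> ereal t < inradius E \<longrightarrow> perimeter (inner_parallel E t) \<le> perimeter E)"

definition strictly_perimeter_regular :: "'a::euclidean_space set \<Rightarrow> bool" where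
  "strictly_perimeter_regular E \<longleftrightarrow> E \<in> sets borel \<and> inradius E > 0 \<and>
     (AE t in (lebesgue :: real measure).
        0 < t \<and> ereal t < inradius E \<longrightarrow> perimeter (inner_parallel E t) < perimeter E)"

text \<open>A Cheeger set is determined only up to null sets, whereas inner parallel sets depend on the
  representative. As usual, the representative is taken such that the part of its topological
  boundary that it contains is a null set. Open representatives, and those whose topological
  boundary is the support of the perimeter measure, have this property.
  Without it, removing a countable dense set from the complement of a small closed ball inside
  \<open>C\<close> would turn any Cheeger set, in dimension at least two, into a strictly perimeter-regular
  one: the inner parallel sets then only see the ball.\<close>

definition null_boundary_representative :: "'a::euclidean_space set \<Rightarrow> bool" where
  "null_boundary_representative C \<longleftrightarrow> C \<inter> frontier C \<in> null_sets lebesgue"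

end

theory Submission
  imports Defs
begin

text \<open>Let \<open>U\<close> be the interior of the Cheeger set \<open>C\<close>, \<open>K\<close> its complement and \<open>d\<close> the distance to \<open>K\<close>; for
\<open>t > 0\<close> the inner parallel set of \<open>C\<close> is the superlevel set \<open>{d \<ge> t}\<close>. Write \<open>V = |U| = |C|\<close>,
\<open>P = Per C\<close>, \<open>h = P / V\<close>, and let \<open>G(t)\<close> be the fraction of the volume of \<open>U\<close> where \<open>d \<le> t\<close>.
Regularity bounds the perimeter of almost every superlevel set of \<open>d\<close> by \<open>P\<close>, and since the gradient of
\<open>d\<close> has length one, the coarea inequality turns this into the statement that \<open>G\<close> is
\<open>h\<close>-Lipschitz (\<open>volume_between_levels_le\<close>, \<open>volume_profile_lipschitz\<close>).

The trial function is \<open>sin (\<pi>/2 \<cdot> G(d))\<close> on \<open>U\<close>. Its gradient is at most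
\<open>(\<pi>/2) h cos (\<pi>/2 \<cdot> G(d))\<close>. As \<open>G\<close> is continuous, \<open>G(d)\<close> is uniformly distributed on
\<open>[0,1]\<close> under normalised volume, so \<open>cos\<^sup>2\<close> and \<open>sin\<^sup>2\<close> of \<open>\<pi>/2 \<cdot> G(d)\<close> have the
same integral (\<open>integral_cos_volume_profile\<close>), and the Rayleigh quotient is at most
\<open>(\<pi>/2)\<^sup>2 h\<^sup>2\<close>.

If the perimeters are strictly smaller than \<open>P\<close>, then \<open>G\<close> increases on an interval \<open>[a,b]\<close> by strictly
less than \<open>h (b - a)\<close>. Replacing \<open>G\<close> there by its chord, of slope \<open>q < h\<close>, gains a multiple of
\<open>h - q\<close> in the gradient term and loses at most a multiple of \<open>(h - q)(b - a)\<close> through the change of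
\<open>G\<close>; for a short interval the gain wins (\<open>chord_gain\<close>).

Two analytic ingredients carry the argument. The distance is differentiable almost everywhere with
unit gradient because \<open>|x|\<^sup>2 - d\<^sup>2\<close> is convex (\<open>infdist_has_unit_gradient_AE\<close>). Mollification
with a smooth kernel supplies both the vector fields that test the perimeter
(\<open>clamp_dist_calibrating_fields\<close>) and the test functions whose Rayleigh quotients approximate the one
of the trial function (\<open>lambda1_le_profile\<close>). It converges at every point of differentiability
(\<open>mollify_gradient_tendsto\<close>) and respects local Lipschitz constants (\<open>mollify_gradient_le\<close>).\<close>

section \<open>Calculus of functions of class C^k\<close>

lemma frechet_derivative_eq:
  "(f has_derivative f') (at x) \<Longrightarrow> frechet_derivative f (at x) = f'"
  using frechet_derivative_at by metis

lemma C_k_Suc_has_derivative: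
  assumes "C_k (Suc k) f"
  shows "(f has_derivative frechet_derivative f (at x)) (at x)"
  using assms by (simp add: frechet_derivative_works)

lemma C_k_continuous: "C_k k f \<Longrightarrow> continuous_on UNIV f"
  by (cases k) (auto simp: continuous_at_imp_continuous_on differentiable_imp_continuous_within)

lemma C_k_SucD: "C_k (Suc k) f \<Longrightarrow> C_k k f"
proof (induction k arbitrary: f)
  case 0
  then show ?case using C_k_continuous by fastforce
next
  case (Suc k)
  then show ?case by simp
qed

lemma C_k_cong_derivative:
  assumes "\<And>x. (f has_derivative f' x) (at x)" "\<And>i. i \<in> Basis \<Longrightarrow> C_k k (\<lambda>x. f' x i)"
  shows "C_k (Suc k) f"
  using assms frechet_derivative_eq[OF assms(1)] by (auto simp: differentiable_def)

lemma C_k_const: "C_k k (\<lambda>x. c)"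
proof (induction k arbitrary: c)
  case (Suc k)
  show ?case
    by (rule C_k_cong_derivative[where f'="\<lambda>x h. 0"]) (use Suc in auto)
qed auto

lemma C_k_add: "C_k k f \<Longrightarrow> C_k k g \<Longrightarrow> C_k k (\<lambda>x. f x + g x)"
proof (induction k arbitrary: f g)
  case (Suc k)
  show ?case
  proof (rule C_k_cong_derivative)
    show "((\<lambda>x. f x + g x) has_derivative
            (\<lambda>h. frechet_derivative f (at x) h + frechet_derivative g (at x) h)) (at x)" for x
      using Suc.prems by (intro has_derivative_add C_k_Suc_has_derivative)
  qed (use Suc in auto)
qed (auto intro: continuous_intros)

lemma C_k_sum: "(\<And>j. j \<in> S \<Longrightarrow> C_k k (f j)) \<Longrightarrow> C_k k (\<lambda>x. \<Sum>j\<in>S. f j x)"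
  by (induction S rule: infinite_finite_induct) (auto intro: C_k_const C_k_add)

lemma C_k_scaleR:
  fixes f :: "'a::euclidean_space \<Rightarrow> real" and g :: "'a \<Rightarrow> 'b::real_normed_vector"
  shows "C_k k f \<Longrightarrow> C_k k g \<Longrightarrow> C_k k (\<lambda>x. f x *\<^sub>R g x)"
proof (induction k arbitrary: f g)
  case (Suc k)
  show ?case
  proof (rule C_k_cong_derivative)
    show "((\<lambda>x. f x *\<^sub>R g x) has_derivative
            (\<lambda>h. f x *\<^sub>R frechet_derivative g (at x) h + frechet_derivative f (at x) h *\<^sub>R g x)) (at x)" for x
      using Suc.prems by (intro has_derivative_scaleR C_k_Suc_has_derivative)
    show "C_k k (\<lambda>x. f x *\<^sub>R frechet_derivative g (at x) i + frechet_derivative f (at x) i *\<^sub>R g x)"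
      if "i \<in> Basis" for i
      using that Suc.prems by (intro C_k_add Suc.IH) (auto dest: C_k_SucD simp del: C_k.simps(1) intro: C_k_SucD)
  qed
qed (auto intro: continuous_intros)

lemma C_k_mult:
  fixes f g :: "'a::euclidean_space \<Rightarrow> real"
  shows "C_k k f \<Longrightarrow> C_k k g \<Longrightarrow> C_k k (\<lambda>x. f x * g x)"
  using C_k_scaleR[of k f g] by simp

lemma C_k_linear:
  assumes "bounded_linear f"
  shows "C_k k f"
proof (cases k)
  case 0
  then show ?thesis using assms by (simp add: linear_continuous_on)
next
  case (Suc l)
  show ?thesis unfolding Suc
    by (rule C_k_cong_derivative[where f'="\<lambda>x. f"])
      (use assms in \<open>auto simp: bounded_linear_imp_has_derivative C_k_const\<close>)
qed

section \<open>A smooth bump function\<close>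

text \<open>The flat functions \<open>p(1/s) e\<^bsup>-1/s\<^esup>\<close>, extended by zero, with an arbitrary polynomial \<open>p\<close>: this
family is closed under differentiation, so smoothness follows by induction over all \<open>p\<close> at once.\<close>

definition flat_exp :: "real poly \<Rightarrow> real \<Rightarrow> real" where
  "flat_exp p s = (if s > 0 then poly p (1 / s) * exp (- (1 / s)) else 0)"

lemma poly_exp_tendsto_0: "((\<lambda>u::real. poly p u * exp (- u)) \<longlongrightarrow> 0) at_top"
proof (induction p rule: pCons_induct)
  case 0 then show ?case by simp
next
  case (pCons a p)
  have 1: "((\<lambda>u::real. u^k / exp u) \<longlongrightarrow> 0) at_top" for k by (rule tendsto_power_div_exp_0)
  have "((\<lambda>u::real. \<Sum>i\<le>degree (pCons a p). coeff (pCons a p) i * (u^i / exp u)) \<longlongrightarrow> (\<Sum>i\<le>degree (pCons a p). coeff (pCons a p) i * 0)) at_top"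
    by (intro tendsto_intros 1)
  then show ?case by (simp add: poly_altdef[of "pCons a p"] exp_minus divide_inverse sum_distrib_right mult.assoc del: poly_pCons)
qed

lemma flat_exp_has_derivative:
  "(flat_exp p has_real_derivative flat_exp ([:0,0,1:] * (p - pderiv p)) s) (at s)"
proof -
  consider "s > 0" | "s < 0" | "s = 0" by linarith
  then show ?thesis
  proof cases
    case 1
    have "((\<lambda>s. poly p (1 / s) * exp (- (1 / s))) has_real_derivative
        flat_exp ([:0,0,1:] * (p - pderiv p)) s) (at s)"
      using 1 by (auto intro!: derivative_eq_intros DERIV_chain2[OF poly_DERIV]
        simp: flat_exp_def power2_eq_square field_simps)
    then show ?thesis
      by (rule has_field_derivative_transform_within_open[where S="{0<..}"]) (use 1 in \<open>auto simp: flat_exp_def\<close>)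
  next
    case 2
    have "((\<lambda>s::real. 0::real) has_real_derivative flat_exp ([:0,0,1:] * (p - pderiv p)) s) (at s)"
      using 2 by (auto simp: flat_exp_def)
    then show ?thesis
      by (rule has_field_derivative_transform_within_open[where S="{..<0}"]) (use 2 in \<open>auto simp: flat_exp_def\<close>)
  next
    case 3
    have "((\<lambda>u::real. poly ([:0,1:] * p) u * exp (- u)) \<longlongrightarrow> 0) at_top" by (rule poly_exp_tendsto_0)
    then have "((\<lambda>s::real. poly ([:0,1:] * p) (inverse s) * exp (- inverse s)) \<longlongrightarrow> 0) (at_right 0)"
      by (rule filterlim_compose[OF _ filterlim_inverse_at_top_right])
    then have "((\<lambda>h. (flat_exp p (0 + h) - flat_exp p 0) / h) \<longlongrightarrow> 0) (at_right 0)"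
      by (rule Lim_transform_eventually)
        (auto simp: flat_exp_def eventually_at_right_field divide_inverse mult_ac intro!: exI[of _ 1])
    moreover have "((\<lambda>h. (flat_exp p (0 + h) - flat_exp p 0) / h) \<longlongrightarrow> 0) (at_left 0)"
      by (rule Lim_transform_eventually[OF tendsto_const])
        (auto simp: flat_exp_def eventually_at_left_field intro!: exI[of _ "-1"])
    ultimately have "((\<lambda>h. (flat_exp p (0 + h) - flat_exp p 0) / h) \<longlongrightarrow> 0) (at 0)"
      by (simp add: filterlim_split_at)
    then show ?thesis using 3 by (simp add: DERIV_def flat_exp_def)
  qed
qed

definition bump :: "'a::euclidean_space \<Rightarrow> real" where
  "bump x = flat_exp [:1:] (1 - x \<bullet> x)"

lemma C_k_flat_exp_inner: "C_k k (\<lambda>x::'a::euclidean_space. flat_exp p (1 - x \<bullet> x))"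
proof (induction k arbitrary: p)
  case 0
  have "continuous_on UNIV (flat_exp p)"
    using flat_exp_has_derivative by (meson DERIV_isCont continuous_at_imp_continuous_on)
  then have "continuous_on UNIV (flat_exp p \<circ> (\<lambda>x::'a. 1 - x \<bullet> x))"
    by (intro continuous_on_compose continuous_intros) (auto intro: continuous_on_subset)
  then show ?case by (simp add: o_def)
next
  case (Suc k)
  let ?q = "[:0,0,1:] * (p - pderiv p)"
  show ?case
  proof (rule C_k_cong_derivative)
    show "((\<lambda>x::'a. flat_exp p (1 - x \<bullet> x)) has_derivative
       (\<lambda>h. flat_exp ?q (1 - x \<bullet> x) * ((- 2) * (x \<bullet> h)))) (at x)" for x
    proof -
      have "((\<lambda>x::'a. 1 - x \<bullet> x) has_derivative (\<lambda>h. (- 2) * (x \<bullet> h))) (at x)"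
        by (auto intro!: derivative_eq_intros simp: inner_commute)
      from has_derivative_compose[OF this flat_exp_has_derivative[of p, unfolded has_field_derivative_def]]
      show ?thesis by simp
    qed
    show "C_k k (\<lambda>x::'a. flat_exp ?q (1 - x \<bullet> x) * ((- 2) * (x \<bullet> i)))" for i
      by (intro C_k_mult Suc.IH C_k_const C_k_linear bounded_linear_inner_left)
  qed
qed

lemma C_k_compose_scaleR:
  assumes "C_k k f"
  shows "C_k k (\<lambda>x. f (c *\<^sub>R x))"
  using assms
proof (induction k arbitrary: f)
  case 0
  then show ?case
    by (auto intro!: continuous_on_compose2[of UNIV f] continuous_intros)
next
  case (Suc k)
  show ?case
  proof (rule C_k_cong_derivative)
    show "((\<lambda>x. f (c *\<^sub>R x)) has_derivative (\<lambda>h. c *\<^sub>R frechet_derivative f (at (c *\<^sub>R x)) h)) (at x)" for x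
    proof -
      note D = C_k_Suc_has_derivative[OF Suc.prems, of "c *\<^sub>R x"]
      have "((\<lambda>x. f (c *\<^sub>R x)) has_derivative (\<lambda>h. frechet_derivative f (at (c *\<^sub>R x)) (c *\<^sub>R h))) (at x)"
        using D by (rule has_derivative_compose[rotated]) (auto intro!: derivative_eq_intros)
      then show ?thesis using has_derivative_bounded_linear[OF D] by (simp add: linear_simps)
    qed
    show "C_k k (\<lambda>x. c *\<^sub>R frechet_derivative f (at (c *\<^sub>R x)) i)" if "i \<in> Basis" for i
      by (intro C_k_scaleR C_k_const Suc.IH) (use Suc.prems that in auto)
  qed
qed

section \<open>Integrals of continuous functions of bounded support\<close>

lemma integrable_continuous_bounded_support:
  fixes f :: "'a::euclidean_space \<Rightarrow> 'b::{banach, second_countable_topology}"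
  assumes "continuous_on UNIV f" "bounded {x. f x \<noteq> 0}"
  shows "integrable lborel f"
proof -
  have "integrable lborel (\<lambda>x. indicator (closure {x. f x \<noteq> 0}) x *\<^sub>R f x)"
    using assms by (intro borel_integrable_compact) (auto intro: continuous_on_subset)
  moreover have "(\<lambda>x. indicator (closure {x. f x \<noteq> 0}) x *\<^sub>R f x) = f"
    using closure_subset[of "{x. f x \<noteq> 0}"] by (auto simp: fun_eq_iff indicator_def)
  ultimately show ?thesis by simp
qed

lemma continuous_bounded_support_bounded:
  fixes f :: "'a::euclidean_space \<Rightarrow> 'b::real_normed_vector"
  assumes "continuous_on UNIV f" "bounded {x. f x \<noteq> 0}"
  obtains M where "M > 0" "\<And>x. norm (f x) \<le> M"
proof -
  have "compact (f ` closure {x. f x \<noteq> 0})"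
    using assms by (intro compact_continuous_image) (auto intro: continuous_on_subset)
  then obtain M where M: "M > 0" "\<And>y. y \<in> f ` closure {x. f x \<noteq> 0} \<Longrightarrow> norm y \<le> M"
    using compact_imp_bounded bounded_pos by metis
  have "norm (f x) \<le> M" for x
  proof (cases "f x = 0")
    case False
    then have "x \<in> closure {x. f x \<noteq> 0}" using closure_subset[of "{x. f x \<noteq> 0}"] by blast
    with M(2) show ?thesis by blast
  qed (use M(1) in simp)
  with M(1) that show thesis by blast
qed

lemma frechet_derivative_eq_0_off_closure:
  assumes "x \<notin> closure {x. f x \<noteq> 0}"
  shows "frechet_derivative f (at x) = (\<lambda>h. 0)"
proof (rule frechet_derivative_eq)
  show "(f has_derivative (\<lambda>h. 0)) (at x)"
    by (rule has_derivative_transform_within_open[of "\<lambda>x. 0" _ _ _ "- closure {x. f x \<noteq> 0}"])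
      (use assms closure_subset[of "{x. f x \<noteq> 0}"] in auto)
qed

lemma bounded_support_derivative:
  assumes "bounded {x. f x \<noteq> 0}"
  shows "bounded {x. frechet_derivative f (at x) i \<noteq> 0}"
  by (rule bounded_subset[OF bounded_closure[OF assms]]) (use frechet_derivative_eq_0_off_closure in force)

lemma lborel_integral_affine:
  fixes f :: "'a::euclidean_space \<Rightarrow> real"
  assumes [measurable]: "f \<in> borel_measurable borel" and "c \<noteq> 0"
  shows "(LINT x|lborel. f x) = \<bar>c\<bar> ^ DIM('a) * (LINT x|lborel. f (t + c *\<^sub>R x))"
proof -
  have "(LINT x|lborel. f x) = (LINT x|density (distr lborel borel (\<lambda>x. t + c *\<^sub>R x)) (\<lambda>_. ennreal (\<bar>c\<bar> ^ DIM('a))). f x)"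
    using lborel_affine[OF \<open>c \<noteq> 0\<close>, of t] by simp
  also have "\<dots> = (LINT x|distr lborel borel (\<lambda>x. t + c *\<^sub>R x). \<bar>c\<bar> ^ DIM('a) * f x)"
    by (subst integral_density) auto
  also have "\<dots> = (LINT x|lborel. \<bar>c\<bar> ^ DIM('a) * f (t + c *\<^sub>R x))"
    by (subst integral_distr) auto
  finally show ?thesis by simp
qed

lemma lborel_integral_translate:
  fixes f :: "'a::euclidean_space \<Rightarrow> real"
  assumes "f \<in> borel_measurable borel"
  shows "(LINT x|lborel. f (x + t)) = (LINT x|lborel. f x)"
  using lborel_integral_affine[OF assms, of 1 t] by (simp add: add.commute)

lemma lborel_integral_reflect:
  fixes f :: "'a::euclidean_space \<Rightarrow> real"
  assumes "f \<in> borel_measurable borel"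
  shows "(LINT x|lborel. f (t - x)) = (LINT x|lborel. f x)"
  using lborel_integral_affine[OF assms, of "-1" t] by simp

section \<open>Convolution\<close>

definition conv :: "('a::euclidean_space \<Rightarrow> real) \<Rightarrow> ('a \<Rightarrow> real) \<Rightarrow> 'a \<Rightarrow> real" where
  "conv \<kappa> g x = (LINT w|lborel. \<kappa> (x - w) * g w)"

lemma bounded_support_reflect:
  assumes "bounded {x. \<kappa> x \<noteq> (0::'b::zero)}"
  shows "bounded {w::'a::real_normed_vector. \<kappa> (x - w) \<noteq> 0}"
proof -
  have "{w. \<kappa> (x - w) \<noteq> 0} = (\<lambda>y. x - y) ` {y. \<kappa> y \<noteq> 0}"
    by (auto simp: image_iff) (metis diff_diff_eq2 add_diff_cancel_left')
  also have "bounded \<dots>"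
  proof -
    obtain R where "\<And>y. \<kappa> y \<noteq> 0 \<Longrightarrow> norm y \<le> R" using assms by (auto simp: bounded_iff)
    then have "norm z \<le> norm x + R" if "z \<in> (\<lambda>y. x - y) ` {y. \<kappa> y \<noteq> 0}" for z
      using that norm_triangle_ineq4[of x] by (fastforce intro: order_trans)
    then show ?thesis unfolding bounded_iff by blast
  qed
  finally show ?thesis .
qed

lemma integrable_conv:
  assumes "continuous_on UNIV \<kappa>" "bounded {x. \<kappa> x \<noteq> 0}" "continuous_on UNIV g"
  shows "integrable lborel (\<lambda>w::'a::euclidean_space. \<kappa> (x - w) * g w :: real)"
proof (rule integrable_continuous_bounded_support)
  show "continuous_on UNIV (\<lambda>w. \<kappa> (x - w) * g w)"
    using assms by (auto intro!: continuous_intros continuous_on_compose2[of UNIV \<kappa>])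
  show "bounded {w. \<kappa> (x - w) * g w \<noteq> 0}"
    by (rule bounded_subset[OF bounded_support_reflect[OF assms(2), of x]]) auto
qed

lemma conv_commute:
  assumes "continuous_on UNIV \<kappa>" "continuous_on UNIV g"
  shows "conv \<kappa> g x = (LINT w|lborel. \<kappa> w * g (x - w))"
proof -
  have "continuous_on UNIV (\<lambda>w. \<kappa> w * g (x - w))"
    using assms by (auto intro!: continuous_intros continuous_on_compose2[of UNIV g])
  from lborel_integral_reflect[OF borel_measurable_continuous_onI[OF this], of x]
  show ?thesis by (simp add: conv_def)
qed

lemma has_derivative_Basis_sum:
  assumes "(f has_derivative f') F"
  shows "f' h = (\<Sum>i\<in>Basis. (h \<bullet> i) *\<^sub>R f' i)"
proof -
  interpret bounded_linear f' using assms by (rule has_derivative_bounded_linear)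
  have "f' h = f' (\<Sum>i\<in>Basis. (h \<bullet> i) *\<^sub>R i)" by (simp add: euclidean_representation)
  then show ?thesis by (simp add: sum scaleR)
qed

text \<open>Differentiation under the integral sign. Since the kernel has bounded support, the integral can be taken
over one fixed box for all points near \<open>x\<close>.\<close>

lemma conv_has_derivative:
  fixes \<kappa> g :: "'a::euclidean_space \<Rightarrow> real"
  assumes \<kappa>: "C_k (Suc 0) \<kappa>" "bounded {x. \<kappa> x \<noteq> 0}" and g: "continuous_on UNIV g"
  shows "(conv \<kappa> g has_derivative
     (\<lambda>h. \<Sum>i\<in>Basis. (h \<bullet> i) * conv (\<lambda>y. frechet_derivative \<kappa> (at y) i) g x)) (at x)"
proof -
  let ?D = "\<lambda>i y. frechet_derivative \<kappa> (at y) i"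
  have c\<kappa>: "continuous_on UNIV \<kappa>" using C_k_continuous \<kappa>(1) by blast
  have cD: "continuous_on UNIV (?D i)" if "i \<in> Basis" for i using \<kappa>(1) that by simp
  have bD: "bounded {x. ?D i x \<noteq> 0}" for i using \<kappa>(2) by (rule bounded_support_derivative)
  obtain R where R: "\<And>y. \<kappa> y \<noteq> 0 \<Longrightarrow> norm y \<le> R" using \<kappa>(2) by (auto simp: bounded_iff)
  obtain c where c: "cball x (R + 1) \<subseteq> cbox (- c) c"
    using bounded_subset_cbox_symmetric[OF bounded_cball] by metis
  have R': "?D i y = 0" if "norm y > R" for i y
  proof -
    have "closure {y. \<kappa> y \<noteq> 0} \<subseteq> cball 0 R" by (rule closure_minimal) (use R in auto)
    then have "y \<notin> closure {y. \<kappa> y \<noteq> 0}" using that by auto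
    then show ?thesis by (simp add: frechet_derivative_eq_0_off_closure)
  qed
  have far: "norm (y - w) > R" if "y \<in> ball x 1" "w \<notin> cbox (- c) c" for y w
  proof -
    have "dist x w > R + 1" using that c by (meson mem_cball not_le subsetD)
    moreover have "dist x w \<le> dist x y + dist y w" by (rule dist_triangle)
    ultimately show ?thesis using that(1) by (auto simp: dist_norm)
  qed
  have box: "(LINT w|lborel. K (y - w) * g w) = integral (cbox (- c) c) (\<lambda>w. K (y - w) * g w)"
    if "y \<in> ball x 1" "continuous_on UNIV K" "bounded {x. K x \<noteq> 0}" "\<And>z. norm z > R \<Longrightarrow> K z = 0" for K y
  proof -
    have i: "integrable lborel (\<lambda>w. K (y - w) * g w)" by (rule integrable_conv) (use that g in auto)
    have "integral UNIV (\<lambda>w. K (y - w) * g w) = integral (cbox (- c) c) (\<lambda>w. K (y - w) * g w)"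
      unfolding integral_restrict_UNIV[symmetric, of "cbox (- c) c"]
      by (rule arg_cong[where f="integral UNIV"]) (use far[OF that(1)] that(4) in \<open>simp add: fun_eq_iff\<close>)
    then show ?thesis using integral_lborel[OF i] by simp
  qed
  define F where "F y w = (\<Sum>i\<in>Basis. (?D i (y - w) * g w) *\<^sub>R blinfun_inner_right i)" for y w
  have F_app: "blinfun_apply (F y w) h = (\<Sum>i\<in>Basis. (?D i (y - w) * g w) * (i \<bullet> h))" for y w h
    by (simp add: F_def blinfun.sum_left blinfun.scaleR_left)
  have der: "((\<lambda>y. \<kappa> (y - w) * g w) has_derivative blinfun_apply (F y w)) (at y)" for y w
  proof -
    have "(\<kappa> has_derivative frechet_derivative \<kappa> (at (y - w))) (at (y - w))"
      using \<kappa>(1) by (rule C_k_Suc_has_derivative)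
    then have "((\<lambda>y. \<kappa> (y - w)) has_derivative frechet_derivative \<kappa> (at (y - w))) (at y)"
      by (rule has_derivative_compose[rotated]) (auto intro!: derivative_eq_intros)
    then have "((\<lambda>y. \<kappa> (y - w) * g w) has_derivative (\<lambda>h. frechet_derivative \<kappa> (at (y - w)) h * g w)) (at y)"
      by (rule has_derivative_mult_left)
    moreover have "(\<lambda>h. frechet_derivative \<kappa> (at (y - w)) h * g w) = blinfun_apply (F y w)"
    proof
      fix h
      show "frechet_derivative \<kappa> (at (y - w)) h * g w = blinfun_apply (F y w) h"
        unfolding F_app has_derivative_Basis_sum[OF C_k_Suc_has_derivative[OF \<kappa>(1), of "y - w"], of h]
        by (auto simp: sum_distrib_right sum_distrib_left inner_commute mult_ac intro!: sum.cong)
    qed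
    ultimately show ?thesis by simp
  qed
  have cF: "continuous_on (ball x 1 \<times> cbox (- c) c) (\<lambda>(y, w). F y w)"
    unfolding F_def case_prod_beta
    using cD g by (intro continuous_intros)
      (auto intro!: continuous_intros intro: continuous_on_compose2[of UNIV])
  have ci: "(\<lambda>w. \<kappa> (y - w) * g w) integrable_on cbox (- c) c" for y
    using c\<kappa> g by (intro integrable_continuous)
      (auto intro!: continuous_intros intro: continuous_on_compose2[of UNIV])
  have "((\<lambda>y. integral (cbox (- c) c) (\<lambda>w. \<kappa> (y - w) * g w)) has_derivative
      blinfun_apply (integral (cbox (- c) c) (F x))) (at x within ball x 1)"
    by (rule leibniz_rule) (use der ci cF in \<open>auto intro: has_derivative_at_withinI\<close>)
  then have "((\<lambda>y. integral (cbox (- c) c) (\<lambda>w. \<kappa> (y - w) * g w)) has_derivative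
      blinfun_apply (integral (cbox (- c) c) (F x))) (at x)"
    by (simp add: at_within_open[of x "ball x 1"])
  then have "(conv \<kappa> g has_derivative blinfun_apply (integral (cbox (- c) c) (F x))) (at x)"
  proof (rule has_derivative_transform_within_open)
    show "integral (cbox (- c) c) (\<lambda>w. \<kappa> (y - w) * g w) = conv \<kappa> g y" if "y \<in> ball x 1" for y
      unfolding conv_def by (rule box[OF that c\<kappa> \<kappa>(2), symmetric]) (use R not_le in blast)
  qed auto
  moreover have "blinfun_apply (integral (cbox (- c) c) (F x)) =
     (\<lambda>h. \<Sum>i\<in>Basis. (h \<bullet> i) * conv (?D i) g x)"
  proof
    fix h
    have Fi: "F x integrable_on cbox (- c) c"
      unfolding F_def using cD g
      by (intro integrable_continuous) (auto intro!: continuous_intros intro: continuous_on_compose2[of UNIV])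
    have int: "(\<lambda>w. ?D i (x - w) * g w) integrable_on cbox (- c) c" if "i \<in> Basis" for i
      using cD[OF that] g by (intro integrable_continuous) (auto intro!: continuous_intros intro: continuous_on_compose2[of UNIV])
    have "blinfun_apply (integral (cbox (- c) c) (F x)) h =
        integral (cbox (- c) c) (\<lambda>w. \<Sum>i\<in>Basis. (h \<bullet> i) * (?D i (x - w) * g w))"
      by (simp add: blinfun_apply_integral[OF Fi] F_app inner_commute mult_ac)
    also have "\<dots> = (\<Sum>i\<in>Basis. (h \<bullet> i) * integral (cbox (- c) c) (\<lambda>w. ?D i (x - w) * g w))"
      using int by (subst integral_sum) (auto intro: integrable_on_mult_right)
    also have "\<dots> = (\<Sum>i\<in>Basis. (h \<bullet> i) * conv (?D i) g x)"
      unfolding conv_def by (intro sum.cong refl, subst box) (use cD bD R' in auto)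
    finally show "blinfun_apply (integral (cbox (- c) c) (F x)) h = (\<Sum>i\<in>Basis. (h \<bullet> i) * conv (?D i) g x)" .
  qed
  ultimately show ?thesis by simp
qed

lemma conv_frechet_derivative:
  fixes \<kappa> g :: "'a::euclidean_space \<Rightarrow> real"
  assumes "C_k (Suc 0) \<kappa>" "bounded {x. \<kappa> x \<noteq> 0}" "continuous_on UNIV g" "i \<in> Basis"
  shows "frechet_derivative (conv \<kappa> g) (at x) i = conv (\<lambda>y. frechet_derivative \<kappa> (at y) i) g x"
  using frechet_derivative_eq[OF conv_has_derivative[OF assms(1-3)]] assms(4)
  by (simp add: inner_Basis if_distrib[of "\<lambda>u. u * _"] cong: if_cong)

text \<open>All derivatives fall on the kernel.\<close>

lemma C_k_conv:
  assumes "\<And>k. C_k k \<kappa>" "bounded {x. \<kappa> x \<noteq> 0}" "continuous_on UNIV g"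
  shows "C_k k (conv \<kappa> g)"
  using assms(1,2)
proof (induction k arbitrary: \<kappa>)
  case 0
  have "(conv \<kappa> g) differentiable (at x)" for x
    using conv_has_derivative[OF 0 assms(3)] by (auto simp: differentiable_def)
  then show ?case by (simp add: continuous_at_imp_continuous_on differentiable_imp_continuous_within)
next
  case (Suc k)
  have "C_k k (conv (\<lambda>y. frechet_derivative \<kappa> (at y) i) g)" if "i \<in> Basis" for i
  proof (rule Suc.IH)
    show "C_k l (\<lambda>y. frechet_derivative \<kappa> (at y) i)" for l
      using Suc.prems(1)[of "Suc l"] that by simp
  qed (rule bounded_support_derivative[OF Suc.prems(2)])
  moreover have "(conv \<kappa> g) differentiable (at x)" for x
    using conv_has_derivative[OF Suc.prems assms(3)] by (auto simp: differentiable_def)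
  ultimately show ?case
    using conv_frechet_derivative[OF Suc.prems assms(3)] by simp
qed

section \<open>Mollification\<close>

lemma C_k_bump: "C_k k bump"
  unfolding bump_def by (rule C_k_flat_exp_inner)

lemma bump_nonneg: "0 \<le> bump x"
  by (simp add: bump_def flat_exp_def)

lemma bump_pos_iff: "0 < bump x \<longleftrightarrow> norm x < 1"
  by (simp add: bump_def flat_exp_def norm_eq_sqrt_inner)

lemma bounded_support_bump: "bounded {x::'a::euclidean_space. bump x \<noteq> 0}"
  by (rule bounded_subset[OF bounded_ball[of "0::'a" 1]])
    (use bump_nonneg bump_pos_iff in \<open>force simp: less_le\<close>)

lemma integrable_bump: "integrable lborel bump"
  by (rule integrable_continuous_bounded_support[OF C_k_continuous[OF C_k_bump] bounded_support_bump])

lemma integral_bump_pos: "0 < (LINT x|lborel. bump (x::'a::euclidean_space))"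
proof -
  have "\<not> (AE x in lborel. bump (x::'a) = 0)"
  proof
    assume "AE x in lborel. bump (x::'a) = 0"
    then have "AE x in lborel. x \<notin> ball (0::'a) 1"
      by eventually_elim (use bump_pos_iff in force)
    then have "ball (0::'a) 1 \<in> null_sets lborel"
      using AE_iff_null_sets[of "ball (0::'a) 1" lborel] by simp
    then show False
      using emeasure_lborel_cbox_eq open_not_negligible[of "ball (0::'a) 1"]
      by (auto simp: negligible_iff_null_sets null_sets_completionI)
  qed
  then show ?thesis
    using integral_nonneg_eq_0_iff_AE[OF integrable_bump] bump_nonneg
    by (metis (mono_tags, lifting) AE_I2 Bochner_Integration.integral_nonneg order_le_less)
qed

definition mollifier :: "real \<Rightarrow> 'a::euclidean_space \<Rightarrow> real" where
  "mollifier \<epsilon> x = (1 / (\<epsilon> ^ DIM('a) * (LINT y|lborel. bump (y::'a)))) * bump ((1 / \<epsilon>) *\<^sub>R x)"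

lemma C_k_mollifier: "C_k k (mollifier \<epsilon>)"
  unfolding mollifier_def by (intro C_k_mult C_k_const C_k_compose_scaleR C_k_bump)

lemma mollifier_nonneg: "0 < \<epsilon> \<Longrightarrow> 0 \<le> mollifier \<epsilon> x"
  using integral_bump_pos less_imp_le by (auto simp: mollifier_def intro!: mult_nonneg_nonneg bump_nonneg divide_nonneg_nonneg)

lemma mollifier_eq_0: "0 < \<epsilon> \<Longrightarrow> norm x \<ge> \<epsilon> \<Longrightarrow> mollifier \<epsilon> x = 0"
  using bump_nonneg[of "(1 / \<epsilon>) *\<^sub>R x"] bump_pos_iff[of "(1 / \<epsilon>) *\<^sub>R x"] by (auto simp: mollifier_def field_simps not_less)

lemma bounded_support_mollifier: "0 < \<epsilon> \<Longrightarrow> bounded {x::'a::euclidean_space. mollifier \<epsilon> x \<noteq> 0}"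
  by (rule bounded_subset[OF bounded_ball[of "0::'a" \<epsilon>]]) (use mollifier_eq_0 in force)

lemma continuous_mollifier: "continuous_on S (mollifier \<epsilon>)"
  using C_k_continuous[OF C_k_mollifier] continuous_on_subset by blast

lemma integral_scaled:
  fixes f :: "'a::euclidean_space \<Rightarrow> real"
  assumes [measurable]: "f \<in> borel_measurable borel" and "0 < \<epsilon>"
  shows "(LINT x|lborel. f ((1 / \<epsilon>) *\<^sub>R x)) = \<epsilon> ^ DIM('a) * (LINT x|lborel. f x)"
proof -
  have "(LINT x|lborel. f ((1 / \<epsilon>) *\<^sub>R x)) = \<bar>\<epsilon>\<bar> ^ DIM('a) * (LINT x|lborel. f ((1 / \<epsilon>) *\<^sub>R (0 + \<epsilon> *\<^sub>R x)))"
    by (rule lborel_integral_affine) (use assms in auto)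
  then show ?thesis using assms(2) by simp
qed

lemma integral_mollifier:
  assumes "0 < \<epsilon>"
  shows "(LINT x|lborel. mollifier \<epsilon> (x::'a::euclidean_space)) = 1"
proof -
  have [measurable]: "bump \<in> borel_measurable (borel :: 'a measure)"
    by (rule borel_measurable_integrable[OF integrable_bump, simplified])
  show ?thesis
    unfolding mollifier_def using integral_bump_pos[where 'a='a] assms
    by (simp add: integral_scaled)
qed

lemma mollifier_derivative:
  assumes "0 < \<epsilon>"
  shows "frechet_derivative (mollifier \<epsilon>) (at (x::'a::euclidean_space)) i =
    (1 / (\<epsilon> ^ DIM('a) * (LINT y|lborel. bump (y::'a)))) * ((1 / \<epsilon>) * frechet_derivative bump (at ((1 / \<epsilon>) *\<^sub>R x)) i)"
proof -
  note D = C_k_Suc_has_derivative[OF C_k_bump[of "Suc 0"], of "(1 / \<epsilon>) *\<^sub>R x"]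
  have "((\<lambda>x::'a. bump ((1 / \<epsilon>) *\<^sub>R x)) has_derivative (\<lambda>h. frechet_derivative bump (at ((1 / \<epsilon>) *\<^sub>R x)) ((1 / \<epsilon>) *\<^sub>R h))) (at x)"
    using D by (rule has_derivative_compose[rotated]) (auto intro!: derivative_eq_intros)
  from has_derivative_mult_right[OF this, of "1 / (\<epsilon> ^ DIM('a) * (LINT y|lborel. bump (y::'a)))"]
  have "(mollifier \<epsilon> has_derivative (\<lambda>h. (1 / (\<epsilon> ^ DIM('a) * (LINT y|lborel. bump (y::'a)))) * frechet_derivative bump (at ((1 / \<epsilon>) *\<^sub>R x)) ((1 / \<epsilon>) *\<^sub>R h))) (at x)"
    by (simp add: mollifier_def[abs_def])
  from frechet_derivative_eq[OF this] has_derivative_bounded_linear[OF D]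
  show ?thesis by (simp add: linear_simps)
qed

text \<open>By scaling, the derivative of the mollifier has \<open>L\<^sup>1\<close>-norm \<open>O(1/\<epsilon>)\<close>.\<close>

lemma integral_abs_mollifier_derivative:
  obtains M where "\<And>\<epsilon> i x. 0 < \<epsilon> \<Longrightarrow> i \<in> Basis \<Longrightarrow>
     (LINT w|lborel. \<bar>frechet_derivative (mollifier \<epsilon>) (at (x - w)) i\<bar>) \<le> M / \<epsilon>"
   and "M > 0"
proof -
  let ?Z = "LINT y|lborel. bump (y::'a)"
  let ?I = "\<lambda>i::'a. LINT y|lborel. \<bar>frechet_derivative bump (at y) i\<bar>"
  define M where "M = 1 + (\<Sum>i\<in>Basis. ?I i / ?Z)"
  have "(LINT w|lborel. \<bar>frechet_derivative (mollifier \<epsilon>) (at (x - w)) i\<bar>) \<le> M / \<epsilon>"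
    if e: "0 < \<epsilon>" and i: "i \<in> Basis" for \<epsilon> and i x :: 'a
  proof -
    have "continuous_on UNIV (\<lambda>y::'a. frechet_derivative bump (at y) i)"
      using C_k_bump[of "Suc 0", where 'a='a] i by simp
    then have m: "(\<lambda>y. \<bar>frechet_derivative bump (at y) i\<bar>) \<in> borel_measurable borel"
      by (intro borel_measurable_continuous_onI continuous_intros)
    have "continuous_on UNIV (\<lambda>y::'a. frechet_derivative (mollifier \<epsilon>) (at y) i)"
      using C_k_mollifier[of "Suc 0" \<epsilon>, where 'a='a] i by simp
    then have m': "(\<lambda>y. \<bar>frechet_derivative (mollifier \<epsilon>) (at y) i\<bar>) \<in> borel_measurable borel"
      by (intro borel_measurable_continuous_onI continuous_intros)
    have "(LINT w|lborel. \<bar>frechet_derivative (mollifier \<epsilon>) (at (x - w)) i\<bar>) =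
      (LINT w|lborel. \<bar>frechet_derivative (mollifier \<epsilon>) (at w) i\<bar>)"
      by (rule lborel_integral_reflect[OF m'])
    also have "\<dots> = (LINT w|lborel. (1 / (\<epsilon> ^ DIM('a) * ?Z * \<epsilon>)) * \<bar>frechet_derivative bump (at ((1 / \<epsilon>) *\<^sub>R w)) i\<bar>)"
      using e integral_bump_pos[where 'a='a]
      by (intro Bochner_Integration.integral_cong) (auto simp: mollifier_derivative abs_mult)
    also have "\<dots> = (1 / (\<epsilon> ^ DIM('a) * ?Z * \<epsilon>)) * (LINT w|lborel. \<bar>frechet_derivative bump (at ((1 / \<epsilon>) *\<^sub>R w)) i\<bar>)" by simp
    also have "\<dots> = (?I i / ?Z) / \<epsilon>"
      unfolding integral_scaled[OF m e] using e by simp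
    also have "\<dots> \<le> M / \<epsilon>"
    proof -
      have "?I i / ?Z \<le> (\<Sum>i\<in>Basis. ?I i / ?Z)"
        by (rule member_le_sum[OF i]) (use integral_bump_pos[where 'a='a] in \<open>auto intro!: divide_nonneg_nonneg less_imp_le[OF integral_bump_pos]\<close>)
      then have "?I i / ?Z \<le> M" by (simp add: M_def)
      then show ?thesis using e by (intro divide_right_mono) auto
    qed
    finally show ?thesis .
  qed
  moreover have "M > 0" unfolding M_def
    by (intro add_pos_nonneg sum_nonneg divide_nonneg_nonneg) (auto intro: less_imp_le[OF integral_bump_pos])
  ultimately show thesis using that by blast
qed

definition mollify :: "real \<Rightarrow> ('a::euclidean_space \<Rightarrow> real) \<Rightarrow> 'a \<Rightarrow> real" where
  "mollify \<epsilon> g = conv (mollifier \<epsilon>) g"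

lemma C_k_mollify: "0 < \<epsilon> \<Longrightarrow> continuous_on UNIV g \<Longrightarrow> C_k k (mollify \<epsilon> g)"
  unfolding mollify_def by (intro C_k_conv C_k_mollifier bounded_support_mollifier)

lemma mollify_eq: "continuous_on UNIV g \<Longrightarrow> mollify \<epsilon> g x = (LINT w|lborel. mollifier \<epsilon> w * g (x - w))"
  unfolding mollify_def by (intro conv_commute continuous_mollifier)

lemma integrable_mollify:
  assumes "0 < \<epsilon>" "continuous_on UNIV g"
  shows "integrable lborel (\<lambda>w. mollifier \<epsilon> w * g (x - w))"
proof (rule integrable_continuous_bounded_support)
  show "continuous_on UNIV (\<lambda>w. mollifier \<epsilon> w * g (x - w))"
    using assms by (auto intro!: continuous_intros continuous_on_compose2[of UNIV g] continuous_mollifier)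
  show "bounded {w. mollifier \<epsilon> w * g (x - w) \<noteq> 0}"
    by (rule bounded_subset[OF bounded_support_mollifier[OF assms(1)]]) auto
qed

lemma integrable_mollifier: "0 < \<epsilon> \<Longrightarrow> integrable lborel (mollifier \<epsilon>)"
  by (rule integrable_continuous_bounded_support[OF continuous_mollifier bounded_support_mollifier])

lemma mollify_diff:
  assumes "0 < \<epsilon>" "continuous_on UNIV f" "continuous_on UNIV g"
  shows "mollify \<epsilon> (\<lambda>x. f x - g x) x = mollify \<epsilon> f x - mollify \<epsilon> g x"
  using assms by (simp add: mollify_eq continuous_on_diff right_diff_distrib integrable_mollify)

lemma mollify_abs_le:
  fixes f :: "'a::euclidean_space \<Rightarrow> real"
  assumes e: "0 < \<epsilon>" and f: "continuous_on UNIV f" and b: "\<And>w. norm w < \<epsilon> \<Longrightarrow> \<bar>f (x - w)\<bar> \<le> B"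
  shows "\<bar>mollify \<epsilon> f x\<bar> \<le> B"
proof -
  have "\<bar>mollify \<epsilon> f x\<bar> \<le> (LINT w|lborel. \<bar>mollifier \<epsilon> w * f (x - w)\<bar>)"
    unfolding mollify_eq[OF f] by (rule integral_abs_bound)
  also have "\<dots> \<le> (LINT w|lborel. mollifier \<epsilon> (w::'a) * B)"
  proof (rule Bochner_Integration.integral_mono)
    show "\<bar>mollifier \<epsilon> w * f (x - w)\<bar> \<le> mollifier \<epsilon> w * B" for w
    proof (cases "norm w < \<epsilon>")
      case True
      then show ?thesis using b[OF True] mollifier_nonneg[OF e, of w] by (simp add: abs_mult mult_left_mono)
    qed (use mollifier_eq_0[OF e, of w] in auto)
  qed (use integrable_mollify[OF e f] integrable_mollifier[OF e] in auto)
  also have "\<dots> = B" using integral_mollifier[OF e, where 'a='a] by simp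
  finally show ?thesis .
qed

lemma mollify_const: "0 < \<epsilon> \<Longrightarrow> mollify \<epsilon> (\<lambda>x. c) (x::'a::euclidean_space) = c"
  using integral_mollifier[of \<epsilon>, where 'a='a] by (simp add: mollify_eq)

lemma mollify_close:
  fixes f :: "'a::euclidean_space \<Rightarrow> real"
  assumes e: "0 < \<epsilon>" and f: "continuous_on UNIV f" and b: "\<And>w. norm w < \<epsilon> \<Longrightarrow> \<bar>f (x - w) - c\<bar> \<le> B"
  shows "\<bar>mollify \<epsilon> f x - c\<bar> \<le> B"
  using mollify_abs_le[OF e, of "\<lambda>x. f x - c" x B] mollify_diff[OF e f, of "\<lambda>x. c" x] mollify_const[OF e, of c x] f b
  by (simp add: continuous_on_diff)

lemma mollify_lipschitz:
  fixes f :: "'a::euclidean_space \<Rightarrow> real"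
  assumes e: "0 < \<epsilon>" and f: "continuous_on UNIV f"
    and b: "\<And>w. norm w < \<epsilon> \<Longrightarrow> \<bar>f (x - w) - f (y - w)\<bar> \<le> B"
  shows "\<bar>mollify \<epsilon> f x - mollify \<epsilon> f y\<bar> \<le> B"
proof -
  have c: "continuous_on UNIV (\<lambda>z. f (z + c))" for c
    using f by (auto intro!: continuous_intros continuous_on_compose2[of UNIV f])
  have "mollify \<epsilon> f y = mollify \<epsilon> (\<lambda>z. f (z + (y - x))) x"
    by (simp add: mollify_eq f c)
  then have "mollify \<epsilon> f x - mollify \<epsilon> f y = mollify \<epsilon> (\<lambda>z. f z - f (z + (y - x))) x"
    using mollify_diff[OF e f c] by simp
  moreover have "\<bar>mollify \<epsilon> (\<lambda>z. f z - f (z + (y - x))) x\<bar> \<le> B"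
  proof (rule mollify_abs_le[OF e])
    show "continuous_on UNIV (\<lambda>z. f z - f (z + (y - x)))" by (intro continuous_on_diff f c)
    show "\<bar>f (x - w) - f (x - w + (y - x))\<bar> \<le> B" if "norm w < \<epsilon>" for w
      using b[OF that] by simp
  qed
  ultimately show ?thesis by simp
qed

lemma has_derivative_gradient_inner:
  assumes "(f has_derivative f') (at x)"
  shows "gradient f x \<bullet> h = f' h"
  unfolding gradient_def frechet_derivative_eq[OF assms] has_derivative_Basis_sum[OF assms, of h]
  by (simp add: inner_sum_left inner_commute[of h] mult.commute)

lemma gradient_eqI:
  assumes "(f has_derivative (\<lambda>h. p \<bullet> h)) (at x)"
  shows "gradient f x = p"
  using has_derivative_gradient_inner[OF assms] by (metis vector_eq_rdot)

lemma has_real_derivative_line: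
  assumes "(f has_derivative f') (at (x + s *\<^sub>R h))"
  shows "((\<lambda>s. f (x + s *\<^sub>R h)) has_real_derivative f' h) (at s)"
proof -
  have "((\<lambda>s. f (x + s *\<^sub>R h)) has_derivative (\<lambda>t. f' (t *\<^sub>R h))) (at s)"
    by (rule has_derivative_compose[where f="\<lambda>s. x + s *\<^sub>R h" and g=f and s=UNIV, OF _ assms]) (auto intro!: derivative_eq_intros)
  moreover have "(\<lambda>t. f' (t *\<^sub>R h)) = (\<lambda>t. f' h * t)"
    using has_derivative_bounded_linear[OF assms] by (auto simp: linear_simps fun_eq_iff)
  ultimately show ?thesis by (simp add: has_field_derivative_def)
qed

lemma norm_gradient_le:
  assumes f: "(f has_derivative f') (at x)" and "r > 0" and L: "\<And>y. y \<in> ball x r \<Longrightarrow> \<bar>f y - f x\<bar> \<le> L * norm (y - x)"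
  shows "norm (gradient f x) \<le> L"
proof -
  let ?g = "gradient f x"
  have "((\<lambda>s. f (x + s *\<^sub>R ?g)) has_real_derivative f' ?g) (at 0)"
    using f by (intro has_real_derivative_line) simp
  then have lim: "((\<lambda>s. (f (x + s *\<^sub>R ?g) - f x) / s) \<longlongrightarrow> f' ?g) (at 0)"
    by (simp add: DERIV_def)
  have "eventually (\<lambda>s::real. norm (s *\<^sub>R ?g) < r) (at 0)"
  proof -
    have "((\<lambda>s. norm (s *\<^sub>R ?g)) \<longlongrightarrow> norm ((0::real) *\<^sub>R ?g)) (at 0)" by (intro tendsto_intros)
    then show ?thesis using \<open>r > 0\<close> by (auto dest: order_tendstoD)
  qed
  then have "eventually (\<lambda>s. (f (x + s *\<^sub>R ?g) - f x) / s \<le> L * norm ?g) (at 0)"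
    using eventually_neq_at_within[of "0::real" 0 UNIV]
  proof (eventually_elim)
    case (elim s)
    have "\<bar>f (x + s *\<^sub>R ?g) - f x\<bar> \<le> L * norm (s *\<^sub>R ?g)"
      using L[of "x + s *\<^sub>R ?g"] elim(1) by (simp add: dist_norm)
    then have "\<bar>(f (x + s *\<^sub>R ?g) - f x) / s\<bar> \<le> L * norm ?g"
      using elim(2) by (simp add: abs_divide divide_le_eq mult_ac)
    then show ?case by linarith
  qed
  then have "f' ?g \<le> L * norm ?g" by (intro tendsto_upperbound[OF lim]) auto
  then have "norm ?g * norm ?g \<le> L * norm ?g"
    using has_derivative_gradient_inner[OF f, of ?g] by (simp add: power2_norm_eq_inner[symmetric] power2_eq_square)
  moreover have "0 \<le> L"
  proof -
    obtain i :: 'a where "i \<in> Basis" using nonempty_Basis by blast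
    then have "\<bar>f (x + (r / 2) *\<^sub>R i) - f x\<bar> \<le> L * norm ((r / 2) *\<^sub>R i)"
      using L[of "x + (r / 2) *\<^sub>R i"] \<open>r > 0\<close> by (simp add: dist_norm)
    then have "0 \<le> L * norm ((r / 2) *\<^sub>R i)" by linarith
    then show ?thesis using \<open>r > 0\<close> \<open>i \<in> Basis\<close> by (simp add: zero_le_mult_iff)
  qed
  ultimately show ?thesis by (cases "norm ?g = 0") (auto dest: mult_right_le_imp_le)
qed

text \<open>A local Lipschitz constant is inherited by mollification, because a mollified function is an average of
translates.\<close>

lemma mollify_gradient_le:
  fixes f :: "'a::euclidean_space \<Rightarrow> real"
  assumes e: "0 < \<epsilon>" "\<epsilon> < r" and f: "continuous_on UNIV f"
    and L: "\<And>y z. y \<in> ball x r \<Longrightarrow> z \<in> ball x r \<Longrightarrow> \<bar>f y - f z\<bar> \<le> L * norm (y - z)"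
  shows "norm (gradient (mollify \<epsilon> f) x) \<le> L"
proof (rule norm_gradient_le)
  show "(mollify \<epsilon> f has_derivative frechet_derivative (mollify \<epsilon> f) (at x)) (at x)"
    by (rule C_k_Suc_has_derivative[OF C_k_mollify[of _ _ "Suc 0"]]) (use e f in auto)
  show "0 < r - \<epsilon>" using e by simp
  show "\<bar>mollify \<epsilon> f y - mollify \<epsilon> f x\<bar> \<le> L * norm (y - x)" if "y \<in> ball x (r - \<epsilon>)" for y
  proof (rule mollify_lipschitz[OF e(1) f])
    fix w :: 'a assume w: "norm w < \<epsilon>"
    have "dist x (y - w) \<le> dist x y + norm w" by (metis add.commute add_diff_cancel_left' diff_add_cancel dist_commute dist_norm dist_triangle minus_diff_eq norm_minus_cancel)
    then show "\<bar>f (y - w) - f (x - w)\<bar> \<le> L * norm (y - x)"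
      using L[of "y - w" "x - w"] w e that by (simp add: dist_norm)
  qed
qed

lemma mollify_affine_has_derivative:
  fixes D :: "'a::euclidean_space \<Rightarrow> real"
  assumes e: "0 < \<epsilon>" and D: "bounded_linear D"
  shows "(mollify \<epsilon> (\<lambda>y. c + D y) has_derivative D) (at x)"
proof -
  interpret D: bounded_linear D by (rule D)
  have cD: "continuous_on UNIV D" using D by (simp add: linear_continuous_on)
  have i1: "integrable lborel (\<lambda>w::'a. mollifier \<epsilon> w * c)" for c
    using integrable_mollifier[OF e] by auto
  have i2: "integrable lborel (\<lambda>w::'a. mollifier \<epsilon> w * D w)"
    using integrable_mollify[OF e continuous_on_minus[OF cD], of 0] by (simp add: D.neg)
  have "mollify \<epsilon> (\<lambda>y. c + D y) y = (c - (LINT w|lborel. mollifier \<epsilon> w * D w)) + D y" for y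
  proof -
    have "mollify \<epsilon> (\<lambda>y. c + D y) y = (LINT w|lborel. mollifier \<epsilon> w * (c + D y) - mollifier \<epsilon> w * D w)"
      using cD by (subst mollify_eq) (auto intro!: continuous_intros simp: D.diff algebra_simps)
    also have "\<dots> = (LINT w|lborel. mollifier \<epsilon> (w::'a) * (c + D y)) - (LINT w|lborel. mollifier \<epsilon> w * D w)"
      by (rule Bochner_Integration.integral_diff[OF i1 i2])
    finally show ?thesis using integral_mollifier[OF e, where 'a='a] by simp
  qed
  then have *: "mollify \<epsilon> (\<lambda>y. c + D y) = (\<lambda>y. (c - (LINT w|lborel. mollifier \<epsilon> w * D w)) + D y)" by blast
  show ?thesis unfolding *
    using D by (auto intro!: derivative_eq_intros bounded_linear_imp_has_derivative)
qed

text \<open>The first order Taylor polynomial of \<open>f\<close> at \<open>x\<close> contributes exactly its own gradient; the remainder is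
\<open>o(\<epsilon>)\<close> on the \<open>\<epsilon>\<close>-ball and is integrated against a kernel of \<open>L\<^sup>1\<close>-norm
\<open>O(1/\<epsilon>)\<close>.\<close>

lemma mollify_gradient_tendsto:
  fixes f :: "'a::euclidean_space \<Rightarrow> real"
  assumes f: "continuous_on UNIV f" and D: "(f has_derivative D) (at x)"
    and \<epsilon>: "\<And>n. 0 < \<epsilon> n" "\<epsilon> \<longlonglongrightarrow> 0"
  shows "(\<lambda>n. gradient (mollify (\<epsilon> n) f) x) \<longlonglongrightarrow> gradient f x"
proof -
  have "(\<lambda>n. frechet_derivative (mollify (\<epsilon> n) f) (at x) i) \<longlonglongrightarrow> D i" if i: "i \<in> Basis" for i
  proof (rule LIMSEQ_I)
    fix \<eta> :: real assume "\<eta> > 0"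
    interpret D: bounded_linear D using D by (rule has_derivative_bounded_linear)
    obtain M where M: "\<And>\<epsilon>. 0 < \<epsilon> \<Longrightarrow> (LINT w|lborel. \<bar>frechet_derivative (mollifier \<epsilon>) (at (x - w)) i\<bar>) \<le> M / \<epsilon>" and "M > 0"
      using integral_abs_mollifier_derivative i by metis
    \<comment> \<open>the affine Taylor polynomial \<open>A\<close> of \<open>f\<close> at \<open>x\<close>\<close>
    define c where "c = f x - D x"
    define A where "A y = c + D y" for y
    have cA: "continuous_on UNIV A" unfolding A_def
      using D.bounded_linear_axioms by (intro continuous_intros linear_continuous_on)
    have "0 < \<eta> / (2 * M)" using \<open>\<eta> > 0\<close> \<open>M > 0\<close> by simp
    then obtain d where "d > 0" and d: "\<And>y. norm (y - x) < d \<Longrightarrow> \<bar>f y - f x - D (y - x)\<bar> \<le> (\<eta> / (2 * M)) * norm (y - x)"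
      using D unfolding has_derivative_at_alt by (metis real_norm_def)
    obtain N where N: "\<And>n. n \<ge> N \<Longrightarrow> \<epsilon> n < d"
      using order_tendstoD(2)[OF \<epsilon>(2) \<open>d > 0\<close>] by (auto simp: eventually_sequentially)
    show "\<exists>no. \<forall>n\<ge>no. norm (frechet_derivative (mollify (\<epsilon> n) f) (at x) i - D i) < \<eta>"
    proof (intro exI allI impI)
      fix n assume "n \<ge> N"
      let ?e = "\<epsilon> n" and ?k = "mollifier (\<epsilon> n) :: 'a \<Rightarrow> real"
      let ?dk = "\<lambda>y. frechet_derivative ?k (at y) i"
      have e: "0 < ?e" "?e < d" using \<epsilon>(1) N[OF \<open>n \<ge> N\<close>] by auto
      note k = C_k_mollifier[of "Suc 0" ?e, where 'a='a] bounded_support_mollifier[OF e(1), where 'a='a]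
      have cdk: "continuous_on UNIV ?dk" using k(1) i by simp
      have bdk: "bounded {y. ?dk y \<noteq> 0}" by (rule bounded_support_derivative[OF k(2)])
      have r0: "?dk y = 0" if "norm y > ?e" for y
      proof -
        have "closure {y. ?k y \<noteq> 0} \<subseteq> cball 0 ?e" by (rule closure_minimal) (use mollifier_eq_0[OF e(1), where 'a='a] in force)+
        then have "y \<notin> closure {y. ?k y \<noteq> 0}" using that by auto
        then show ?thesis by (simp add: frechet_derivative_eq_0_off_closure)
      qed
      have "frechet_derivative (mollify ?e f) (at x) i - D i = conv ?dk f x - conv ?dk A x"
      proof -
        have "D i = frechet_derivative (mollify ?e A) (at x) i"
          unfolding A_def using frechet_derivative_eq[OF mollify_affine_has_derivative[OF e(1) D.bounded_linear_axioms]] by simp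
        then show ?thesis
          unfolding mollify_def using conv_frechet_derivative[OF k f i] conv_frechet_derivative[OF k cA i] by simp
      qed
      also have "\<dots> = (LINT w|lborel. ?dk (x - w) * f w - ?dk (x - w) * A w)"
        unfolding conv_def by (rule Bochner_Integration.integral_diff[symmetric]) (intro integrable_conv cdk bdk f cA)+
      finally have "\<bar>frechet_derivative (mollify ?e f) (at x) i - D i\<bar> \<le> (LINT w|lborel. \<bar>?dk (x - w) * f w - ?dk (x - w) * A w\<bar>)"
        by (simp only:) (rule integral_abs_bound)
      also have "\<dots> \<le> (LINT w|lborel. \<bar>?dk (x - w)\<bar> * ((\<eta> / (2 * M)) * ?e))"
      proof (rule Bochner_Integration.integral_mono)
        show "integrable lborel (\<lambda>w. \<bar>?dk (x - w) * f w - ?dk (x - w) * A w\<bar>)"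
          by (intro integrable_abs Bochner_Integration.integrable_diff integrable_conv cdk bdk f cA)
        have "integrable lborel (\<lambda>w. ?dk (x - w) * 1)"
          by (intro integrable_conv cdk bdk continuous_on_const)
        then show "integrable lborel (\<lambda>w. \<bar>?dk (x - w)\<bar> * ((\<eta> / (2 * M)) * ?e))"
          by (intro integrable_mult_left integrable_abs) simp
        show "\<bar>?dk (x - w) * f w - ?dk (x - w) * A w\<bar> \<le> \<bar>?dk (x - w)\<bar> * ((\<eta> / (2 * M)) * ?e)" for w
        proof (cases "norm (x - w) > ?e")
          case False
          have "\<bar>f w - A w\<bar> \<le> (\<eta> / (2 * M)) * norm (w - x)"
            using d[of w] False e by (simp add: A_def c_def D.diff norm_minus_commute algebra_simps)
          also have "\<dots> \<le> (\<eta> / (2 * M)) * ?e"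
            using False \<open>0 < \<eta> / (2 * M)\<close> by (intro mult_left_mono) (auto simp: norm_minus_commute)
          finally show ?thesis
            using mult_left_mono[of "\<bar>f w - A w\<bar>" "(\<eta> / (2 * M)) * ?e" "\<bar>?dk (x - w)\<bar>"]
            unfolding right_diff_distrib[symmetric] abs_mult by simp
        qed (simp add: r0)
      qed
      also have "\<dots> = (LINT w|lborel. \<bar>?dk (x - w)\<bar>) * ((\<eta> / (2 * M)) * ?e)" by simp
      also have "\<dots> \<le> (M / ?e) * ((\<eta> / (2 * M)) * ?e)"
        using \<open>\<eta> > 0\<close> \<open>M > 0\<close> e(1) by (intro mult_right_mono M) auto
      also have "\<dots> < \<eta>" using e \<open>M > 0\<close> \<open>\<eta> > 0\<close> by simp
      finally show "norm (frechet_derivative (mollify ?e f) (at x) i - D i) < \<eta>" by simp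
    qed
  qed
  then show ?thesis
    unfolding gradient_def frechet_derivative_eq[OF D] by (intro tendsto_intros)
qed

section \<open>Integration by parts\<close>

text \<open>The integrals of the difference quotients vanish by translation invariance of Lebesgue measure.\<close>

lemma integral_partial_derivative_eq_0:
  fixes F :: "'a::euclidean_space \<Rightarrow> real"
  assumes F: "C_k (Suc 0) F" "bounded {x. F x \<noteq> 0}" and i: "i \<in> Basis"
  shows "(LINT x|lborel. frechet_derivative F (at x) i) = 0"
proof -
  let ?D = "\<lambda>x. frechet_derivative F (at x) i"
  have cF: "continuous_on UNIV F" using F(1) C_k_continuous by blast
  have cD: "continuous_on UNIV ?D" using F(1) i by simp
  have bD: "bounded {x. ?D x \<noteq> 0}" using F(2) by (rule bounded_support_derivative)
  obtain M where M: "\<And>x. norm (?D x) \<le> M" "M > 0" using continuous_bounded_support_bounded[OF cD bD] by metis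
  obtain R where R: "\<And>x. F x \<noteq> 0 \<Longrightarrow> norm x \<le> R" using F(2) by (auto simp: bounded_iff)
  let ?h = "\<lambda>n. 1 / real (Suc n)"
  let ?s = "\<lambda>n x. (F (x + ?h n *\<^sub>R i) - F x) / ?h n"
  have cs: "continuous_on UNIV (\<lambda>x. F (x + t *\<^sub>R i))" for t
    by (auto intro!: continuous_intros continuous_on_compose2[OF cF])
  have tl: "((\<lambda>s. F (x + s *\<^sub>R i)) has_real_derivative ?D (x + s *\<^sub>R i)) (at s)" for x s
    by (rule has_real_derivative_line[OF C_k_Suc_has_derivative[OF F(1)]])
  have "(\<lambda>n. LINT x|lborel. ?s n x) \<longlonglongrightarrow> (LINT x|lborel. ?D x)"
  proof (rule integral_dominated_convergence)
    show "integrable lborel (\<lambda>x::'a. M * indicator (cball 0 (R + 1)) x)"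
      by (intro integrable_mult_right integrable_real_indicator emeasure_bounded_finite bounded_cball) simp
    show "AE x in lborel. (\<lambda>n. ?s n x) \<longlonglongrightarrow> ?D x"
    proof (intro AE_I2)
      fix x
      have "((\<lambda>h. (F (x + h *\<^sub>R i) - F x) / h) \<longlongrightarrow> ?D x) (at 0)"
        using tl[of x 0] by (simp add: DERIV_def)
      then show "(\<lambda>n. ?s n x) \<longlonglongrightarrow> ?D x"
        by (rule filterlim_compose) (auto simp: filterlim_at intro!: LIMSEQ_Suc[OF lim_1_over_n, simplified])
    qed
    show "AE x in lborel. norm (?s n x) \<le> M * indicator (cball 0 (R + 1)) x" for n
    proof (intro AE_I2)
      fix x
      have "0 < ?h n" by simp
      then obtain z where "F (x + ?h n *\<^sub>R i) - F (x + 0 *\<^sub>R i) = (?h n - 0) * ?D (x + z *\<^sub>R i)"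
        using MVT2[of 0 "?h n" "\<lambda>s. F (x + s *\<^sub>R i)" "\<lambda>s. ?D (x + s *\<^sub>R i)"] tl by blast
      then have "norm (?s n x) \<le> M" using M(1)[of "x + z *\<^sub>R i"] by simp
      moreover have "?s n x = 0" if "x \<notin> cball 0 (R + 1)"
      proof -
        have "norm x \<le> norm (x + ?h n *\<^sub>R i) + norm (?h n *\<^sub>R i)" using norm_triangle_ineq4[of "x + ?h n *\<^sub>R i" "?h n *\<^sub>R i"] by simp
        moreover have "norm (?h n *\<^sub>R i) \<le> 1" using i by simp
        ultimately have *: "norm x \<le> norm (x + ?h n *\<^sub>R i) + 1" by linarith
        have "F x = 0" using R[of x] that by auto
        moreover have "F (x + ?h n *\<^sub>R i) = 0"
        proof (rule ccontr)
          assume "F (x + ?h n *\<^sub>R i) \<noteq> 0"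
          from R[OF this] * have "norm x \<le> R + 1" by linarith
          with that show False by simp
        qed
        ultimately show ?thesis by simp
      qed
      ultimately show "norm (?s n x) \<le> M * indicator (cball 0 (R + 1)) x" by (cases "x \<in> cball 0 (R + 1)") auto
    qed
    show "?D \<in> borel_measurable lborel" using cD by (simp add: borel_measurable_continuous_onI)
    show "?s n \<in> borel_measurable lborel" for n using cs[of "?h n"] cF
      by (auto intro!: borel_measurable_continuous_onI continuous_intros)
  qed
  moreover have "(LINT x|lborel. ?s n x) = 0" for n
  proof -
    have i0: "integrable lborel F" by (rule integrable_continuous_bounded_support[OF cF F(2)])
    have "bounded {x. F (x + ?h n *\<^sub>R i) \<noteq> 0}"
    proof -
      have "norm x \<le> R + norm (?h n *\<^sub>R i)" if "F (x + ?h n *\<^sub>R i) \<noteq> 0" for x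
        using R[OF that] norm_triangle_ineq4[of "x + ?h n *\<^sub>R i" "?h n *\<^sub>R i"] by simp
      then show ?thesis unfolding bounded_iff by blast
    qed
    then have i1: "integrable lborel (\<lambda>x. F (x + ?h n *\<^sub>R i))" by (rule integrable_continuous_bounded_support[OF cs])
    have "(LINT x|lborel. F (x + ?h n *\<^sub>R i) - F x) = 0"
      using Bochner_Integration.integral_diff[OF i1 i0] lborel_integral_translate[of F "?h n *\<^sub>R i"] cF
      by (simp add: borel_measurable_continuous_onI)
    then show ?thesis by simp
  qed
  ultimately show ?thesis by (simp add: LIMSEQ_const_iff)
qed

lemma integration_by_parts:
  fixes f g :: "'a::euclidean_space \<Rightarrow> real"
  assumes f: "C_k (Suc 0) f" and g: "C_k (Suc 0) g" "bounded {x. g x \<noteq> 0}" and i: "i \<in> Basis"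
  shows "(LINT x|lborel. f x * frechet_derivative g (at x) i) = - (LINT x|lborel. frechet_derivative f (at x) i * g x)"
proof -
  let ?f = "\<lambda>x. frechet_derivative f (at x) i" and ?g = "\<lambda>x. frechet_derivative g (at x) i"
  have c: "continuous_on UNIV f" "continuous_on UNIV g" "continuous_on UNIV ?f" "continuous_on UNIV ?g"
    using f g i C_k_continuous[OF f] C_k_continuous[OF g(1)] by auto
  have fg: "C_k (Suc 0) (\<lambda>x. f x * g x)" by (rule C_k_mult[OF f g(1)])
  have b: "bounded {x. f x * g x \<noteq> 0}" by (rule bounded_subset[OF g(2)]) auto
  have "((\<lambda>x. f x * g x) has_derivative (\<lambda>h. f x * frechet_derivative g (at x) h + frechet_derivative f (at x) h * g x)) (at x)" for x
    by (intro has_derivative_mult C_k_Suc_has_derivative[OF f] C_k_Suc_has_derivative[OF g(1)])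
  then have "frechet_derivative (\<lambda>x. f x * g x) (at x) i = f x * ?g x + ?f x * g x" for x
    by (rule fun_cong[OF frechet_derivative_eq])
  with integral_partial_derivative_eq_0[OF fg b i] have "(LINT x|lborel. f x * ?g x + ?f x * g x) = 0" by simp
  moreover have "integrable lborel (\<lambda>x. f x * ?g x)"
    by (intro integrable_continuous_bounded_support continuous_intros c bounded_subset[OF bounded_support_derivative[OF g(2), of i]]) auto
  moreover have "integrable lborel (\<lambda>x. ?f x * g x)"
    by (intro integrable_continuous_bounded_support continuous_intros c bounded_subset[OF g(2)]) auto
  ultimately show ?thesis by simp
qed

section \<open>The distance function has unit gradient almost everywhere\<close>

text \<open>This is \<open>sup\<^sub>y (x \<bullet> y - |y|\<^sup>2/2)\<close> over \<open>y \<in> K\<close>, the convex conjugate of the function that is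
\<open>|y|\<^sup>2/2\<close> on \<open>K\<close> and infinite elsewhere. The supremum is attained at the points of \<open>K\<close> nearest to
\<open>x\<close>, which are therefore subgradients at \<open>x\<close>.\<close>

definition dist_conj :: "'a::euclidean_space set \<Rightarrow> 'a \<Rightarrow> real" where
  "dist_conj K x = (x \<bullet> x - (infdist x K)\<^sup>2) / 2"

lemma dist_conj_ge:
  assumes "y \<in> K"
  shows "x \<bullet> y - y \<bullet> y / 2 \<le> dist_conj K x"
proof -
  have "(infdist x K)\<^sup>2 \<le> (norm (x - y))\<^sup>2"
    using infdist_le[OF assms, of x] by (intro power_mono) (auto simp: dist_norm infdist_nonneg)
  then show ?thesis by (simp add: dist_conj_def power2_norm_eq_inner inner_diff_left inner_diff_right inner_commute)
qed

lemma dist_conj_nearest: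
  assumes "infdist x K = dist x y"
  shows "dist_conj K x = x \<bullet> y - y \<bullet> y / 2"
  using assms by (simp add: dist_conj_def dist_norm power2_norm_eq_inner inner_diff_left inner_diff_right inner_commute)

lemma dist_conj_subgradient:
  assumes "y \<in> K" "infdist x K = dist x y"
  shows "dist_conj K x + y \<bullet> z \<le> dist_conj K (x + z)"
  using dist_conj_ge[OF assms(1), of "x + z"] dist_conj_nearest[OF assms(2)]
  by (simp add: inner_add_left inner_commute[of x y] inner_commute[of z y])

lemma convex_dist_conj:
  fixes K :: "'a::euclidean_space set"
  assumes K: "closed K" "K \<noteq> {}"
  shows "convex_on UNIV (dist_conj K)"
proof (rule convex_onI)
  fix t :: real and x z :: 'a assume t: "0 < t" "t < 1"
  let ?m = "(1 - t) *\<^sub>R x + t *\<^sub>R z"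
  obtain y where y: "y \<in> K" "infdist ?m K = dist ?m y" using infdist_attains_inf[OF K] by metis
  have "dist_conj K ?m = (1 - t) * (x \<bullet> y - y \<bullet> y / 2) + t * (z \<bullet> y - y \<bullet> y / 2)"
    unfolding dist_conj_nearest[OF y(2)] by (simp only: inner_add_left inner_scaleR_left) (simp add: field_simps)
  also have "\<dots> \<le> (1 - t) * dist_conj K x + t * dist_conj K z"
    using t by (intro add_mono mult_left_mono dist_conj_ge y) auto
  finally show "dist_conj K ?m \<le> (1 - t) * dist_conj K x + t * dist_conj K z" .
qed auto

lemma continuous_dist_conj: "continuous_on S (dist_conj K)"
  unfolding dist_conj_def by (intro continuous_intros) auto

definition second_diff :: "('a::euclidean_space \<Rightarrow> real) \<Rightarrow> 'a \<Rightarrow> 'a \<Rightarrow> real" where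
  "second_diff w z x = w (x + z) + w (x - z) - 2 * w x"

lemma second_diff_nonneg:
  assumes "convex_on UNIV w"
  shows "0 \<le> second_diff w z x"
  using convex_onD[OF assms, of "1/2" "x + z" "x - z"]
  by (simp add: second_diff_def algebra_simps scaleR_add_left[symmetric])

lemma dist_conj_local_lipschitz:
  assumes "norm x \<le> R" "norm z \<le> 1"
  shows "\<bar>dist_conj K (x + z) - dist_conj K x\<bar> \<le> norm z * (2 * R + infdist 0 K + 1)"
proof -
  let ?d = "infdist x K" and ?d' = "infdist (x + z) K"
  have 1: "\<bar>?d' - ?d\<bar> \<le> norm z" using infdist_triangle_abs[of "x + z" K x] by (simp add: dist_norm)
  have 2: "?d \<le> R + infdist 0 K" using infdist_triangle[of x K 0] assms(1) by (simp add: dist_norm)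
  have "\<bar>?d'\<^sup>2 - ?d\<^sup>2\<bar> = \<bar>?d' - ?d\<bar> * \<bar>?d' + ?d\<bar>" by (simp add: power2_eq_square square_diff_square_factored abs_mult mult.commute)
  also have "\<dots> \<le> norm z * (2 * R + 2 * infdist 0 K + 1)"
    using 1 2 assms infdist_nonneg[of x K] infdist_nonneg[of "x+z" K] by (intro mult_mono) auto
  finally have 3: "\<bar>?d'\<^sup>2 - ?d\<^sup>2\<bar> \<le> norm z * (2 * R + 2 * infdist 0 K + 1)" .
  have "\<bar>2 * (x \<bullet> z) + z \<bullet> z\<bar> \<le> 2 * (norm x * norm z) + norm z * norm z"
  proof -
    have "z \<bullet> z = norm z * norm z" by (simp add: power2_norm_eq_inner[symmetric] power2_eq_square)
    then show ?thesis using Cauchy_Schwarz_ineq2[of x z] zero_le_square[of "norm z"] by linarith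
  qed
  also have "\<dots> \<le> 2 * (R * norm z) + 1 * norm z"
    using assms by (intro add_mono mult_left_mono mult_right_mono) auto
  also have "\<dots> = norm z * (2 * R + 1)" by (simp add: algebra_simps)
  finally have 4: "\<bar>2 * (x \<bullet> z) + z \<bullet> z\<bar> \<le> norm z * (2 * R + 1)" .
  have "2 * (dist_conj K (x + z) - dist_conj K x) = (2 * (x \<bullet> z) + z \<bullet> z) - (?d'\<^sup>2 - ?d\<^sup>2)"
    by (simp add: dist_conj_def inner_add_left inner_add_right inner_commute field_simps)
  then have "\<bar>2 * (dist_conj K (x + z) - dist_conj K x)\<bar> \<le> norm z * (2 * R + 1) + norm z * (2 * R + 2 * infdist 0 K + 1)"
    using 3 4 by linarith
  then show ?thesis by (simp add: algebra_simps)
qed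

text \<open>Moving one of the two differences onto the Lipschitz cut-off \<open>max 0 (R - |x|)\<close> by translation invariance
gains a second factor \<open>h\<close>.\<close>

lemma integral_second_diff_le:
  fixes e :: "'a::euclidean_space" and K
  assumes "norm e = 1" "R > 0"
  obtains C where "C > 0" "\<And>h. 0 < h \<Longrightarrow> h \<le> 1 \<Longrightarrow>
    (LINT x|lborel. max 0 (R - norm x) * second_diff (dist_conj K) (h *\<^sub>R e) x) \<le> C * h\<^sup>2"
proof -
  define L where "L = 2 * (R + 1) + infdist 0 K + 1"
  have L: "L > 0" using assms infdist_nonneg[of 0 K] by (simp add: L_def)
  define B where "B = measure lborel (cball (0::'a) (R + 1))"
  let ?w = "dist_conj K" and ?\<chi> = "\<lambda>x::'a. max 0 (R - norm x)"
  have "(LINT x|lborel. ?\<chi> x * second_diff ?w (h *\<^sub>R e) x) \<le> (L * B + 1) * h\<^sup>2" if h: "0 < h" "h \<le> 1" for h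
  proof -
    let ?D = "\<lambda>x. ?w (x + h *\<^sub>R e) - ?w x"
    have cD: "continuous_on UNIV ?D"
      by (intro continuous_intros continuous_on_compose2[OF continuous_dist_conj[of UNIV]]) auto
    have c1: "continuous_on UNIV (\<lambda>x. ?\<chi> x * ?D x)" by (intro continuous_intros cD)
    have b1: "bounded {x. ?\<chi> x * ?D x \<noteq> 0}" by (rule bounded_subset[OF bounded_cball[of "0::'a" R]]) (auto simp: max_def split: if_splits)
    have c2: "continuous_on UNIV (\<lambda>x. ?\<chi> (x + h *\<^sub>R e) * ?D x)" by (intro continuous_intros cD)
    have far: "?\<chi> (x + h *\<^sub>R e) = 0" "?\<chi> x = 0" if "x \<notin> cball 0 (R + 1)" for x
      using that norm_triangle_ineq4[of "x + h *\<^sub>R e" "h *\<^sub>R e"] assms h by auto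
    have b2: "bounded {x. ?\<chi> (x + h *\<^sub>R e) * ?D x \<noteq> 0}" by (rule bounded_subset[OF bounded_cball[of "0::'a" "R + 1"]]) (rule subsetI, rule ccontr, drule far(1), simp)
    note i1 = integrable_continuous_bounded_support[OF c1 b1] and i2 = integrable_continuous_bounded_support[OF c2 b2]
    let ?g = "\<lambda>x. ?\<chi> (x + h *\<^sub>R e) * ?D x"
    have t: "(\<lambda>x. ?g (x - h *\<^sub>R e)) = (\<lambda>x. ?\<chi> x * (?w x - ?w (x - h *\<^sub>R e)))" by simp
    have i3: "integrable lborel (\<lambda>x. ?\<chi> x * (?w x - ?w (x - h *\<^sub>R e)))"
      by (intro integrable_continuous_bounded_support continuous_intros continuous_on_compose2[OF continuous_dist_conj[of UNIV]]
          bounded_subset[OF bounded_cball[of "0::'a" R]]) (auto simp: max_def split: if_splits)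
    have "(LINT x|lborel. ?\<chi> x * second_diff ?w (h *\<^sub>R e) x) = (LINT x|lborel. ?\<chi> x * ?D x - ?\<chi> x * (?w x - ?w (x - h *\<^sub>R e)))"
      by (rule Bochner_Integration.integral_cong) (auto simp: second_diff_def algebra_simps)
    also have "\<dots> = (LINT x|lborel. ?\<chi> x * ?D x) - (LINT x|lborel. ?\<chi> x * (?w x - ?w (x - h *\<^sub>R e)))"
      by (rule Bochner_Integration.integral_diff[OF i1 i3])
    also have "(LINT x|lborel. ?\<chi> x * (?w x - ?w (x - h *\<^sub>R e))) = (LINT x|lborel. ?g x)"
      using lborel_integral_translate[OF borel_measurable_continuous_onI[OF c2], of "- (h *\<^sub>R e)"] unfolding t[symmetric] by simp
    also have "(LINT x|lborel. ?\<chi> x * ?D x) - (LINT x|lborel. ?g x) = (LINT x|lborel. ?\<chi> x * ?D x - ?g x)"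
      by (rule Bochner_Integration.integral_diff[OF i1 i2, symmetric])
    also have "\<dots> \<le> (LINT x|lborel. (L * h\<^sup>2) * indicator (cball 0 (R + 1)) (x::'a))"
    proof (rule Bochner_Integration.integral_mono)
      show "integrable lborel (\<lambda>x. ?\<chi> x * ?D x - ?g x)" by (intro Bochner_Integration.integrable_diff i1 i2)
      show "integrable lborel (\<lambda>x::'a. (L * h\<^sup>2) * indicator (cball 0 (R + 1)) x)"
        by (intro integrable_mult_right integrable_real_indicator emeasure_bounded_finite bounded_cball) simp
      show "?\<chi> x * ?D x - ?g x \<le> (L * h\<^sup>2) * indicator (cball 0 (R + 1)) x" for x
      proof (cases "x \<in> cball 0 (R + 1)")
        case True
        have "\<bar>norm (x + h *\<^sub>R e) - norm x\<bar> \<le> h" using norm_triangle_ineq3[of "x + h *\<^sub>R e" x] assms h by simp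
        then have 1: "\<bar>?\<chi> x - ?\<chi> (x + h *\<^sub>R e)\<bar> \<le> h" by linarith
        have 2: "\<bar>?D x\<bar> \<le> h * L"
          using dist_conj_local_lipschitz[of x "R + 1" "h *\<^sub>R e" K] True assms h by (simp add: L_def)
        have "?\<chi> x * ?D x - ?g x \<le> \<bar>(?\<chi> x - ?\<chi> (x + h *\<^sub>R e)) * ?D x\<bar>"
          by (rule order_trans[OF _ abs_ge_self]) (simp add: left_diff_distrib)
        also have "\<dots> \<le> h * (h * L)" unfolding abs_mult using 1 2 h by (intro mult_mono) auto
        finally show ?thesis using True by (simp add: power2_eq_square mult_ac)
      qed (simp add: far)
    qed
    also have "\<dots> = L * h\<^sup>2 * B" by (simp add: B_def)
    also have "\<dots> \<le> (L * B + 1) * h\<^sup>2" by (simp add: algebra_simps)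
    finally show ?thesis .
  qed
  moreover have "L * B + 1 > 0" using L by (simp add: B_def add_nonneg_pos)
  ultimately show thesis using that by blast
qed

text \<open>For a convex function the second difference quotients are nonnegative, and by the preceding bound their
weighted integrals tend to \<open>0\<close> with \<open>h\<close>; hence their infimum over \<open>h\<close> vanishes almost everywhere.\<close>

lemma AE_second_diff_small:
  fixes e :: "'a::euclidean_space"
  assumes K: "closed K" "K \<noteq> {}" and e: "norm e = 1"
  shows "AE x in lborel. \<forall>\<epsilon>>0. \<exists>h>0. second_diff (dist_conj K) (h *\<^sub>R e) x < \<epsilon> * h"
proof -
  have "AE x in lborel. norm x < real (Suc m) \<longrightarrow> (\<forall>\<epsilon>>0. \<exists>h>0. second_diff (dist_conj K) (h *\<^sub>R e) x < \<epsilon> * h)" for m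
  proof -
    let ?R = "real (Suc m)"
    obtain C where C: "C > 0" "\<And>h. 0 < h \<Longrightarrow> h \<le> 1 \<Longrightarrow>
        (LINT x|lborel. max 0 (?R - norm x) * second_diff (dist_conj K) (h *\<^sub>R e) x) \<le> C * h\<^sup>2"
      using integral_second_diff_le[OF e, of ?R K] by auto
    let ?h = "\<lambda>n. 1 / real (Suc n)"
    let ?f = "\<lambda>n x. max 0 (?R - norm x) * second_diff (dist_conj K) (?h n *\<^sub>R e) x / ?h n"
    have cf: "continuous_on UNIV (?f n)" for n
      unfolding second_diff_def
      by (intro continuous_intros continuous_on_compose2[OF continuous_dist_conj[of UNIV]]) auto
    have mf [measurable]: "?f n \<in> borel_measurable borel" for n by (rule borel_measurable_continuous_onI[OF cf])
    have f0: "0 \<le> ?f n x" for n x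
      by (intro divide_nonneg_nonneg mult_nonneg_nonneg second_diff_nonneg convex_dist_conj K) auto
    have "integrable lborel (?f n)" for n
      by (intro integrable_continuous_bounded_support cf bounded_subset[OF bounded_cball[of "0::'a" ?R]])
        (auto simp: max_def split: if_splits)
    then have fn: "(\<integral>\<^sup>+x. ennreal (?f n x) \<partial>lborel) = ennreal (LINT x|lborel. ?f n x)" for n
      by (intro nn_integral_eq_integral AE_I2 f0)
    have "(LINT x|lborel. ?f n x) \<le> C * ?h n" for n
    proof -
      have "(LINT x|lborel. ?f n x) = (LINT x|lborel. max 0 (?R - norm x) * second_diff (dist_conj K) (?h n *\<^sub>R e) x) / ?h n"
        by simp
      also have "\<dots> \<le> C * (?h n)\<^sup>2 / ?h n" by (intro divide_right_mono C) auto
      finally show ?thesis by (simp add: power2_eq_square)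
    qed
    then have "(\<integral>\<^sup>+x. (INF n. ennreal (?f n x)) \<partial>lborel) \<le> ennreal (C * ?h n)" for n
      by (rule order_trans[OF nn_integral_mono, rotated, OF order_trans[OF eq_refl[OF fn] ennreal_leI]]) (rule INF_lower, simp)
    moreover have "(\<lambda>n. ennreal (C * ?h n)) \<longlonglongrightarrow> ennreal (C * 0)"
      by (intro tendsto_ennrealI tendsto_mult_left LIMSEQ_Suc[OF lim_1_over_n])
    ultimately have "(\<integral>\<^sup>+x. (INF n. ennreal (?f n x)) \<partial>lborel) \<le> ennreal (C * 0)"
      by (intro LIMSEQ_le_const[of _ _ "\<integral>\<^sup>+x. (INF n. ennreal (?f n x)) \<partial>lborel"]) auto
    then have "(\<integral>\<^sup>+x. (INF n. ennreal (?f n x)) \<partial>lborel) = 0" by simp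
    moreover have "(\<lambda>x. INF n. ennreal (?f n x)) \<in> borel_measurable lborel"
      by (intro borel_measurable_INF measurable_compose[OF _ measurable_ennreal]) (use mf in simp_all)
    ultimately have "AE x in lborel. (INF n. ennreal (?f n x)) = 0"
      by (simp only: nn_integral_0_iff_AE)
    then show ?thesis
    proof eventually_elim
      case (elim x)
      show ?case
      proof (intro impI allI)
        fix \<epsilon> :: real assume x: "norm x < ?R" and \<epsilon>: "\<epsilon> > 0"
        then have "(INF n. ennreal (?f n x)) < ennreal ((?R - norm x) * \<epsilon>)" using elim by (simp del: of_nat_Suc)
        then obtain n where "ennreal (?f n x) < ennreal ((?R - norm x) * \<epsilon>)" by (auto simp: INF_less_iff)
        then have "?f n x < (?R - norm x) * \<epsilon>" using f0[of x n] by (subst (asm) ennreal_less_iff) auto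
        then have "(?R - norm x) * (second_diff (dist_conj K) (?h n *\<^sub>R e) x / ?h n) < (?R - norm x) * \<epsilon>"
          using x by (simp add: max_def del: of_nat_Suc)
        then have "second_diff (dist_conj K) (?h n *\<^sub>R e) x / ?h n < \<epsilon>" using x by (simp only: mult_less_cancel_left_pos diff_gt_0_iff_gt)
        then have "second_diff (dist_conj K) (?h n *\<^sub>R e) x < \<epsilon> * ?h n" by (subst (asm) pos_divide_less_eq) auto
        then show "\<exists>h>0. second_diff (dist_conj K) (h *\<^sub>R e) x < \<epsilon> * h" by (intro exI[of _ "?h n"]) auto
      qed
    qed
  qed
  then have "AE x in lborel. \<forall>m. norm x < real (Suc m) \<longrightarrow> (\<forall>\<epsilon>>0. \<exists>h>0. second_diff (dist_conj K) (h *\<^sub>R e) x < \<epsilon> * h)"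
    by (subst AE_all_countable) auto
  then show ?thesis
  proof eventually_elim
    case (elim x)
    obtain m where "norm x < real m" using reals_Archimedean2 by blast
    then have "norm x < real (Suc m)" by simp
    with elim show ?case by blast
  qed
qed

lemma convex_ray_le:
  assumes k: "convex_on UNIV k" "k 0 = (0::real)" and "0 \<le> t" "t \<le> h" "0 < h"
  shows "k (t *\<^sub>R z) \<le> t / h * k (h *\<^sub>R z)"
  using convex_onD[OF k(1), of "t / h" 0 "h *\<^sub>R z"] assms by simp

text \<open>Subtracting the subgradient \<open>y\<close> leaves a nonnegative convex function \<open>k\<close> with \<open>k 0 = 0\<close>. Small second
differences make \<open>k\<close> of order \<open>o(|t|)\<close> along each coordinate axis, and by convexity the values on the
axes control \<open>k\<close> in all directions.\<close>

lemma dist_conj_has_derivative: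
  fixes K :: "'a::euclidean_space set"
  assumes K: "closed K" "K \<noteq> {}" and y: "y \<in> K" "infdist x K = dist x y"
    and small: "\<And>i \<epsilon>. i \<in> Basis \<Longrightarrow> \<epsilon> > 0 \<Longrightarrow> \<exists>h>0. second_diff (dist_conj K) (h *\<^sub>R i) x < \<epsilon> * h"
  shows "(dist_conj K has_derivative (\<lambda>z. y \<bullet> z)) (at x)"
proof -
  let ?N = "real DIM('a)"
  define k where "k z = dist_conj K (x + z) - dist_conj K x - y \<bullet> z" for z
  have k0: "0 \<le> k z" for z using dist_conj_subgradient[OF y, of z] by (simp add: k_def)
  have kz: "k 0 = 0" by (simp add: k_def)
  have kc: "convex_on UNIV k"
  proof (rule convex_onI)
    fix t :: real and u v assume t: "0 < t" "t < 1"
    have "x + ((1 - t) *\<^sub>R u + t *\<^sub>R v) = (1 - t) *\<^sub>R (x + u) + t *\<^sub>R (x + v)" by (simp add: algebra_simps)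
    then have "dist_conj K (x + ((1 - t) *\<^sub>R u + t *\<^sub>R v)) \<le> (1 - t) * dist_conj K (x + u) + t * dist_conj K (x + v)"
      using convex_onD[OF convex_dist_conj[OF K], of t "x + u" "x + v"] t by simp
    then show "k ((1 - t) *\<^sub>R u + t *\<^sub>R v) \<le> (1 - t) * k u + t * k v"
      by (simp add: k_def inner_add_right algebra_simps)
  qed auto
  show ?thesis
    unfolding has_derivative_at_alt
  proof (intro conjI allI impI)
    fix \<epsilon> :: real assume \<epsilon>: "\<epsilon> > 0"
    have "\<exists>h. \<forall>i\<in>Basis. 0 < h i \<and> second_diff (dist_conj K) (h i *\<^sub>R i) x < (\<epsilon> / ?N) * h i"
      using small[of _ "\<epsilon> / ?N"] \<epsilon> by (intro bchoice) auto
    then obtain h where h: "\<And>i. i \<in> Basis \<Longrightarrow> 0 < h i"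
       "\<And>i. i \<in> Basis \<Longrightarrow> second_diff (dist_conj K) (h i *\<^sub>R i) x < (\<epsilon> / ?N) * h i" by blast
    define d where "d = Min (h ` Basis) / ?N"
    have d: "d > 0" "\<And>i. i \<in> Basis \<Longrightarrow> ?N * d \<le> h i"
      using h(1) by (auto simp: d_def)
    have axis: "k (t *\<^sub>R i) \<le> (\<epsilon> / ?N) * \<bar>t\<bar>" if i: "i \<in> Basis" and t: "\<bar>t\<bar> \<le> h i" for i t
    proof -
      have s: "k (h i *\<^sub>R i) + k (- (h i *\<^sub>R i)) = second_diff (dist_conj K) (h i *\<^sub>R i) x"
        by (simp add: k_def second_diff_def)
      have "k (t *\<^sub>R i) = k (\<bar>t\<bar> *\<^sub>R (sgn t *\<^sub>R i))" by (simp add: abs_mult_sgn)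
      also have "\<dots> \<le> \<bar>t\<bar> / h i * k (h i *\<^sub>R (sgn t *\<^sub>R i))"
        by (rule convex_ray_le[OF kc kz]) (use t h(1)[OF i] in auto)
      also have "\<dots> \<le> \<bar>t\<bar> / h i * second_diff (dist_conj K) (h i *\<^sub>R i) x"
        using s k0[of "h i *\<^sub>R i"] k0[of "- (h i *\<^sub>R i)"] h(1)[OF i]
        by (intro mult_left_mono) (auto simp: sgn_if kz)
      also have "\<dots> \<le> \<bar>t\<bar> / h i * ((\<epsilon> / ?N) * h i)"
        using h[OF i] by (intro mult_left_mono) auto
      also have "\<dots> = (\<epsilon> / ?N) * \<bar>t\<bar>" using h(1)[OF i] by simp
      finally show ?thesis .
    qed
    have bound: "k z \<le> \<epsilon> * norm z" if z: "norm z < d" for z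
    proof -
      have "k z = k (\<Sum>i\<in>Basis. (1 / ?N) *\<^sub>R ((?N * (z \<bullet> i)) *\<^sub>R i))"
        by (simp add: euclidean_representation)
      also have "\<dots> \<le> (\<Sum>i\<in>Basis. (1 / ?N) * k ((?N * (z \<bullet> i)) *\<^sub>R i))"
        by (rule convex_on_sum[OF _ _ kc]) auto
      also have "\<dots> \<le> (\<Sum>i\<in>(Basis::'a set). (1 / ?N) * (\<epsilon> * norm z))"
      proof (rule sum_mono)
        fix i :: 'a assume i: "i \<in> Basis"
        have zi: "\<bar>z \<bullet> i\<bar> \<le> norm z" using i by (rule Basis_le_norm)
        then have "?N * \<bar>z \<bullet> i\<bar> \<le> ?N * d" using z by (intro mult_left_mono) auto
        then have "k ((?N * (z \<bullet> i)) *\<^sub>R i) \<le> (\<epsilon> / ?N) * \<bar>?N * (z \<bullet> i)\<bar>"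
          using d(2)[OF i] by (intro axis[OF i]) (simp only: abs_mult abs_of_nat)
        also have "\<dots> \<le> \<epsilon> * norm z" using zi \<epsilon> by (simp add: abs_mult)
        finally have "k ((?N * (z \<bullet> i)) *\<^sub>R i) \<le> \<epsilon> * norm z" .
        then show "(1 / ?N) * k ((?N * (z \<bullet> i)) *\<^sub>R i) \<le> (1 / ?N) * (\<epsilon> * norm z)"
          by (intro mult_left_mono) auto
      qed
      also have "\<dots> = \<epsilon> * norm z" by simp
      finally show ?thesis .
    qed
    show "\<exists>d>0. \<forall>z. norm (z - x) < d \<longrightarrow> norm (dist_conj K z - dist_conj K x - y \<bullet> (z - x)) \<le> \<epsilon> * norm (z - x)"
    proof (intro exI[of _ d] conjI allI impI d(1))
      fix z assume "norm (z - x) < d"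
      then show "norm (dist_conj K z - dist_conj K x - y \<bullet> (z - x)) \<le> \<epsilon> * norm (z - x)"
        using bound[of "z - x"] k0[of "z - x"] by (simp add: k_def)
    qed
  qed (rule bounded_linear_inner_right)
qed

text \<open>Where \<open>dist_conj K\<close> has gradient \<open>y\<close>, a nearest point, \<open>d\<^sup>2 = |x|\<^sup>2 - 2 dist_conj K x\<close> has gradient
\<open>2 (x - y)\<close>, and \<open>|x - y| = d\<close>.\<close>

lemma infdist_has_unit_gradient_AE:
  fixes K :: "'a::euclidean_space set"
  assumes K: "closed K" "K \<noteq> {}"
  shows "AE x in lborel. x \<notin> K \<longrightarrow>
    (\<exists>p. norm p = 1 \<and> ((\<lambda>x. infdist x K) has_derivative (\<lambda>z. p \<bullet> z)) (at x))"
proof -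
  have "AE x in lborel. \<forall>i\<in>Basis. \<forall>\<epsilon>>0. \<exists>h>0. second_diff (dist_conj K) (h *\<^sub>R i) x < \<epsilon> * h"
    by (intro AE_ball_countable[THEN iffD2] ballI AE_second_diff_small K countable_finite) auto
  then show ?thesis
  proof (eventually_elim, intro impI)
    case (elim x)
    assume "x \<notin> K"
    then have d: "infdist x K > 0" using K by (simp add: infdist_pos_not_in_closed)
    obtain y where y: "y \<in> K" "infdist x K = dist x y" using infdist_attains_inf[OF K] by metis
    have "(dist_conj K has_derivative (\<lambda>z. y \<bullet> z)) (at x)"
      using elim by (intro dist_conj_has_derivative[OF K y]) auto
    then have "((\<lambda>x. x \<bullet> x - 2 * dist_conj K x) has_derivative (\<lambda>z. 2 * ((x - y) \<bullet> z))) (at x)"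
      by (auto intro!: derivative_eq_intros simp: inner_diff_left inner_diff_right inner_commute right_diff_distrib)
    moreover have "(\<lambda>x. x \<bullet> x - 2 * dist_conj K x) = (\<lambda>x. (infdist x K)\<^sup>2)"
      by (auto simp: dist_conj_def field_simps)
    ultimately have sq: "((\<lambda>x. (infdist x K)\<^sup>2) has_derivative (\<lambda>z. 2 * ((x - y) \<bullet> z))) (at x)" by simp
    have "((\<lambda>x. sqrt ((infdist x K)\<^sup>2)) has_derivative (\<lambda>z. ((1 / infdist x K) *\<^sub>R (x - y)) \<bullet> z)) (at x)"
      by (rule has_derivative_eq_rhs[OF DERIV_compose_FDERIV[OF DERIV_real_sqrt sq]])
        (use d in \<open>auto simp: fun_eq_iff inner_diff_left divide_simps\<close>)
    then have "((\<lambda>x. infdist x K) has_derivative (\<lambda>z. ((1 / infdist x K) *\<^sub>R (x - y)) \<bullet> z)) (at x)"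
      by (simp add: infdist_nonneg)
    moreover have "norm ((1 / infdist x K) *\<^sub>R (x - y)) = 1" using d y(2) by (simp add: dist_norm)
    ultimately show "\<exists>p. norm p = 1 \<and> ((\<lambda>x. infdist x K) has_derivative (\<lambda>z. p \<bullet> z)) (at x)" by blast
  qed
qed

section \<open>Volume between level sets of the distance\<close>

lemma C_k_inner_const: "C_k k \<phi> \<Longrightarrow> C_k k (\<lambda>x. \<phi> x \<bullet> i)"
proof (induction k arbitrary: \<phi>)
  case 0
  then show ?case by (auto intro: continuous_intros)
next
  case (Suc k)
  show ?case
  proof (rule C_k_cong_derivative)
    show "((\<lambda>x. \<phi> x \<bullet> i) has_derivative (\<lambda>h. frechet_derivative \<phi> (at x) h \<bullet> i)) (at x)" for x
      by (rule has_derivative_inner_left[OF C_k_Suc_has_derivative[OF Suc.prems]])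
    show "C_k k (\<lambda>x. frechet_derivative \<phi> (at x) j \<bullet> i)" if "j \<in> Basis" for j
      by (rule Suc.IH) (use Suc.prems that in auto)
  qed
qed

lemma divergence_components:
  assumes "C_k (Suc 0) \<phi>"
  shows "divergence \<phi> x = (\<Sum>i\<in>Basis. frechet_derivative (\<lambda>x. \<phi> x \<bullet> i) (at x) i)"
proof -
  have "((\<lambda>x. \<phi> x \<bullet> i) has_derivative (\<lambda>h. frechet_derivative \<phi> (at x) h \<bullet> i)) (at x)" for i
    by (rule has_derivative_inner_left[OF C_k_Suc_has_derivative[OF assms]])
  then have "frechet_derivative (\<lambda>x. \<phi> x \<bullet> i) (at x) = (\<lambda>h. frechet_derivative \<phi> (at x) h \<bullet> i)" for i
    by (rule frechet_derivative_eq)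
  then show ?thesis by (simp add: divergence_def)
qed

lemma continuous_divergence:
  assumes "C_k (Suc 0) \<phi>"
  shows "continuous_on UNIV (divergence \<phi>)"
  unfolding divergence_def[abs_def] using assms by (intro continuous_intros) auto

lemma bounded_support_divergence:
  assumes "bounded {x. \<phi> x \<noteq> 0}"
  shows "bounded {x. divergence \<phi> x \<noteq> 0}"
  by (rule bounded_subset[OF bounded_closure[OF assms]])
    (use frechet_derivative_eq_0_off_closure[of _ \<phi>] in \<open>force simp: divergence_def\<close>)

lemma continuous_gradient:
  assumes "C_k (Suc 0) f"
  shows "continuous_on UNIV (gradient f)"
  unfolding gradient_def[abs_def] using assms by (intro continuous_intros) auto

lemma bounded_support_gradient:
  assumes "bounded {x. f x \<noteq> 0}"
  shows "bounded {x. gradient f x \<noteq> 0}"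
  by (rule bounded_subset[OF bounded_closure[OF assms]])
    (use frechet_derivative_eq_0_off_closure[of _ f] in \<open>force simp: gradient_def\<close>)

lemma C_k_gradient: "C_k (Suc k) f \<Longrightarrow> C_k k (gradient f)"
  unfolding gradient_def[abs_def] by (intro C_k_sum C_k_scaleR C_k_const) simp

lemma divergence_theorem_product:
  assumes f: "C_k (Suc 0) f" and \<phi>: "C_k (Suc 0) \<phi>" "bounded {x. \<phi> x \<noteq> 0}"
  shows "(LINT x|lborel. f x * divergence \<phi> x) = - (LINT x|lborel. gradient f x \<bullet> \<phi> x)"
proof -
  let ?d = "\<lambda>i x. frechet_derivative (\<lambda>x. \<phi> x \<bullet> i) (at x) i"
  have \<phi>i: "C_k (Suc 0) (\<lambda>x. \<phi> x \<bullet> i)" for i by (rule C_k_inner_const[OF \<phi>(1)])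
  have bi: "bounded {x. \<phi> x \<bullet> i \<noteq> 0}" for i by (rule bounded_subset[OF \<phi>(2)]) auto
  have c: "continuous_on UNIV f" using C_k_continuous f by blast
  have i1: "integrable lborel (\<lambda>x. f x * ?d i x)" if "i \<in> Basis" for i
    using \<phi>i[of i] that by (intro integrable_continuous_bounded_support continuous_intros c
        bounded_subset[OF bounded_support_derivative[OF bi, of i i]]) auto
  have i2: "integrable lborel (\<lambda>x. frechet_derivative f (at x) i * (\<phi> x \<bullet> i))" if "i \<in> Basis" for i
    using f that by (intro integrable_continuous_bounded_support continuous_on_mult C_k_continuous[OF \<phi>i]
        bounded_subset[OF bi[of i]]) auto
  have "(LINT x|lborel. f x * divergence \<phi> x) = (\<Sum>i\<in>Basis. LINT x|lborel. f x * ?d i x)"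
    using i1 by (simp add: divergence_components[OF \<phi>(1)] sum_distrib_left)
  also have "\<dots> = (\<Sum>i\<in>Basis. - (LINT x|lborel. frechet_derivative f (at x) i * (\<phi> x \<bullet> i)))"
    by (intro sum.cong refl integration_by_parts[OF f \<phi>i bi])
  also have "\<dots> = - (LINT x|lborel. (\<Sum>i\<in>Basis. frechet_derivative f (at x) i * (\<phi> x \<bullet> i)))"
    using i2 by (simp add: sum_negf)
  also have "(\<lambda>x. \<Sum>i\<in>Basis. frechet_derivative f (at x) i * (\<phi> x \<bullet> i)) = (\<lambda>x. gradient f x \<bullet> \<phi> x)"
    by (simp add: gradient_def inner_sum_left inner_commute[of "\<phi> _"] fun_eq_iff)
  finally show ?thesis .
qed

lemma borel_measurable_infdist [measurable]:
  "(\<lambda>x::'a::euclidean_space. infdist x K) \<in> borel_measurable borel"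
  by (intro borel_measurable_continuous_onI continuous_intros)

definition clamp_dist :: "'a::euclidean_space set \<Rightarrow> real \<Rightarrow> real \<Rightarrow> 'a \<Rightarrow> real" where
  "clamp_dist K t s x = min (max (infdist x K) t) s - t"

lemma clamp_dist_lipschitz: "\<bar>clamp_dist K t s x - clamp_dist K t s y\<bar> \<le> norm (x - y)"
  using infdist_triangle_abs[of x K y] by (simp add: clamp_dist_def dist_norm)

lemma continuous_clamp_dist: "continuous_on S (clamp_dist K t s)"
  unfolding clamp_dist_def[abs_def] by (intro continuous_intros)

lemma clamp_dist_gradient_AE:
  fixes K :: "'a::euclidean_space set"
  assumes K: "closed K" "K \<noteq> {}" and ts: "0 < t" "t < s"
    and null: "{x. infdist x K = t} \<in> null_sets lborel" "{x. infdist x K = s} \<in> null_sets lborel"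
  shows "AE x in lborel. \<exists>p. (clamp_dist K t s has_derivative (\<lambda>z. p \<bullet> z)) (at x) \<and>
     p \<bullet> p = indicator {x. t < infdist x K \<and> infdist x K < s} x"
  using infdist_has_unit_gradient_AE[OF K] AE_not_in[OF null(1)] AE_not_in[OF null(2)]
proof eventually_elim
  case (elim x)
  have op: "open {x. infdist x K < c}" "open {x. c < infdist x K}" for c
    by (intro open_Collect_less continuous_intros)+
  consider "infdist x K < t" | "infdist x K > s" | "t < infdist x K" "infdist x K < s"
    using elim by fastforce
  then show ?case
  proof cases
    case 1
    have "(clamp_dist K t s has_derivative (\<lambda>z. 0)) (at x)"
      by (rule has_derivative_transform_within_open[OF has_derivative_const[of 0] op(1)[of t]])
        (use 1 ts in \<open>auto simp: clamp_dist_def\<close>)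
    then show ?thesis using 1 by (intro exI[of _ 0]) auto
  next
    case 2
    have "(clamp_dist K t s has_derivative (\<lambda>z. 0)) (at x)"
      by (rule has_derivative_transform_within_open[OF has_derivative_const[of "s - t"] op(2)[of s]])
        (use 2 ts in \<open>auto simp: clamp_dist_def\<close>)
    then show ?thesis using 2 by (intro exI[of _ 0]) auto
  next
    case 3
    then have "x \<notin> K" using ts by auto
    then obtain p where p: "norm p = 1" "((\<lambda>x. infdist x K) has_derivative (\<lambda>z. p \<bullet> z)) (at x)" using elim by blast
    then have "((\<lambda>x. infdist x K - t) has_derivative (\<lambda>z. p \<bullet> z)) (at x)"
      by (auto intro!: derivative_eq_intros)
    then have "(clamp_dist K t s has_derivative (\<lambda>z. p \<bullet> z)) (at x)"
      by (rule has_derivative_transform_within_open[OF _ open_Int[OF op(2)[of t] op(1)[of s]]])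
        (use 3 ts in \<open>auto simp: clamp_dist_def\<close>)
    then show ?thesis using 3 p by (intro exI[of _ p]) (auto simp: power2_norm_eq_inner[symmetric])
  qed
qed

lemma mollify_eq_0:
  fixes f :: "'a::euclidean_space \<Rightarrow> real"
  assumes "0 < \<epsilon>" "continuous_on UNIV f" "\<And>w. norm w < \<epsilon> \<Longrightarrow> f (x - w) = 0"
  shows "mollify \<epsilon> f x = 0"
  using mollify_abs_le[OF assms(1,2), of x 0] assms(3) by simp

lemma mollify_tendsto:
  fixes f :: "'a::euclidean_space \<Rightarrow> real"
  assumes f: "continuous_on UNIV f" and \<epsilon>: "\<And>n. 0 < \<epsilon> n" "\<epsilon> \<longlonglongrightarrow> 0"
  shows "(\<lambda>n. mollify (\<epsilon> n) f x) \<longlonglongrightarrow> f x"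
proof (rule LIMSEQ_I)
  fix r :: real assume "r > 0"
  then obtain d where d: "d > 0" "\<And>y. dist y x < d \<Longrightarrow> dist (f y) (f x) < r / 2"
    using f by (metis continuous_on_eq_continuous_at open_UNIV UNIV_I continuous_at_eps_delta half_gt_zero dist_norm)
  obtain N where N: "\<And>n. n \<ge> N \<Longrightarrow> \<epsilon> n < d"
    using order_tendstoD(2)[OF \<epsilon>(2) d(1)] by (auto simp: eventually_sequentially)
  show "\<exists>no. \<forall>n\<ge>no. norm (mollify (\<epsilon> n) f x - f x) < r"
  proof (intro exI allI impI)
    fix n assume n: "n \<ge> N"
    have "\<bar>mollify (\<epsilon> n) f x - f x\<bar> \<le> r / 2"
    proof (rule mollify_close[OF \<epsilon>(1) f])
      show "\<bar>f (x - w) - f x\<bar> \<le> r / 2" if "norm w < \<epsilon> n" for w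
        using d(2)[of "x - w"] that N[OF n] by (simp add: dist_norm)
    qed
    then show "norm (mollify (\<epsilon> n) f x - f x) < r" using \<open>r > 0\<close> by simp
  qed
qed

lemma mollify_support_near:
  fixes f :: "'a::euclidean_space \<Rightarrow> real"
  assumes "0 < \<epsilon>" "\<epsilon> \<le> 1" "continuous_on UNIV f" "\<And>x. f x \<noteq> 0 \<Longrightarrow> norm x \<le> R" "mollify \<epsilon> f x \<noteq> 0"
  shows "norm x \<le> R + 1"
proof (rule ccontr)
  assume x: "\<not> norm x \<le> R + 1"
  have "f (x - w) = 0" if "norm w < \<epsilon>" for w
    using assms(4)[of "x - w"] norm_triangle_ineq2[of x w] x that assms(2) by fastforce
  from mollify_eq_0[OF assms(1,3) this] assms(5) show False by simp
qed

lemma gradient_support: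
  assumes "\<And>x. f x \<noteq> 0 \<Longrightarrow> norm x \<le> R" "gradient f x \<noteq> 0"
  shows "norm x \<le> R"
proof (rule ccontr)
  assume "\<not> norm x \<le> R"
  moreover have "closure {x. f x \<noteq> 0} \<subseteq> cball 0 R" by (rule closure_minimal) (use assms(1) in auto)
  ultimately have "x \<notin> closure {x. f x \<noteq> 0}" by auto
  then show False using assms(2) by (simp add: gradient_def frechet_derivative_eq_0_off_closure)
qed

text \<open>The fields are the negative gradients of the mollified truncated distance. They have norm at most one
because the truncated distance is 1-Lipschitz, and testing it against them yields, in the limit, the integral
of the squared length of its gradient, which is the volume between the two levels. The level sets have to be
null sets since the truncated distance is not differentiable there.\<close>

lemma clamp_dist_calibrating_fields:
  fixes K :: "'a::euclidean_space set"
  assumes K: "closed K" "K \<noteq> {}" "bounded (- K)" and ts: "0 < t" "t < s"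
    and null: "{x. infdist x K = t} \<in> null_sets lborel" "{x. infdist x K = s} \<in> null_sets lborel"
  obtains \<phi> :: "nat \<Rightarrow> 'a \<Rightarrow> 'a" where
    "\<And>n. C_k (Suc 0) (\<phi> n)" "\<And>n. bounded {x. \<phi> n x \<noteq> 0}" "\<And>n x. norm (\<phi> n x) \<le> 1"
    "(\<lambda>n. LINT x|lborel. clamp_dist K t s x * divergence (\<phi> n) x)
        \<longlonglongrightarrow> measure lborel {x. t < infdist x K \<and> infdist x K < s}"
proof -
  let ?g = "clamp_dist K t s" and ?A = "{x. t < infdist x K \<and> infdist x K < s}"
  define \<epsilon> where "\<epsilon> n = 1 / real (Suc n)" for n
  have \<epsilon>: "\<And>n. 0 < \<epsilon> n" "\<And>n. \<epsilon> n \<le> 1" "\<epsilon> \<longlonglongrightarrow> 0"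
    by (auto simp: \<epsilon>_def[abs_def] intro: LIMSEQ_Suc[OF lim_1_over_n] simp del: of_nat_Suc)
  note cg = continuous_clamp_dist[of UNIV K t s]
  obtain R0 where R0: "\<And>x. x \<in> - K \<Longrightarrow> norm x \<le> R0" using K(3) by (auto simp: bounded_iff)
  have gR: "norm x \<le> R0" if "?g x \<noteq> 0" for x
    by (rule R0) (use that ts in \<open>auto simp: clamp_dist_def\<close>)
  define G where "G n = mollify (\<epsilon> n) ?g" for n
  have CG: "C_k k (G n)" for k n unfolding G_def by (rule C_k_mollify[OF \<epsilon>(1) cg])
  have GR: "norm x \<le> R0 + 1" if "G n x \<noteq> 0" for n x
    by (rule mollify_support_near[OF \<epsilon>(1,2) cg gR that[unfolded G_def]])
  have gradR: "gradient (G n) x = 0" if "x \<notin> cball 0 (R0 + 1)" for n x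
    using gradient_support[of "G n" "R0 + 1" x] GR[of n] that by auto
  have grad1: "norm (gradient (G n) x) \<le> 1" for n x
    unfolding G_def by (rule mollify_gradient_le[OF \<epsilon>(1), of n "\<epsilon> n + 1"]) (auto simp: cg clamp_dist_lipschitz)
  have cgr: "continuous_on UNIV (gradient (G n))" for n by (rule continuous_gradient[OF CG])
  have [measurable]: "gradient (G n) \<in> borel_measurable borel" for n
    by (rule borel_measurable_continuous_onI[OF cgr])
  \<comment> \<open>the gradient of the truncated distance almost everywhere; as a limit of continuous functions it is Borel measurable\<close>
  define Dg where "Dg x = lim (\<lambda>n. gradient (G n) x)" for x
  have [measurable]: "Dg \<in> borel_measurable borel"
    unfolding Dg_def[abs_def] by (rule borel_measurable_lim_metric) measurable
  have AE_Dg: "AE x in lborel. (\<lambda>n. gradient (G n) x) \<longlonglongrightarrow> Dg x \<and> Dg x \<bullet> Dg x = indicator ?A x"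
    using clamp_dist_gradient_AE[OF K(1,2) ts null]
  proof eventually_elim
    case (elim x)
    then obtain p where p: "(?g has_derivative (\<lambda>z. p \<bullet> z)) (at x)" "p \<bullet> p = indicator ?A x" by blast
    have "(\<lambda>n. gradient (G n) x) \<longlonglongrightarrow> p"
      unfolding G_def using mollify_gradient_tendsto[OF cg p(1) \<epsilon>(1,3)] gradient_eqI[OF p(1)] by simp
    moreover from this have "Dg x = p" unfolding Dg_def by (rule limI)
    ultimately show ?case using p(2) by simp
  qed
  have normDg: "AE x in lborel. norm (Dg x) \<le> 1"
    using AE_Dg by eventually_elim (auto simp: norm_eq_sqrt_inner indicator_def)
  define \<phi> where "\<phi> n x = (- 1) *\<^sub>R gradient (G n) x" for n x
  have \<phi>1: "C_k (Suc 0) (\<phi> n)" for n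
    unfolding \<phi>_def[abs_def] by (intro C_k_scaleR C_k_const C_k_gradient CG)
  have \<phi>2: "bounded {x. \<phi> n x \<noteq> 0}" for n
    by (rule bounded_subset[OF bounded_cball[of "0::'a" "R0 + 1"]]) (use gradR in \<open>force simp: \<phi>_def\<close>)
  have \<phi>3: "norm (\<phi> n x) \<le> 1" for n x using grad1 by (simp add: \<phi>_def)
  have int1: "integrable lborel (\<lambda>x::'a. indicator (cball 0 (R0 + 1)) x :: real)"
    by (intro integrable_real_indicator emeasure_bounded_finite bounded_cball) simp
  have eq: "(LINT x|lborel. ?g x * divergence (\<phi> n) x) = (LINT x|lborel. Dg x \<bullet> gradient (G n) x)" for n
  proof -
    have cdiv: "continuous_on UNIV (divergence (\<phi> n))" by (rule continuous_divergence[OF \<phi>1])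
    have idiv: "integrable lborel (\<lambda>x. s * \<bar>divergence (\<phi> n) x\<bar>)"
      by (intro integrable_mult_right integrable_abs integrable_continuous_bounded_support cdiv bounded_support_divergence \<phi>2)
    have m: "divergence (\<phi> n) \<in> borel_measurable borel" "?g \<in> borel_measurable borel" "\<And>k. G k \<in> borel_measurable borel"
      by (intro borel_measurable_continuous_onI cdiv cg C_k_continuous[OF CG])+
    have "(\<lambda>k. LINT x|lborel. G k x * divergence (\<phi> n) x) \<longlonglongrightarrow> (LINT x|lborel. ?g x * divergence (\<phi> n) x)"
    proof (rule integral_dominated_convergence[OF _ _ idiv])
      show "AE x in lborel. (\<lambda>k. G k x * divergence (\<phi> n) x) \<longlonglongrightarrow> ?g x * divergence (\<phi> n) x"
        unfolding G_def by (intro AE_I2 tendsto_mult_right mollify_tendsto cg \<epsilon>)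
      show "AE x in lborel. norm (G k x * divergence (\<phi> n) x) \<le> s * \<bar>divergence (\<phi> n) x\<bar>" for k
      proof (intro AE_I2)
        fix x
        have "\<bar>G k x\<bar> \<le> s" unfolding G_def
          by (rule mollify_abs_le[OF \<epsilon>(1) cg]) (use ts in \<open>auto simp: clamp_dist_def\<close>)
        then show "norm (G k x * divergence (\<phi> n) x) \<le> s * \<bar>divergence (\<phi> n) x\<bar>"
          by (simp add: abs_mult mult_right_mono)
      qed
    qed (use m in simp_all)
    moreover have "(LINT x|lborel. G k x * divergence (\<phi> n) x) = (LINT x|lborel. gradient (G k) x \<bullet> gradient (G n) x)" for k
      unfolding divergence_theorem_product[OF CG \<phi>1 \<phi>2] by (simp add: \<phi>_def)
    moreover have "(\<lambda>k. LINT x|lborel. gradient (G k) x \<bullet> gradient (G n) x) \<longlonglongrightarrow> (LINT x|lborel. Dg x \<bullet> gradient (G n) x)"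
    proof (rule integral_dominated_convergence[OF _ _ int1])
      show "AE x in lborel. (\<lambda>k. gradient (G k) x \<bullet> gradient (G n) x) \<longlonglongrightarrow> Dg x \<bullet> gradient (G n) x"
        using AE_Dg by eventually_elim (auto intro: tendsto_intros)
      show "AE x in lborel. norm (gradient (G k) x \<bullet> gradient (G n) x) \<le> indicator (cball 0 (R0 + 1)) x" for k
      proof (intro AE_I2)
        fix x show "norm (gradient (G k) x \<bullet> gradient (G n) x) \<le> indicator (cball 0 (R0 + 1)) x"
        proof (cases "x \<in> cball 0 (R0 + 1)")
          case True
          have "\<bar>gradient (G k) x \<bullet> gradient (G n) x\<bar> \<le> norm (gradient (G k) x) * norm (gradient (G n) x)" by (rule Cauchy_Schwarz_ineq2)
          also have "\<dots> \<le> 1 * 1" by (intro mult_mono grad1) auto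
          finally show ?thesis using True by simp
        qed (simp add: gradR)
      qed
    qed measurable
    ultimately show ?thesis by (simp add: LIMSEQ_unique)
  qed
  have "(\<lambda>n. LINT x|lborel. Dg x \<bullet> gradient (G n) x) \<longlonglongrightarrow> (LINT x|lborel. Dg x \<bullet> Dg x)"
  proof (rule integral_dominated_convergence[OF _ _ int1])
    show "AE x in lborel. (\<lambda>n. Dg x \<bullet> gradient (G n) x) \<longlonglongrightarrow> Dg x \<bullet> Dg x"
      using AE_Dg by eventually_elim (intro tendsto_intros, blast)
    show "AE x in lborel. norm (Dg x \<bullet> gradient (G n) x) \<le> indicator (cball 0 (R0 + 1)) x" for n
      using normDg
    proof eventually_elim
      case (elim x)
      show ?case
      proof (cases "x \<in> cball 0 (R0 + 1)")
        case True
        have "\<bar>Dg x \<bullet> gradient (G n) x\<bar> \<le> norm (Dg x) * norm (gradient (G n) x)" by (rule Cauchy_Schwarz_ineq2)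
        also have "\<dots> \<le> 1 * 1" by (intro mult_mono grad1 elim) auto
        finally show ?thesis using True by simp
      qed (simp add: gradR)
    qed
  qed measurable
  also have "(LINT x|lborel. Dg x \<bullet> Dg x) = (LINT x|lborel. indicator ?A x)"
  proof (rule integral_cong_AE)
    have "{x. t < infdist x K \<and> infdist x K < s} \<in> sets lborel" by measurable
    then show "(\<lambda>x. indicator ?A x :: real) \<in> borel_measurable lborel" by measurable
    show "AE x in lborel. Dg x \<bullet> Dg x = indicator ?A x" using AE_Dg by eventually_elim auto
  qed measurable
  also have "\<dots> = measure lborel ?A" by simp
  finally show thesis using that[of \<phi>] \<phi>1 \<phi>2 \<phi>3 eq by simp
qed

lemma perimeter_ge:
  fixes \<phi> :: "'a::euclidean_space \<Rightarrow> 'a"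
  assumes "C_k (Suc 0) \<phi>" "bounded {x. \<phi> x \<noteq> 0}" "\<And>x. norm (\<phi> x) \<le> 1" "E \<in> sets borel"
  shows "ereal (LINT x|lborel. indicator E x * divergence \<phi> x) \<le> perimeter E"
proof -
  have [measurable]: "divergence \<phi> \<in> borel_measurable borel"
    by (intro borel_measurable_continuous_onI continuous_divergence assms)
  have "(LINT x:E|lebesgue. divergence \<phi> x) = (LINT x|lborel. indicator E x * divergence \<phi> x)"
    unfolding set_lebesgue_integral_def using assms(4) by (subst integral_completion) auto
  moreover have "compact_support_in UNIV \<phi>"
    using assms(2) by (auto simp: compact_support_in_def compact_eq_bounded_closed)
  ultimately show ?thesis
    unfolding perimeter_def using assms by (intro SUP_upper2[of \<phi>]) auto
qed

lemma perimeter_nonneg: "0 \<le> perimeter (E :: 'a::euclidean_space set)"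
proof -
  have "divergence (\<lambda>x::'a. 0::'a) = (\<lambda>x. 0)" by (auto simp: divergence_def frechet_derivative_const)
  then have "ereal (LINT x:E|lebesgue. divergence (\<lambda>x::'a. 0::'a) x) = 0"
    by (simp add: set_lebesgue_integral_def)
  moreover have "C_k (Suc 0) (\<lambda>x::'a. 0::'a)" by (rule C_k_const)
  ultimately show ?thesis
    unfolding perimeter_def by (intro SUP_upper2[of "\<lambda>x. 0"]) (auto simp: compact_support_in_def simp del: C_k.simps)
qed

lemma perimeter_empty: "perimeter {} = 0"
proof (rule antisym)
  show "perimeter {} \<le> 0" unfolding perimeter_def by (rule SUP_least) (simp add: set_lebesgue_integral_def)
qed (rule perimeter_nonneg)

text \<open>Fubini's theorem, for \<open>min (max d t) s - t = \<integral>\<^sub>t\<^sup>s 1{\<tau> \<le> d} d\<tau>\<close>.\<close>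

lemma clamp_dist_layer_cake:
  fixes F :: "'a::euclidean_space \<Rightarrow> real"
  assumes F: "continuous_on UNIV F" "bounded {x. F x \<noteq> 0}" and ts: "t \<le> s"
  shows "integrable lborel (\<lambda>\<tau>. indicator {t..s} \<tau> * (LINT x|lborel. indicator {x. \<tau> \<le> infdist x K} x * F x))"
    and "(LINT x|lborel. clamp_dist K t s x * F x) =
      (LINT \<tau>|lborel. indicator {t..s} \<tau> * (LINT x|lborel. indicator {x. \<tau> \<le> infdist x K} x * F x))"
proof -
  define f where "f x \<tau> = indicator {t..s} \<tau> * (indicator {x. \<tau> \<le> infdist x K} x * F x)" for x \<tau>
  have [measurable]: "F \<in> borel_measurable borel" by (rule borel_measurable_continuous_onI[OF F(1)])
  have set: "{(x, \<tau>). \<tau> \<le> infdist x K} \<in> sets (lborel \<Otimes>\<^sub>M lborel)"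
  proof -
    have "closed {p::'a \<times> real. snd p \<le> infdist (fst p) K}" by (intro closed_Collect_le continuous_intros)
    then have "{p::'a \<times> real. snd p \<le> infdist (fst p) K} \<in> sets (borel \<Otimes>\<^sub>M borel)"
      unfolding borel_prod by (rule borel_closed)
    moreover have "{(x::'a, \<tau>). \<tau> \<le> infdist x K} = {p. snd p \<le> infdist (fst p) K}" by auto
    ultimately show ?thesis by (simp only: sets_pair_measure_cong[OF sets_lborel sets_lborel])
  qed
  have "f = (\<lambda>x \<tau>. indicator {t..s} \<tau> * (indicator {(x, \<tau>). \<tau> \<le> infdist x K} (x, \<tau>) * F x))"
    by (auto simp: f_def fun_eq_iff indicator_def)
  then have meas: "case_prod f \<in> borel_measurable (lborel \<Otimes>\<^sub>M lborel)"
    using set by (simp add: case_prod_beta) measurable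
  have int_f: "(LINT \<tau>|lborel. f x \<tau>) = clamp_dist K t s x * F x"
    and int_nf: "(LINT \<tau>|lborel. norm (f x \<tau>)) = clamp_dist K t s x * norm (F x)"
    and i_f: "integrable lborel (f x)" for x
  proof -
    have *: "(\<lambda>\<tau>. f x \<tau>) = (\<lambda>\<tau>. F x * indicator {t..infdist x K} \<tau> * indicator {t..s} \<tau>)"
      by (auto simp: f_def fun_eq_iff indicator_def)
    define I where "I = {t..min (infdist x K) s}"
    have **: "(\<lambda>\<tau>. f x \<tau>) = (\<lambda>\<tau>. F x * indicator I \<tau>)"
      unfolding * I_def by (auto simp: fun_eq_iff indicator_def)
    have I: "measure lborel I = clamp_dist K t s x"
      using ts by (auto simp: I_def clamp_dist_def min_def max_def)
    have I': "integrable lborel (indicator I :: real \<Rightarrow> real)"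
      by (intro integrable_real_indicator emeasure_bounded_finite) (auto simp: I_def)
    show "(LINT \<tau>|lborel. f x \<tau>) = clamp_dist K t s x * F x"
      "(LINT \<tau>|lborel. norm (f x \<tau>)) = clamp_dist K t s x * norm (F x)" "integrable lborel (f x)"
      unfolding ** using I I' by (simp_all add: abs_mult)
  qed
  have iF: "integrable lborel (\<lambda>x. clamp_dist K t s x * F x)"
    by (intro integrable_continuous_bounded_support continuous_on_mult continuous_clamp_dist F bounded_subset[OF F(2)]) auto
  have inF: "integrable lborel (\<lambda>x. clamp_dist K t s x * norm (F x))"
    by (intro integrable_continuous_bounded_support continuous_on_mult continuous_on_norm continuous_clamp_dist F bounded_subset[OF F(2)]) auto
  have int: "integrable (lborel \<Otimes>\<^sub>M lborel) (case_prod f)"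
    by (rule lborel_pair.Fubini_integrable[OF meas]) (use int_nf inF i_f in auto)
  show "integrable lborel (\<lambda>\<tau>. indicator {t..s} \<tau> * (LINT x|lborel. indicator {x. \<tau> \<le> infdist x K} x * F x))"
    using lborel_pair.integrable_snd[OF int] by (simp add: f_def)
  show "(LINT x|lborel. clamp_dist K t s x * F x) =
      (LINT \<tau>|lborel. indicator {t..s} \<tau> * (LINT x|lborel. indicator {x. \<tau> \<le> infdist x K} x * F x))"
    using lborel_pair.Fubini_integral[OF int] by (simp add: int_f) (simp add: f_def)
qed

lemma closed_superlevel: "closed {x. \<tau> \<le> infdist x K}"
  by (intro closed_Collect_le continuous_intros)

lemma superlevel_measurable [measurable]:
  "{x. \<tau> \<le> infdist (x::'a::euclidean_space) K} \<in> sets borel"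
  by (intro borel_closed closed_superlevel)

text \<open>The coarea inequality. Testing the superlevel sets with the calibrating fields and integrating over the level
gives at most \<open>P (s - t)\<close> for each field. In the strict case the defect
\<open>P - \<integral>\<^bsub>{d \<ge> \<tau>}\<^esub> div \<phi>\<^sub>n\<close> is, for almost every \<open>\<tau>\<close>, bounded away from zero uniformly in
\<open>n\<close>, so that some of it survives in the limit.\<close>

lemma volume_between_null_levels:
  fixes K :: "'a::euclidean_space set"
  assumes K: "closed K" "K \<noteq> {}" "bounded (- K)" and ts: "0 < t" "t < s"
    and null: "{x. infdist x K = t} \<in> null_sets lborel" "{x. infdist x K = s} \<in> null_sets lborel"
    and P: "AE \<tau> in lborel. 0 < \<tau> \<longrightarrow> perimeter {x. \<tau> \<le> infdist x K} \<le> ereal P"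
  shows "measure lborel {x. t < infdist x K \<and> infdist x K < s} \<le> P * (s - t)" (is "?m \<le> _")
    and "(AE \<tau> in lborel. 0 < \<tau> \<longrightarrow> perimeter {x. \<tau> \<le> infdist x K} < ereal P) \<Longrightarrow>
       measure lborel {x. t < infdist x K \<and> infdist x K < s} < P * (s - t)"
proof -
  obtain \<phi> :: "nat \<Rightarrow> 'a \<Rightarrow> 'a" where \<phi>: "\<And>n. C_k (Suc 0) (\<phi> n)" "\<And>n. bounded {x. \<phi> n x \<noteq> 0}" "\<And>n x. norm (\<phi> n x) \<le> 1"
    and lim: "(\<lambda>n. LINT x|lborel. clamp_dist K t s x * divergence (\<phi> n) x) \<longlonglongrightarrow> ?m"
    using clamp_dist_calibrating_fields[OF K ts null] by blast
  define a where "a n \<tau> = (LINT x|lborel. indicator {x. \<tau> \<le> infdist x K} x * divergence (\<phi> n) x)" for n \<tau>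
  let ?I = "\<lambda>\<tau>. indicator {t..s} \<tau> :: real"
  have ia: "integrable lborel (\<lambda>\<tau>. ?I \<tau> * a n \<tau>)"
    and ea: "(LINT x|lborel. clamp_dist K t s x * divergence (\<phi> n) x) = (LINT \<tau>|lborel. ?I \<tau> * a n \<tau>)" for n
    unfolding a_def using ts
    by (intro clamp_dist_layer_cake continuous_divergence bounded_support_divergence \<phi>; simp)+
  have aP: "ereal (a n \<tau>) \<le> perimeter {x. \<tau> \<le> infdist x K}" for n \<tau>
    unfolding a_def by (intro perimeter_ge \<phi>) measurable
  have iI: "integrable lborel (\<lambda>\<tau>. ?I \<tau> * P)"
    by (intro integrable_mult_left integrable_real_indicator) (auto simp: ts less_imp_le)
  have II: "(LINT \<tau>|lborel. ?I \<tau> * P) = P * (s - t)" using ts by simp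
  let ?A = "\<lambda>n \<tau>. ?I \<tau> * P - ?I \<tau> * a n \<tau>"
  have iA: "integrable lborel (?A n)" for n by (intro Bochner_Integration.integrable_diff ia iI)
  have A0: "AE \<tau> in lborel. 0 \<le> ?A n \<tau>" for n
    using P
  proof eventually_elim
    case (elim \<tau>)
    show ?case
    proof (cases "\<tau> \<in> {t..s}")
      case True
      then have "ereal (a n \<tau>) \<le> ereal P" using elim ts by (intro order_trans[OF aP]) auto
      then show ?thesis using True by simp
    qed simp
  qed
  have IA: "(LINT \<tau>|lborel. ?A n \<tau>) = P * (s - t) - (LINT x|lborel. clamp_dist K t s x * divergence (\<phi> n) x)" for n
    unfolding Bochner_Integration.integral_diff[OF iI ia] II ea ..
  have limA: "(\<lambda>n. LINT \<tau>|lborel. ?A n \<tau>) \<longlonglongrightarrow> P * (s - t) - ?m"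
    unfolding IA by (intro tendsto_intros lim)
  show le: "?m \<le> P * (s - t)"
    using LIMSEQ_le_const[OF limA, of 0] integral_nonneg_AE[OF A0] by auto
  show "?m < P * (s - t)" if strict: "AE \<tau> in lborel. 0 < \<tau> \<longrightarrow> perimeter {x. \<tau> \<le> infdist x K} < ereal P"
  proof (rule ccontr)
    assume "\<not> ?m < P * (s - t)"
    then have "(\<lambda>n. LINT \<tau>|lborel. ?A n \<tau>) \<longlonglongrightarrow> 0" using limA le by simp
    then have "(\<lambda>n. ennreal (LINT \<tau>|lborel. ?A n \<tau>)) \<longlonglongrightarrow> ennreal 0" by (rule tendsto_ennrealI)
    moreover have "(\<integral>\<^sup>+\<tau>. (INF n. ennreal (?A n \<tau>)) \<partial>lborel) \<le> ennreal (LINT \<tau>|lborel. ?A n \<tau>)" for n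
      unfolding nn_integral_eq_integral[OF iA A0, symmetric] by (intro nn_integral_mono INF_lower) simp
    ultimately have "(\<integral>\<^sup>+\<tau>. (INF n. ennreal (?A n \<tau>)) \<partial>lborel) \<le> ennreal 0"
      by (intro LIMSEQ_le_const) auto
    then have "(\<integral>\<^sup>+\<tau>. (INF n. ennreal (?A n \<tau>)) \<partial>lborel) = 0" by simp
    moreover have "(\<lambda>\<tau>. INF n. ennreal (?A n \<tau>)) \<in> borel_measurable lborel"
      by (intro borel_measurable_INF measurable_compose[OF borel_measurable_integrable[OF iA] measurable_ennreal]) simp
    ultimately have "AE \<tau> in lborel. (INF n. ennreal (?A n \<tau>)) = 0" by (simp only: nn_integral_0_iff_AE)
    then have "AE \<tau> in lborel. \<tau> \<notin> {t..s}"
      using strict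
    proof eventually_elim
      case (elim \<tau>)
      show ?case
      proof
        assume \<tau>: "\<tau> \<in> {t..s}"
        then have "perimeter {x. \<tau> \<le> infdist x K} < ereal P" using elim ts by auto
        then obtain r where r: "perimeter {x. \<tau> \<le> infdist x K} < ereal r" "ereal r < ereal P" using ereal_dense2 by blast
        have "ennreal (P - r) \<le> ennreal (?A n \<tau>)" for n
        proof -
          have "ereal (a n \<tau>) < ereal r" using aP r(1) by (rule le_less_trans)
          then show ?thesis using \<tau> by (intro ennreal_leI) simp
        qed
        then have "ennreal (P - r) \<le> (INF n. ennreal (?A n \<tau>))" by (intro INF_greatest)
        then show False using elim(1) r(2) by simp
      qed
    qed
    then have "{t..s} \<in> null_sets lborel" using AE_iff_null_sets[of "{t..s}" lborel] by simp
    then show False using ts by (simp add: null_sets_def)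
  qed
qed

lemma emeasure_off_K_finite: "bounded (- K) \<Longrightarrow> closed K \<Longrightarrow> A \<subseteq> - K \<Longrightarrow> emeasure lborel A < \<infinity>"
  by (rule emeasure_bounded_finite) (rule bounded_subset)

text \<open>A finite measure on the line has at most countably many atoms.\<close>

lemma null_level_between:
  fixes K :: "'a::euclidean_space set"
  assumes K: "closed K" "bounded (- K)" and ab: "0 \<le> a" "a < b"
  obtains t where "a < t" "t < b" "{x. infdist x K = t} \<in> null_sets lborel"
proof -
  let ?M = "distr (restrict_space lborel (- K)) borel (\<lambda>x. infdist x K)"
  have oK: "- K \<in> sets lborel" using K(1) by (simp add: open_Compl)
  have m: "(\<lambda>x. infdist x K) \<in> restrict_space lborel (- K) \<rightarrow>\<^sub>M borel"
    by (rule measurable_restrict_space1) simp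
  have fin: "emeasure lborel (- K) < \<infinity>" using K(2) by (rule emeasure_bounded_finite)
  interpret finite_measure ?M
  proof
    show "emeasure ?M (space ?M) \<noteq> \<infinity>"
      using fin oK by (simp add: emeasure_distr[OF m] space_restrict_space emeasure_restrict_space)
  qed
  have "countable {t. measure ?M {t} \<noteq> 0}" by (rule countable_support)
  moreover have "uncountable {a<..<b}" using ab uncountable_open_interval by blast
  ultimately have "\<not> {a<..<b} \<subseteq> {t. measure ?M {t} \<noteq> 0}" using countable_subset by blast
  then obtain t where t: "a < t" "t < b" "measure ?M {t} = 0" by auto
  then have "emeasure ?M {t} = 0" by (simp add: emeasure_eq_measure)
  moreover have "emeasure ?M {t} = emeasure lborel {x. infdist x K = t}"
  proof -
    have "(\<lambda>x. infdist x K) -` {t} \<inter> (- K) = {x. infdist x K = t}" using t ab by auto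
    moreover have "{x. infdist x K = t} \<subseteq> - K" using t ab by auto
    ultimately show ?thesis using oK by (simp add: emeasure_distr[OF m] space_restrict_space emeasure_restrict_space)
  qed
  moreover have "{x. infdist x K = t} \<in> sets lborel" by measurable
  ultimately show thesis using that t by (auto simp: null_sets_def)
qed

text \<open>Enlarging the interval slightly to one whose end levels are null sets removes the null set hypotheses. With
\<open>s = t\<close> it follows that every positive level is a null set.\<close>

lemma volume_between_levels_le:
  fixes K :: "'a::euclidean_space set"
  assumes K: "closed K" "K \<noteq> {}" "bounded (- K)" and ts: "0 < t" "t \<le> s"
    and P: "AE \<tau> in lborel. 0 < \<tau> \<longrightarrow> perimeter {x. \<tau> \<le> infdist x K} \<le> ereal P" and P0: "0 \<le> P"
  shows "measure lborel {x. t \<le> infdist x K \<and> infdist x K \<le> s} \<le> P * (s - t)"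
proof (rule field_le_epsilon)
  fix \<eta> :: real assume \<eta>: "\<eta> > 0"
  define \<delta> where "\<delta> = \<eta> / (2 * (P + 1))"
  have \<delta>: "\<delta> > 0" using \<eta> P0 by (simp add: \<delta>_def)
  have "max 0 (t - \<delta>) < t" using ts \<delta> by simp
  from null_level_between[OF K(1,3) _ this]
  obtain t' where t': "max 0 (t - \<delta>) < t'" "t' < t" "{x. infdist x K = t'} \<in> null_sets lborel" by auto
  have "s < s + \<delta>" "0 \<le> s" using \<delta> ts by auto
  from null_level_between[OF K(1,3) this(2,1)]
  obtain s' where s': "s < s'" "s' < s + \<delta>" "{x. infdist x K = s'} \<in> null_sets lborel" by auto
  have "measure lborel {x. t \<le> infdist x K \<and> infdist x K \<le> s} \<le> measure lborel {x. t' < infdist x K \<and> infdist x K < s'}"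
  proof (rule measure_mono_fmeasurable)
    show "{x. t \<le> infdist x K \<and> infdist x K \<le> s} \<subseteq> {x. t' < infdist x K \<and> infdist x K < s'}"
      using t' s' by auto
    show "{x. t \<le> infdist x K \<and> infdist x K \<le> s} \<in> sets lborel" by measurable
    have "{x. t' < infdist x K \<and> infdist x K < s'} \<in> sets lborel" by measurable
    moreover have "{x. t' < infdist x K \<and> infdist x K < s'} \<subseteq> - K" using t' by auto
    ultimately show "{x. t' < infdist x K \<and> infdist x K < s'} \<in> fmeasurable lborel"
      using emeasure_off_K_finite[OF K(3,1)] by (intro fmeasurableI)
  qed
  also have "\<dots> \<le> P * (s' - t')"
    by (rule volume_between_null_levels(1)[OF K _ _ t'(3) s'(3) P]) (use t' s' ts in auto)
  also have "\<dots> \<le> P * ((s - t) + 2 * \<delta>)" using t' s' P0 by (intro mult_left_mono) auto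
  also have "\<dots> \<le> P * (s - t) + \<eta>"
  proof -
    have "P * (2 * \<delta>) = \<eta> * (P / (P + 1))" using P0 by (simp add: \<delta>_def field_simps)
    also have "\<dots> \<le> \<eta> * 1" using P0 \<eta> by (intro mult_left_mono) auto
    finally show ?thesis by (simp add: distrib_left)
  qed
  finally show "measure lborel {x. t \<le> infdist x K \<and> infdist x K \<le> s} \<le> P * (s - t) + \<eta>" .
qed

section \<open>Test functions depending on the distance\<close>

lemma set_lebesgue_integral_support:
  fixes f :: "'a::euclidean_space \<Rightarrow> real"
  assumes "continuous_on UNIV f" "\<And>x. x \<notin> \<Omega> \<Longrightarrow> f x = 0"
  shows "(LINT x:\<Omega>|lebesgue. f x) = (LINT x|lborel. f x)"
proof -
  have "(\<lambda>x. indicator \<Omega> x *\<^sub>R f x) = f" using assms(2) by (auto simp: indicator_def fun_eq_iff)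
  then show ?thesis unfolding set_lebesgue_integral_def
    using borel_measurable_continuous_onI[OF assms(1)] by (simp add: integral_completion)
qed

lemma set_integrable_support:
  fixes f :: "'a::euclidean_space \<Rightarrow> real"
  assumes "continuous_on UNIV f" "\<And>x. x \<notin> \<Omega> \<Longrightarrow> f x = 0" "bounded {x. f x \<noteq> 0}"
  shows "set_integrable lebesgue \<Omega> f"
proof -
  have "(\<lambda>x. indicator \<Omega> x *\<^sub>R f x) = f" using assms(2) by (auto simp: indicator_def fun_eq_iff)
  then show ?thesis unfolding set_integrable_def
    using integrable_continuous_bounded_support[OF assms(1,3)] borel_measurable_continuous_onI[OF assms(1)]
    by (simp add: integrable_completion)
qed

lemma set_integrable_compact:
  fixes f :: "'a::euclidean_space \<Rightarrow> 'b::euclidean_space"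
  assumes "continuous_on UNIV f" "compact K"
  shows "set_integrable lebesgue K f"
proof -
  have "integrable lborel (\<lambda>x. indicator K x *\<^sub>R f x)"
    using assms by (intro borel_integrable_compact) (auto intro: continuous_on_subset)
  then show ?thesis unfolding set_integrable_def
    by (subst integrable_completion) (auto dest: borel_measurable_integrable)
qed

lemma compact_support_bounded: "compact_support_in U f \<Longrightarrow> bounded {x. f x \<noteq> 0}"
  unfolding compact_support_in_def using bounded_subset[OF compact_imp_bounded closure_subset] by blast

lemma compact_support_eq_0: "compact_support_in U f \<Longrightarrow> x \<notin> U \<Longrightarrow> f x = 0"
  unfolding compact_support_in_def using closure_subset[of "{x. f x \<noteq> 0}"] by blast

lemma compact_support_derivative_eq_0:
  "compact_support_in U f \<Longrightarrow> x \<notin> U \<Longrightarrow> frechet_derivative f (at x) i = 0"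
  unfolding compact_support_in_def using frechet_derivative_eq_0_off_closure[of x f] by (metis subsetD)

lemma compact_support_gradient_eq_0:
  "compact_support_in U f \<Longrightarrow> x \<notin> U \<Longrightarrow> gradient f x = 0"
  by (simp add: gradient_def compact_support_derivative_eq_0)

text \<open>A test function is its own approximating sequence in \<open>H\<^sup>1\<^sub>0\<close>, and integration by parts makes its
classical gradient a weak one.\<close>

lemma lambda1_le_test_function:
  fixes \<Omega> :: "'a::euclidean_space set"
  assumes "w \<in> test_functions \<Omega>" and pos: "0 < (LINT x|lborel. (w x)\<^sup>2)"
  shows "lambda1 \<Omega> \<le> ereal ((LINT x|lborel. (norm (gradient w x))\<^sup>2) / (LINT x|lborel. (w x)\<^sup>2))"
proof -
  have C: "\<And>k. C_k k w" and S: "compact_support_in \<Omega> w" using assms by (auto simp: test_functions_def)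
  note w0 = compact_support_eq_0[OF S] and g0 = compact_support_gradient_eq_0[OF S]
  have cw: "continuous_on UNIV w" by (rule C_k_continuous[OF C])
  have cg: "continuous_on UNIV (gradient w)" by (rule continuous_gradient[OF C])
  note bw = compact_support_bounded[OF S]
  note bg = bounded_support_gradient[OF bw]
  have gi: "gradient w x \<bullet> i = frechet_derivative w (at x) i" for x i
    by (rule has_derivative_gradient_inner[OF C_k_Suc_has_derivative[OF C[of "Suc 0"]]])
  have iw: "(LINT x:\<Omega>|lebesgue. (w x)\<^sup>2) = (LINT x|lborel. (w x)\<^sup>2)"
    by (intro set_lebesgue_integral_support continuous_intros cw) (simp add: w0)
  have ig: "(LINT x:\<Omega>|lebesgue. (norm (gradient w x))\<^sup>2) = (LINT x|lborel. (norm (gradient w x))\<^sup>2)"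
    by (intro set_lebesgue_integral_support continuous_intros cg) (simp add: g0)
  have L2w: "L2_on \<Omega> w" unfolding L2_on_def
  proof
    have "(\<lambda>x. indicator \<Omega> x *\<^sub>R w x) = w" using w0 by (auto simp: indicator_def fun_eq_iff)
    then show "set_borel_measurable lebesgue \<Omega> w" unfolding set_borel_measurable_def
      using borel_measurable_continuous_onI[OF cw] by (simp add: measurable_completion)
    show "set_integrable lebesgue \<Omega> (\<lambda>x. (norm (w x))\<^sup>2)"
      by (intro set_integrable_support continuous_intros cw bounded_subset[OF bw]) (auto simp: w0)
  qed
  have L2g: "L2_on \<Omega> (gradient w)" unfolding L2_on_def
  proof
    have "(\<lambda>x. indicator \<Omega> x *\<^sub>R gradient w x) = gradient w" using g0 by (auto simp: indicator_def fun_eq_iff)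
    then show "set_borel_measurable lebesgue \<Omega> (gradient w)" unfolding set_borel_measurable_def
      using borel_measurable_continuous_onI[OF cg] by (simp add: measurable_completion)
    show "set_integrable lebesgue \<Omega> (\<lambda>x. (norm (gradient w x))\<^sup>2)"
      by (intro set_integrable_support continuous_intros cg bounded_subset[OF bg]) (auto simp: g0)
  qed
  have weak: "has_weak_gradient_on \<Omega> w (gradient w)"
    unfolding has_weak_gradient_on_def
  proof (intro conjI ballI)
    show "locally_integrable_on \<Omega> w" "locally_integrable_on \<Omega> (gradient w)"
      unfolding locally_integrable_on_def using set_integrable_compact cw cg by blast+
    fix \<phi> and i :: 'a assume "\<phi> \<in> test_functions \<Omega>" and i: "i \<in> Basis"
    then have C\<phi>: "\<And>k. C_k k \<phi>" and S\<phi>: "compact_support_in \<Omega> \<phi>" by (auto simp: test_functions_def)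
    have c\<phi>: "continuous_on UNIV \<phi>" "continuous_on UNIV (\<lambda>x. frechet_derivative \<phi> (at x) i)"
      using C_k_continuous[OF C\<phi>] C\<phi>[of "Suc 0"] i by auto
    have 1: "(LINT x:\<Omega>|lebesgue. w x * frechet_derivative \<phi> (at x) i) = (LINT x|lborel. w x * frechet_derivative \<phi> (at x) i)"
      by (intro set_lebesgue_integral_support continuous_on_mult cw c\<phi>) (simp add: w0)
    have 2: "(LINT x:\<Omega>|lebesgue. (gradient w x \<bullet> i) * \<phi> x) = (LINT x|lborel. (gradient w x \<bullet> i) * \<phi> x)"
      by (intro set_lebesgue_integral_support continuous_on_mult continuous_on_inner cg continuous_on_const c\<phi>) (simp add: g0)
    show "(LINT x:\<Omega>|lebesgue. w x * frechet_derivative \<phi> (at x) i) = - (LINT x:\<Omega>|lebesgue. (gradient w x \<bullet> i) * \<phi> x)"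
      unfolding 1 2 unfolding gi by (rule integration_by_parts[OF C C\<phi> compact_support_bounded[OF S\<phi>] i])
  qed
  have "w \<in> H1_0 \<Omega>" unfolding H1_0_def
    using L2w L2g weak assms(1) by (intro CollectI exI[of _ "gradient w"] conjI exI[of _ "\<lambda>_. w"]) (auto simp: set_lebesgue_integral_def)
  moreover have "\<not> (AE x\<in>\<Omega> in lebesgue. w x = 0)"
  proof
    assume "AE x\<in>\<Omega> in lebesgue. w x = 0"
    then have "AE x in lborel. w x = 0" unfolding AE_completion_iff by eventually_elim (use w0 in auto)
    then have "AE x in lborel. (w x)\<^sup>2 = 0" by eventually_elim auto
    then have "(LINT x|lborel. (w x)\<^sup>2) = 0" by (rule integral_eq_zero_AE)
    then show False using pos by simp
  qed
  ultimately show ?thesis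
    unfolding lambda1_def using weak by (intro INF_lower2[of "(w, gradient w)"]) (auto simp: iw ig)
qed

text \<open>If \<open>F\<close> vanishes on the nonpositive reals, the shift by \<open>2 \<epsilon>\<close> makes the mollified function vanish
within distance \<open>\<epsilon>\<close> of \<open>K\<close>. Only values of \<open>F\<close> near \<open>d(x)\<close> enter the gradient at \<open>x\<close>.\<close>

lemma norm_gradient_mollify_profile_le:
  fixes K :: "'a::euclidean_space set" and F :: "real \<Rightarrow> real"
  assumes e: "0 < \<epsilon>" and cF: "continuous_on UNIV F" and \<kappa>: "0 \<le> \<kappa>"
    and F: "\<And>u v. \<bar>u - infdist x K\<bar> < 4 * \<epsilon> \<Longrightarrow> \<bar>v - infdist x K\<bar> < 4 * \<epsilon> \<Longrightarrow> \<bar>F u - F v\<bar> \<le> \<kappa> * \<bar>u - v\<bar>"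
  shows "norm (gradient (mollify \<epsilon> (\<lambda>x. F (infdist x K - 2 * \<epsilon>))) x) \<le> \<kappa>"
proof (rule mollify_gradient_le[OF e, of "2 * \<epsilon>"])
  show "continuous_on UNIV (\<lambda>x. F (infdist x K - 2 * \<epsilon>))"
    by (intro continuous_on_compose2[OF cF] continuous_intros) auto
  fix y z assume y: "y \<in> ball x (2 * \<epsilon>)" and z: "z \<in> ball x (2 * \<epsilon>)"
  have "\<bar>infdist y K - infdist x K\<bar> < 2 * \<epsilon>" "\<bar>infdist z K - infdist x K\<bar> < 2 * \<epsilon>"
    using y z infdist_triangle_abs[of y K x] infdist_triangle_abs[of z K x] by (auto simp: dist_commute)
  then have "\<bar>F (infdist y K - 2 * \<epsilon>) - F (infdist z K - 2 * \<epsilon>)\<bar> \<le> \<kappa> * \<bar>(infdist y K - 2 * \<epsilon>) - (infdist z K - 2 * \<epsilon>)\<bar>"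
    by (intro F) (use e in linarith)+
  also have "\<dots> \<le> \<kappa> * norm (y - z)"
    using infdist_triangle_abs[of y K z] \<kappa> by (intro mult_left_mono) (auto simp: dist_norm)
  finally show "\<bar>F (infdist y K - 2 * \<epsilon>) - F (infdist z K - 2 * \<epsilon>)\<bar> \<le> \<kappa> * norm (y - z)" .
qed (use e in auto)

text \<open>The function \<open>k\<close> bounds the pointwise Lipschitz constant of \<open>F\<close>. The mollified functions
\<open>F (d - 2 \<epsilon>)\<close> are test functions, they converge pointwise to \<open>F (d)\<close>, and the upper limit of their
gradient norms is at most \<open>k (d)\<close>.\<close>

lemma lambda1_le_profile:
  fixes K \<Omega> :: "'a::euclidean_space set" and F k :: "real \<Rightarrow> real"
  assumes K: "closed K" "K \<noteq> {}" "- K \<subseteq> \<Omega>" "bounded (- K)"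
    and F0: "\<And>t. t \<le> 0 \<Longrightarrow> F t = 0" and FB: "\<And>t. \<bar>F t\<bar> \<le> 1"
    and FL: "\<And>t s. \<bar>F t - F s\<bar> \<le> L * \<bar>t - s\<bar>"
    and k: "\<And>t. 0 \<le> k t" "\<And>t. k t \<le> L" "k \<in> borel_measurable borel"
    and loc: "\<And>t \<kappa>. 0 < t \<Longrightarrow> k t < \<kappa> \<Longrightarrow>
       \<exists>r>0. \<forall>u v. \<bar>u - t\<bar> < r \<longrightarrow> \<bar>v - t\<bar> < r \<longrightarrow> \<bar>F u - F v\<bar> \<le> \<kappa> * \<bar>u - v\<bar>"
    and pos: "0 < (LINT x|lborel. indicator (- K) x * (F (infdist x K))\<^sup>2)"
  shows "lambda1 \<Omega> \<le> ereal ((LINT x|lborel. indicator (- K) x * (k (infdist x K))\<^sup>2) /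
     (LINT x|lborel. indicator (- K) x * (F (infdist x K))\<^sup>2))"
proof -
  let ?d = "\<lambda>x. infdist x K"
  let ?N = "LINT x|lborel. indicator (- K) x * (k (?d x))\<^sup>2" and ?D = "LINT x|lborel. indicator (- K) x * (F (?d x))\<^sup>2"
  have L0: "0 \<le> L" using k(1)[of 0] k(2)[of 0] by linarith
  have cF: "continuous_on UNIV F"
  proof -
    have "L-lipschitz_on UNIV F" by (rule lipschitz_onI) (use FL L0 in \<open>auto simp: dist_real_def\<close>)
    then show ?thesis by (rule lipschitz_on_continuous_on)
  qed
  have [measurable]: "F \<in> borel_measurable borel" by (rule borel_measurable_continuous_onI[OF cF])
  note k(3) [measurable]
  have [measurable]: "- K \<in> sets borel" using K(1) by simp
  have iK: "integrable lborel (\<lambda>x. indicator (- K) x :: real)"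
    by (intro integrable_real_indicator emeasure_bounded_finite K(4)) simp
  define \<epsilon> where "\<epsilon> n = 1 / real (Suc n)" for n
  have \<epsilon>: "\<And>n. 0 < \<epsilon> n" "\<epsilon> \<longlonglongrightarrow> 0"
    by (auto simp: \<epsilon>_def[abs_def] intro: LIMSEQ_Suc[OF lim_1_over_n] simp del: of_nat_Suc)
  define f where "f n x = F (?d x - 2 * \<epsilon> n)" for n x
  have cf: "continuous_on UNIV (f n)" for n
    unfolding f_def[abs_def] by (intro continuous_on_compose2[OF cF] continuous_intros) auto
  define w where "w n = mollify (\<epsilon> n) (f n)" for n
  have Cw: "C_k j (w n)" for j n unfolding w_def by (rule C_k_mollify[OF \<epsilon>(1) cf])
  have w0: "w n x = 0" if "?d x < \<epsilon> n" for n x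
    unfolding w_def
  proof (rule mollify_eq_0[OF \<epsilon>(1) cf])
    fix u :: 'a assume "norm u < \<epsilon> n"
    then have "?d (x - u) < 2 * \<epsilon> n" using that infdist_triangle_abs[of "x - u" K x] by (simp add: dist_norm)
    then show "f n (x - u) = 0" by (simp add: f_def F0)
  qed
  have supp: "closure {x. w n x \<noteq> 0} \<subseteq> - K" for n
  proof -
    have "closure {x. w n x \<noteq> 0} \<subseteq> {x. \<epsilon> n \<le> ?d x}"
      by (rule closure_minimal[OF _ closed_superlevel]) (use w0 in force)
    also have "\<dots> \<subseteq> - K" using \<epsilon>(1)[of n] by auto
    finally show ?thesis .
  qed
  have csK: "compact_support_in (- K) (w n)" for n
    unfolding compact_support_in_def using supp[of n] K(4) by (auto simp: compact_eq_bounded_closed intro: bounded_subset)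
  then have test: "w n \<in> test_functions \<Omega>" for n
    using K(3) Cw unfolding test_functions_def compact_support_in_def by blast
  have wK: "w n x = 0" "gradient (w n) x = 0" if "x \<in> K" for n x
    using compact_support_eq_0[OF csK] compact_support_gradient_eq_0[OF csK] that by auto
  have gL: "norm (gradient (w n) x) \<le> L" for n x
    unfolding w_def f_def[abs_def] by (rule norm_gradient_mollify_profile_le[OF \<epsilon>(1) cF L0]) (rule FL)
  have [measurable]: "w n \<in> borel_measurable borel" "gradient (w n) \<in> borel_measurable borel" for n
    by (intro borel_measurable_continuous_onI C_k_continuous[OF Cw] continuous_gradient[OF Cw])+
  have w_lim: "(\<lambda>n. w n x) \<longlonglongrightarrow> F (?d x)" for x
  proof (rule LIM_zero_cancel, rule tendsto_rabs_zero_cancel, rule tendsto_sandwich[OF always_eventually always_eventually])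
    show "\<forall>n. 0 \<le> \<bar>w n x - F (?d x)\<bar>" by simp
    show "\<forall>n. \<bar>w n x - F (?d x)\<bar> \<le> (L * 3) * \<epsilon> n"
    proof
      fix n
      show "\<bar>w n x - F (?d x)\<bar> \<le> (L * 3) * \<epsilon> n"
        unfolding w_def
      proof (rule mollify_close[OF \<epsilon>(1) cf])
        fix u :: 'a assume "norm u < \<epsilon> n"
        then have "\<bar>(?d (x - u) - 2 * \<epsilon> n) - ?d x\<bar> \<le> 3 * \<epsilon> n"
          using infdist_triangle_abs[of "x - u" K x] \<epsilon>(1)[of n] by (simp add: dist_norm)
        then have "L * \<bar>(?d (x - u) - 2 * \<epsilon> n) - ?d x\<bar> \<le> L * (3 * \<epsilon> n)" using L0 by (rule mult_left_mono)
        then show "\<bar>f n (x - u) - F (?d x)\<bar> \<le> (L * 3) * \<epsilon> n"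
          using FL[of "?d (x - u) - 2 * \<epsilon> n" "?d x"] by (simp add: f_def)
      qed
    qed
    show "(\<lambda>n. (L * 3) * \<epsilon> n) \<longlonglongrightarrow> 0" using tendsto_mult_right_zero[OF \<epsilon>(2), of "L * 3"] by simp
  qed simp
  define D where "D n = (LINT x|lborel. (w n x)\<^sup>2)" for n
  have Dlim: "D \<longlonglongrightarrow> ?D"
  proof -
    have "(\<lambda>n. LINT x|lborel. indicator (- K) x * (w n x)\<^sup>2) \<longlonglongrightarrow> ?D"
    proof (rule integral_dominated_convergence[OF _ _ iK])
      show "AE x in lborel. (\<lambda>n. indicator (- K) x * (w n x)\<^sup>2) \<longlonglongrightarrow> indicator (- K) x * (F (?d x))\<^sup>2"
        by (intro AE_I2 tendsto_intros w_lim)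
      show "AE x in lborel. norm (indicator (- K) x * (w n x)\<^sup>2) \<le> indicator (- K) x" for n
      proof (intro AE_I2)
        fix x
        have "\<bar>w n x\<bar> \<le> 1" unfolding w_def by (rule mollify_abs_le[OF \<epsilon>(1) cf]) (simp add: f_def FB)
        then have "(w n x)\<^sup>2 \<le> 1" by (simp add: abs_square_le_1)
        then show "norm (indicator (- K) x * (w n x)\<^sup>2) \<le> indicator (- K) x" by (simp add: indicator_def)
      qed
    qed measurable
    moreover have "(\<lambda>x. indicator (- K) x * (w n x)\<^sup>2) = (\<lambda>x. (w n x)\<^sup>2)" for n
      using wK by (auto simp: indicator_def fun_eq_iff)
    ultimately show ?thesis by (simp add: D_def[abs_def])
  qed
  \<comment> \<open>taking the maximum with \<open>k\<close> turns the upper bound for the upper limit into convergence\<close>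
  define N where "N n = (LINT x|lborel. indicator (- K) x * max ((norm (gradient (w n) x))\<^sup>2) ((k (?d x))\<^sup>2))" for n
  have bnd: "norm (indicator (- K) x * max ((norm (gradient (w n) x))\<^sup>2) ((k (?d x))\<^sup>2)) \<le> L\<^sup>2 * indicator (- K) x" for n x
  proof -
    have "(norm (gradient (w n) x))\<^sup>2 \<le> L\<^sup>2" "(k (?d x))\<^sup>2 \<le> L\<^sup>2" using gL k by (intro power_mono; simp)+
    then show ?thesis by (simp add: indicator_def abs_le_iff max_def)
  qed
  have iL: "integrable lborel (\<lambda>x. L\<^sup>2 * indicator (- K) x :: real)" using iK by (rule integrable_mult_right)
  have Nlim: "N \<longlonglongrightarrow> ?N"
    unfolding N_def[abs_def]
  proof (rule integral_dominated_convergence[OF _ _ iL])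
    show "AE x in lborel. (\<lambda>n. indicator (- K) x * max ((norm (gradient (w n) x))\<^sup>2) ((k (?d x))\<^sup>2)) \<longlonglongrightarrow> indicator (- K) x * (k (?d x))\<^sup>2"
    proof (intro AE_I2)
      fix x
      show "(\<lambda>n. indicator (- K) x * max ((norm (gradient (w n) x))\<^sup>2) ((k (?d x))\<^sup>2)) \<longlonglongrightarrow> indicator (- K) x * (k (?d x))\<^sup>2"
      proof (cases "x \<in> K")
        case False
        then have dx: "0 < ?d x" using K by (simp add: infdist_pos_not_in_closed)
        let ?k = "k (?d x)"
        have "(\<lambda>n. max (norm (gradient (w n) x)) ?k) \<longlonglongrightarrow> ?k"
        proof (rule order_tendstoI)
          fix c assume "c < ?k" then show "\<forall>\<^sub>F n in sequentially. c < max (norm (gradient (w n) x)) ?k"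
            by (intro always_eventually allI) (simp add: less_max_iff_disj)
        next
          fix c assume "?k < c"
          then obtain \<kappa> where \<kappa>: "?k < \<kappa>" "\<kappa> < c" using dense by blast
          from loc[OF dx \<kappa>(1)] obtain r where r: "r > 0"
            "\<And>u v. \<bar>u - ?d x\<bar> < r \<Longrightarrow> \<bar>v - ?d x\<bar> < r \<Longrightarrow> \<bar>F u - F v\<bar> \<le> \<kappa> * \<bar>u - v\<bar>" by blast
          have "\<forall>\<^sub>F n in sequentially. \<epsilon> n < r / 4" using order_tendstoD(2)[OF \<epsilon>(2), of "r / 4"] r(1) by simp
          then show "\<forall>\<^sub>F n in sequentially. max (norm (gradient (w n) x)) ?k < c"
          proof eventually_elim
            case (elim n)
            have "norm (gradient (w n) x) \<le> \<kappa>"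
              unfolding w_def f_def[abs_def]
              by (rule norm_gradient_mollify_profile_le[OF \<epsilon>(1) cF]) (use k(1)[of "?d x"] \<kappa> elim r(2) in auto)
            then show ?case using \<kappa> by simp
          qed
        qed
        then have "(\<lambda>n. (max (norm (gradient (w n) x)) ?k)\<^sup>2) \<longlonglongrightarrow> ?k\<^sup>2" by (intro tendsto_intros)
        moreover have "(max (norm (gradient (w n) x)) ?k)\<^sup>2 = max ((norm (gradient (w n) x))\<^sup>2) (?k\<^sup>2)" for n
          using k(1)[of "?d x"] by (auto simp: max_def power_mono not_le dest: power2_le_imp_le intro: antisym power_mono)
        ultimately show ?thesis using False by simp
      qed simp
    qed
  qed (use bnd in auto)
  have "(LINT x|lborel. (norm (gradient (w n) x))\<^sup>2) \<le> N n" for n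
    unfolding N_def
  proof (rule Bochner_Integration.integral_mono)
    show "integrable lborel (\<lambda>x. indicator (- K) x * max ((norm (gradient (w n) x))\<^sup>2) ((k (?d x))\<^sup>2))"
      by (rule Bochner_Integration.integrable_bound[OF iL]) (use bnd[of _ n] in auto)
    show "integrable lborel (\<lambda>x. (norm (gradient (w n) x))\<^sup>2)"
      by (intro integrable_continuous_bounded_support continuous_intros continuous_gradient[OF Cw] bounded_subset[OF K(4)])
        (use wK in auto)
    show "(norm (gradient (w n) x))\<^sup>2 \<le> indicator (- K) x * max ((norm (gradient (w n) x))\<^sup>2) ((k (?d x))\<^sup>2)" for x
      using wK by (auto simp: indicator_def)
  qed
  then have "lambda1 \<Omega> \<le> ereal (N n / D n)" if "0 < D n" for n
    using lambda1_le_test_function[OF test that[unfolded D_def]] that unfolding D_def[symmetric]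
    by (elim order_trans) (simp add: divide_right_mono)
  moreover have "\<forall>\<^sub>F n in sequentially. 0 < D n" by (rule order_tendstoD(1)[OF Dlim pos])
  ultimately have "\<forall>\<^sub>F n in sequentially. lambda1 \<Omega> \<le> ereal (N n / D n)" by (simp add: eventually_mono)
  moreover have "(\<lambda>n. ereal (N n / D n)) \<longlonglongrightarrow> ereal (?N / ?D)"
    using pos by (intro tendsto_intros Nlim Dlim) simp
  ultimately show ?thesis by (intro tendsto_lowerbound[of _ _ sequentially]) auto
qed

section \<open>The volume profile\<close>

definition volume_profile :: "'a::euclidean_space set \<Rightarrow> real \<Rightarrow> real" where
  "volume_profile K t = measure lborel {x. x \<notin> K \<and> infdist x K \<le> t} / measure lborel (- K)"

lemma volume_profile_set [measurable]:
  assumes "closed (K :: 'a::euclidean_space set)"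
  shows "{x. x \<notin> K \<and> infdist x K \<le> t} \<in> sets borel"
proof -
  have "{x. x \<notin> K \<and> infdist x K \<le> t} = - K \<inter> {x. infdist x K \<le> t}" by auto
  also have "\<dots> \<in> sets borel"
    using assms by (intro sets.Int borel_open borel_closed closed_Collect_le continuous_intros) auto
  finally show ?thesis .
qed

lemma fmeasurable_off:
  fixes K :: "'a::euclidean_space set"
  assumes "closed K" "bounded (- K)" "A \<in> sets borel" "A \<subseteq> - K"
  shows "A \<in> fmeasurable lborel"
  using emeasure_off_K_finite[OF assms(2,1,4)] assms(3) by (intro fmeasurableI) auto

context
  fixes K :: "'a::euclidean_space set" and P :: real
  assumes K: "closed K" "K \<noteq> {}" "bounded (- K)" and V: "0 < measure lborel (- K)"
    and P: "0 \<le> P" and per: "AE \<tau> in lborel. 0 < \<tau> \<longrightarrow> perimeter {x. \<tau> \<le> infdist x K} \<le> ereal P"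
begin

lemma volume_profile_mono: "t \<le> s \<Longrightarrow> volume_profile K t \<le> volume_profile K s"
  unfolding volume_profile_def using V
  by (intro divide_right_mono measure_mono_fmeasurable fmeasurable_off[OF K(1,3)])
    (auto simp: volume_profile_set[OF K(1)])

lemma volume_profile_nonpos: "t \<le> 0 \<Longrightarrow> volume_profile K t = 0"
proof -
  assume "t \<le> 0"
  then have "{x. x \<notin> K \<and> infdist x K \<le> t} = {}"
    using infdist_pos_not_in_closed[OF K(1,2)] by fastforce
  then show ?thesis unfolding volume_profile_def by (simp only: measure_empty div_0)
qed

lemma volume_profile_nonneg: "0 \<le> volume_profile K t"
  by (simp add: volume_profile_def)

lemma volume_profile_le_1: "volume_profile K t \<le> 1"
proof -
  have "measure lborel {x. x \<notin> K \<and> infdist x K \<le> t} \<le> measure lborel (- K)"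
    by (intro measure_mono_fmeasurable fmeasurable_off[OF K(1,3)])
      (auto simp: volume_profile_set[OF K(1)] K(1))
  then show ?thesis using V by (simp add: volume_profile_def)
qed

lemma volume_profile_eq_1: "\<exists>T>0. volume_profile K T = 1 \<and> (\<forall>x. infdist x K \<le> T)"
proof -
  obtain R where R: "\<And>x. x \<in> - K \<Longrightarrow> norm x \<le> R" "R > 0" using K(3) bounded_pos by metis
  define T where "T = R + infdist 0 K + 1"
  have T: "T > 0" using R infdist_nonneg[of 0 K] by (simp add: T_def)
  have d: "infdist x K \<le> T" for x
  proof (cases "x \<in> K")
    case False
    then show ?thesis using R(1)[of x] infdist_triangle[of x K 0] by (simp add: T_def dist_norm)
  qed (use T in auto)
  then have "{x. x \<notin> K \<and> infdist x K \<le> T} = - K" by auto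
  then have "volume_profile K T = 1" using V by (simp add: volume_profile_def)
  with T d show ?thesis by blast
qed

lemma volume_profile_diff:
  assumes "t \<le> s"
  shows "volume_profile K s - volume_profile K t
    = measure lborel {x. x \<notin> K \<and> t < infdist x K \<and> infdist x K \<le> s} / measure lborel (- K)"
proof -
  let ?A = "\<lambda>t. {x. x \<notin> K \<and> infdist x K \<le> t}"
  have eq: "{x. x \<notin> K \<and> t < infdist x K \<and> infdist x K \<le> s} = ?A s - ?A t" by auto
  have f: "?A t \<in> fmeasurable lborel" for t
    by (intro fmeasurable_off[OF K(1,3)] volume_profile_set K) auto
  have "measure lborel (?A s - ?A t) = measure lborel (?A s) - measure lborel (?A t)"
    using f[of s] f[of t] assms by (intro measure_Diff) (auto simp: fmeasurable_def)
  then show ?thesis unfolding eq volume_profile_def by (simp add: diff_divide_distrib)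
qed

lemma volume_profile_lipschitz_pos:
  assumes "0 < t" "t \<le> s"
  shows "volume_profile K s - volume_profile K t \<le> P / measure lborel (- K) * (s - t)"
proof -
  have "{x. t \<le> infdist x K \<and> infdist x K \<le> s} = {x. t \<le> infdist x K} \<inter> {x. infdist x K \<le> s}" by auto
  also have "\<dots> \<in> sets borel" by (intro sets.Int borel_closed closed_Collect_le continuous_intros)
  finally have m: "{x. t \<le> infdist x K \<and> infdist x K \<le> s} \<in> sets borel" .
  have "{x. x \<notin> K \<and> t < infdist x K \<and> infdist x K \<le> s} = {x. x \<notin> K \<and> infdist x K \<le> s} - {x. x \<notin> K \<and> infdist x K \<le> t}" by auto
  then have m': "{x. x \<notin> K \<and> t < infdist x K \<and> infdist x K \<le> s} \<in> sets borel" using volume_profile_set[OF K(1)] by simp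
  have "measure lborel {x. x \<notin> K \<and> t < infdist x K \<and> infdist x K \<le> s} \<le> measure lborel {x. t \<le> infdist x K \<and> infdist x K \<le> s}"
    using assms m m' by (intro measure_mono_fmeasurable fmeasurable_off[OF K(1,3)]) auto
  also have "\<dots> \<le> P * (s - t)" by (rule volume_between_levels_le[OF K assms per P])
  finally show ?thesis unfolding volume_profile_diff[OF assms(2)] using V by (simp add: divide_right_mono)
qed

text \<open>The bound for positive levels extends to the level zero because \<open>U\<close> is exhausted by the sets
\<open>{d \<ge> 1/n}\<close>.\<close>

lemma volume_profile_lipschitz:
  assumes "t \<le> s"
  shows "volume_profile K s - volume_profile K t \<le> P / measure lborel (- K) * (s - t)"
proof -
  let ?h = "P / measure lborel (- K)"
  have h: "0 \<le> ?h" using P V by simp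
  have near0: "volume_profile K s \<le> ?h * s" if s: "0 < s" for s
  proof -
    let ?A = "\<lambda>n. {x. 1 / real (Suc n) \<le> infdist x K \<and> infdist x K \<le> s}"
    have A: "?A n \<in> sets borel" for n
    proof -
      have "?A n = {x. 1 / real (Suc n) \<le> infdist x K} \<inter> {x. infdist x K \<le> s}" by auto
      also have "\<dots> \<in> sets borel" by (intro sets.Int borel_closed closed_Collect_le continuous_intros)
      finally show ?thesis .
    qed
    have U: "(\<Union>n. ?A n) = {x. x \<notin> K \<and> infdist x K \<le> s}"
    proof (intro equalityI subsetI)
      fix x assume "x \<in> {x. x \<notin> K \<and> infdist x K \<le> s}"
      then have x: "0 < infdist x K" "infdist x K \<le> s" using infdist_pos_not_in_closed[OF K(1,2)] by auto
      obtain n where "1 / real (Suc n) < infdist x K" using x(1) nat_approx_posE by blast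
      then show "x \<in> (\<Union>n. ?A n)" using x(2) by (auto intro!: exI[of _ n])
    qed auto
    have "(\<lambda>n. measure lborel (?A n)) \<longlonglongrightarrow> measure lborel (\<Union>n. ?A n)"
    proof (rule Lim_measure_incseq)
      show "range ?A \<subseteq> sets lborel" using A by auto
      show "incseq ?A"
      proof (rule incseq_SucI)
        fix n
        have "1 / real (Suc (Suc n)) \<le> 1 / real (Suc n)" by (rule divide_left_mono) auto
        then show "?A n \<subseteq> ?A (Suc n)" by (auto simp del: of_nat_Suc)
      qed
      show "emeasure lborel (\<Union>n. ?A n) \<noteq> \<infinity>"
      proof -
        have "{x. x \<notin> K \<and> infdist x K \<le> s} \<subseteq> - K" by auto
        from emeasure_off_K_finite[OF K(3,1) this] show ?thesis unfolding U by simp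
      qed
    qed
    moreover have "measure lborel (?A n) \<le> P * s" for n
    proof (cases "1 / real (Suc n) \<le> s")
      case True
      have "measure lborel (?A n) \<le> P * (s - 1 / real (Suc n))"
        by (rule volume_between_levels_le[OF K _ True per P]) simp
      also have "\<dots> \<le> P * s" using P by (intro mult_left_mono) auto
      finally show ?thesis .
    next
      case False
      then have "?A n = {}" by (auto simp del: of_nat_Suc)
      then show ?thesis using P s by (metis measure_empty mult_nonneg_nonneg less_imp_le)
    qed
    ultimately have "measure lborel (\<Union>n. ?A n) \<le> P * s" by (intro LIMSEQ_le_const2) auto
    then show ?thesis unfolding U using V by (simp add: volume_profile_def divide_right_mono)
  qed
  consider "0 < t" | "t \<le> 0" "0 < s" | "s \<le> 0" by linarith
  then show ?thesis
  proof cases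
    case 1 then show ?thesis using assms by (rule volume_profile_lipschitz_pos)
  next
    case 2
    have "?h * s \<le> ?h * (s - t)" using 2 h by (intro mult_left_mono) auto
    then show ?thesis using near0[OF 2(2)] volume_profile_nonpos[OF 2(1)] by linarith
  next
    case 3
    then have "volume_profile K s = 0" "volume_profile K t = 0" using assms by (auto intro: volume_profile_nonpos)
    moreover have "0 \<le> ?h * (s - t)" using h assms by (intro mult_nonneg_nonneg) auto
    ultimately show ?thesis by linarith
  qed
qed

lemma continuous_volume_profile: "continuous_on UNIV (volume_profile K)"
proof -
  have "(P / measure lborel (- K))-lipschitz_on UNIV (volume_profile K)"
  proof (rule lipschitz_on_leI)
    show "dist (volume_profile K x) (volume_profile K y) \<le> P / measure lborel (- K) * dist x y" if "x \<le> y" for x y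
      using volume_profile_lipschitz[OF that] volume_profile_mono[OF that] that by (simp add: dist_real_def abs_minus_commute)
  qed (use P V in simp)
  then show ?thesis by (rule lipschitz_on_continuous_on)
qed

text \<open>The probability integral transform: a continuous distribution function, evaluated at its own random
variable, is uniformly distributed.\<close>

lemma measure_volume_profile_gt:
  assumes u: "0 \<le> u" "u \<le> 1"
  shows "measure lborel {x. x \<notin> K \<and> u < volume_profile K (infdist x K)} = measure lborel (- K) * (1 - u)"
proof -
  let ?G = "volume_profile K"
  obtain T where T: "0 < T" "?G T = 1" "\<And>x. infdist x K \<le> T" using volume_profile_eq_1 by blast
  have "\<exists>t. {x. x \<notin> K \<and> ?G (infdist x K) \<le> u} = {x. x \<notin> K \<and> infdist x K \<le> t} \<and> ?G t = u"
  proof (cases "u = 1")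
    case True
    then show ?thesis using T volume_profile_le_1 by (intro exI[of _ T]) auto
  next
    case False
    then have u1: "u < 1" using u by simp
    define S where "S = {t. ?G t \<le> u}"
    have bdd: "t \<le> T" if "t \<in> S" for t
      using that volume_profile_mono[of T t] T(2) u1 unfolding S_def by (cases "t \<le> T") simp_all
    have "closed S" unfolding S_def
      by (intro closed_Collect_le continuous_on_const continuous_volume_profile)
    moreover have "0 \<in> S" using volume_profile_nonpos[of 0] u by (simp add: S_def)
    moreover have bS: "bdd_above S" using bdd by (meson bdd_aboveI)
    ultimately have SupS: "Sup S \<in> S" using closed_contains_Sup by blast
    have iff: "t \<in> S \<longleftrightarrow> t \<le> Sup S" for t
    proof
      show "t \<le> Sup S" if "t \<in> S" using that bS by (rule cSup_upper)
      show "t \<in> S" if "t \<le> Sup S" using volume_profile_mono[OF that] SupS by (simp add: S_def)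
    qed
    obtain t0 where "?G t0 = u"
    proof -
      have "\<exists>t\<ge>0. t \<le> T \<and> ?G t = u"
        by (rule IVT') (use T volume_profile_nonpos[of 0] u in \<open>simp_all add: continuous_on_subset[OF continuous_volume_profile]\<close>)
      then show thesis using that by blast
    qed
    then have "u \<le> ?G (Sup S)" using iff[of t0] volume_profile_mono[of t0 "Sup S"] by (simp add: S_def)
    then have "?G (Sup S) = u" using SupS by (simp add: S_def)
    moreover have "{x. x \<notin> K \<and> ?G (infdist x K) \<le> u} = {x. x \<notin> K \<and> infdist x K \<le> Sup S}"
    proof -
      have mem: "?G t \<le> u \<longleftrightarrow> t \<in> S" for t by (simp add: S_def)
      show ?thesis unfolding mem iff ..
    qed
    ultimately show ?thesis by (intro exI conjI)
  qed
  then obtain t where t: "{x. x \<notin> K \<and> ?G (infdist x K) \<le> u} = {x. x \<notin> K \<and> infdist x K \<le> t}" "?G t = u"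
    by (elim exE conjE)
  have "{x. x \<notin> K \<and> u < ?G (infdist x K)} = - K - {x. x \<notin> K \<and> infdist x K \<le> t}"
    unfolding t(1)[symmetric] by auto
  moreover have "measure lborel (- K - {x. x \<notin> K \<and> infdist x K \<le> t}) = measure lborel (- K) - measure lborel {x. x \<notin> K \<and> infdist x K \<le> t}"
    by (intro measure_Diff) (use K volume_profile_set[OF K(1)] emeasure_off_K_finite[OF K(3,1), of "- K"] in auto)
  moreover have "measure lborel {x. x \<notin> K \<and> infdist x K \<le> t} = u * measure lborel (- K)"
    using t(2) V by (simp add: volume_profile_def field_simps)
  ultimately show ?thesis by (simp add: algebra_simps)
qed

lemma integral_cos_volume_profile:
  "(LINT x|lborel. indicator (- K) x * cos (pi * volume_profile K (infdist x K))) = 0"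
proof -
  let ?g = "\<lambda>x. volume_profile K (infdist x K)" and ?V = "measure lborel (- K)"
  have oK: "- K \<in> sets lborel" using K(1) by simp
  have mg: "?g \<in> borel_measurable borel"
    by (intro borel_measurable_continuous_onI continuous_on_compose2[OF continuous_volume_profile] continuous_intros) auto
  have m: "?g \<in> restrict_space lborel (- K) \<rightarrow>\<^sub>M borel"
    by (rule measurable_restrict_space1) (use mg in simp)
  let ?M = "distr (restrict_space lborel (- K)) borel ?g"
  let ?N = "density lborel (\<lambda>u::real. ennreal (?V * indicator {0..1} u))"
  have M: "emeasure ?M {u<..} = ennreal (measure lborel {x. x \<notin> K \<and> u < ?g x})" for u
  proof -
    have s: "{x. x \<notin> K \<and> u < ?g x} = ?g -` {u<..} \<inter> - K" by auto
    have "{x. x \<notin> K \<and> u < ?g x} \<in> fmeasurable lborel"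
      unfolding s using oK measurable_sets[OF mg, of "{u<..}"] by (intro fmeasurable_off[OF K(1,3)]) auto
    then show ?thesis
      using oK by (simp add: emeasure_distr[OF m] space_restrict_space emeasure_restrict_space s emeasure_eq_measure2)
  qed
  have N: "emeasure ?N {u<..} = ennreal (?V * (1 - min 1 (max 0 u)))" for u
  proof -
    have "emeasure ?N {u<..} = (\<integral>\<^sup>+x. ennreal (?V * indicator {0..1} x) * indicator {u<..} x \<partial>lborel)"
      by (subst emeasure_density) auto
    also have "\<dots> = (\<integral>\<^sup>+x. ennreal ?V * indicator ({0..1} \<inter> {u<..}) x \<partial>lborel)"
      by (intro nn_integral_cong) (auto simp: indicator_def)
    also have "\<dots> = ennreal ?V * emeasure lborel ({0..1} \<inter> {u<..})"
      by (subst nn_integral_cmult_indicator) auto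
    also have "emeasure lborel ({0..1} \<inter> {u<..}) = ennreal (1 - min 1 (max 0 u))"
    proof -
      consider "u < 0" | "0 \<le> u" "u \<le> 1" | "1 < u" by linarith
      then show ?thesis
      proof cases
        case 1
        then have "{0..1} \<inter> {u<..} = {0..1}" by auto
        then show ?thesis using 1 by simp
      next
        case 2
        then have "{0..1} \<inter> {u<..} = {u<..1}" by auto
        then show ?thesis using 2 by simp
      next
        case 3
        then have "{0..1} \<inter> {u<..} = {}" by auto
        then show ?thesis using 3 by (metis emeasure_empty diff_self ennreal_0 max.absorb2 min.absorb1 less_imp_le less_trans zero_less_one)
      qed
    qed
    finally show ?thesis using V by (simp add: ennreal_mult'')
  qed
  have MN: "measure lborel {x. x \<notin> K \<and> u < ?g x} = ?V * (1 - min 1 (max 0 u))" for u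
  proof -
    consider "u < 0" | "0 \<le> u" "u \<le> 1" | "1 < u" by linarith
    then show ?thesis
    proof cases
      case 1
      then have "{x. x \<notin> K \<and> u < ?g x} = - K" using volume_profile_nonneg less_le_trans by blast
      then show ?thesis using 1 by simp
    next
      case 2 then show ?thesis using measure_volume_profile_gt by simp
    next
      case 3
      have "\<not> u < ?g x" for x using volume_profile_le_1[of "infdist x K"] 3 by linarith
      then show ?thesis using 3 by simp
    qed
  qed
  have "?M = ?N"
    by (rule measure_eqI_lessThan) (simp_all add: M N MN)
  then have "(LINT u|?M. cos (pi * u)) = (LINT u|?N. cos (pi * u))" by simp
  also have "\<dots> = (LINT u|lborel. ?V * indicator {0..1} u * cos (pi * u))"
    using V by (subst integral_density) (auto intro!: borel_measurable_continuous_onI continuous_intros)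
  also have "\<dots> = ?V * (LINT u|lborel. cos (pi * u) * indicator {0..1} u)"
    unfolding integral_mult_right_zero[symmetric] by (intro Bochner_Integration.integral_cong) auto
  also have "(LINT u|lborel. cos (pi * u) * indicator {0..1::real} u) = sin (pi * 1) / pi - sin (pi * 0) / pi"
    by (rule integral_FTC_Icc_real) (auto intro!: derivative_eq_intros continuous_intros)
  finally have "(LINT u|?M. cos (pi * u)) = 0" by simp
  moreover have "(LINT u|?M. cos (pi * u)) = (LINT x|restrict_space lborel (- K). cos (pi * ?g x))"
    by (rule integral_distr[OF m]) (auto intro!: borel_measurable_continuous_onI continuous_intros)
  moreover have "\<dots> = (LINT x|lborel. indicator (- K) x *\<^sub>R cos (pi * ?g x))"
    using oK by (subst integral_restrict_space) auto
  ultimately show ?thesis by simp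
qed

end

section \<open>The sine profile\<close>

lemma abs_sin_diff_le:
  assumes "0 \<le> A" "A \<le> pi / 2" "0 \<le> B" "B \<le> pi / 2" "cos A \<le> c" "cos B \<le> c"
  shows "\<bar>sin A - sin B\<bar> \<le> c * \<bar>A - B\<bar>"
proof -
  have *: "\<bar>sin A - sin B\<bar> \<le> c * \<bar>A - B\<bar>" if AB: "0 \<le> A" "A < B" "B \<le> pi / 2" "cos A \<le> c" for A B
  proof -
    obtain z where z: "A < z" "z < B" "sin B - sin A = (B - A) * cos z"
      using MVT2[OF AB(2), of sin cos] DERIV_sin by blast
    have "0 \<le> cos z" using z AB by (intro cos_ge_zero) auto
    moreover have "cos z \<le> cos A" using z AB by (intro cos_monotone_0_pi_le) auto
    ultimately have "\<bar>sin A - sin B\<bar> = (B - A) * cos z" "(B - A) * cos z \<le> (B - A) * c"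
      using z AB by (auto simp: abs_minus_commute[of "sin A"] abs_mult intro!: mult_left_mono)
    then show ?thesis using AB by (simp add: mult.commute)
  qed
  consider "A < B" | "B < A" | "A = B" by linarith
  then show ?thesis
    by cases (use *[of A B] *[of B A] assms in \<open>auto simp: abs_minus_commute\<close>)
qed

lemma abs_cos_diff_le: "\<bar>cos x - cos y\<bar> \<le> \<bar>x - y :: real\<bar>"
proof -
  have *: "\<bar>cos x - cos y\<bar> \<le> \<bar>x - y\<bar>" if xy: "x < y" for x y :: real
  proof -
    obtain z where z: "cos y - cos x = (y - x) * (- sin z)"
      using MVT2[OF xy, of cos "\<lambda>z. - sin z"] DERIV_cos by blast
    have "\<bar>cos x - cos y\<bar> = \<bar>y - x\<bar> * \<bar>sin z\<bar>" using z by (simp add: abs_minus_commute[of "cos x"] abs_mult)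
    also have "\<dots> \<le> \<bar>y - x\<bar> * 1" by (intro mult_left_mono) auto
    finally show ?thesis by (simp add: abs_minus_commute)
  qed
  consider "x < y" | "y < x" | "x = y" by linarith
  then show ?thesis by cases (use *[of x y] *[of y x] in \<open>auto simp: abs_minus_commute\<close>)
qed

lemma abs_mult_cos_sq_minus_sin_sq_le:
  assumes "0 \<le> p" "p \<le> (1::real)"
  shows "\<bar>p * (cos y)\<^sup>2 - (sin y)\<^sup>2\<bar> \<le> 1"
proof -
  have "p * (cos y)\<^sup>2 \<le> 1 * 1" using assms by (intro mult_mono) (auto simp: abs_square_le_1)
  moreover have "(sin y)\<^sup>2 \<le> 1" by (simp add: abs_square_le_1)
  moreover have "0 \<le> p * (cos y)\<^sup>2" using assms by simp
  ultimately show ?thesis using zero_le_power2[of "sin y"] by linarith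
qed

lemma cos_sq_minus_sin_sq_half_pi: "(cos (pi / 2 * u))\<^sup>2 - (sin (pi / 2 * u))\<^sup>2 = cos (pi * u)"
  using cos_double[of "pi / 2 * u"] by simp

text \<open>Applied with \<open>g\<close> the volume profile or a modification of it; \<open>l\<close> bounds its pointwise Lipschitz
constant. The last hypothesis compares the gradient term of \<open>sin (\<pi>/2 \<cdot> g(d))\<close>, divided by
\<open>(\<pi>/2)\<^sup>2 h\<^sup>2\<close>, with the square of the function.\<close>

lemma lambda1_le_sine_profile:
  fixes K \<Omega> :: "'a::euclidean_space set" and g l :: "real \<Rightarrow> real"
  assumes K: "closed K" "K \<noteq> {}" "- K \<subseteq> \<Omega>" "bounded (- K)" and h: "0 < h"
    and g: "\<And>t. 0 \<le> g t" "\<And>t. g t \<le> 1" "\<And>t. t \<le> 0 \<Longrightarrow> g t = 0" "\<And>t s. \<bar>g t - g s\<bar> \<le> h * \<bar>t - s\<bar>"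
    and l: "\<And>t. 0 \<le> l t" "\<And>t. l t \<le> h" "l \<in> borel_measurable borel"
    and loc: "\<And>t. 0 < t \<Longrightarrow> \<exists>r>0. \<forall>u v. \<bar>u - t\<bar> < r \<longrightarrow> \<bar>v - t\<bar> < r \<longrightarrow> \<bar>g u - g v\<bar> \<le> l t * \<bar>u - v\<bar>"
    and D: "0 < (LINT x|lborel. indicator (- K) x * (sin (pi / 2 * g (infdist x K)))\<^sup>2)" (is "0 < ?D")
    and H: "(LINT x|lborel. indicator (- K) x *
       ((l (infdist x K) / h)\<^sup>2 * (cos (pi / 2 * g (infdist x K)))\<^sup>2 - (sin (pi / 2 * g (infdist x K)))\<^sup>2)) \<le> - \<delta>"
  shows "lambda1 \<Omega> \<le> ereal ((pi / 2)\<^sup>2 * h\<^sup>2 * (1 - \<delta> / ?D))"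
proof -
  define F where "F t = sin (pi / 2 * g t)" for t
  define k where "k t = pi / 2 * l t * cos (pi / 2 * g t)" for t
  have ang: "0 \<le> pi / 2 * g t" "pi / 2 * g t \<le> pi / 2" for t
    using g(1,2)[of t] by (auto intro: mult_left_le)
  have cos0: "0 \<le> cos (pi / 2 * g t)" for t by (rule cos_ge_zero) (use ang[of t] pi_gt_zero in linarith)+
  have cg: "continuous_on UNIV g"
  proof -
    have "h-lipschitz_on UNIV g" by (rule lipschitz_onI) (use g(4) h in \<open>auto simp: dist_real_def\<close>)
    then show ?thesis by (rule lipschitz_on_continuous_on)
  qed
  have [measurable]: "g \<in> borel_measurable borel" by (rule borel_measurable_continuous_onI[OF cg])
  note l(3) [measurable]
  have [measurable]: "- K \<in> sets borel" using K(1) by simp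
  have iK: "integrable lborel (\<lambda>x. C * indicator (- K) x :: real)" for C
    by (intro integrable_mult_right integrable_real_indicator emeasure_bounded_finite K(4)) simp
  have "lambda1 \<Omega> \<le> ereal ((LINT x|lborel. indicator (- K) x * (k (infdist x K))\<^sup>2) /
      (LINT x|lborel. indicator (- K) x * (F (infdist x K))\<^sup>2))"
  proof (rule lambda1_le_profile[OF K, where L = "pi / 2 * h"])
    show "F t = 0" if "t \<le> 0" for t using g(3)[OF that] by (simp add: F_def)
    show "\<bar>F t\<bar> \<le> 1" for t by (simp add: F_def)
    show "\<bar>F t - F s\<bar> \<le> pi / 2 * h * \<bar>t - s\<bar>" for t s
    proof -
      have "\<bar>F t - F s\<bar> \<le> 1 * \<bar>pi / 2 * g t - pi / 2 * g s\<bar>"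
        unfolding F_def by (rule abs_sin_diff_le) (use ang in auto)
      also have "\<dots> = pi / 2 * \<bar>g t - g s\<bar>" by (simp only: right_diff_distrib[symmetric] abs_mult) simp
      also have "\<dots> \<le> pi / 2 * (h * \<bar>t - s\<bar>)" by (intro mult_left_mono g) auto
      finally show ?thesis by simp
    qed
    show "0 \<le> k t" for t unfolding k_def using l(1)[of t] cos0[of t] by simp
    show "k t \<le> pi / 2 * h" for t
    proof -
      have "pi / 2 * l t * cos (pi / 2 * g t) \<le> pi / 2 * h * 1"
        using l cos0 h by (intro mult_mono mult_left_mono) auto
      then show ?thesis by (simp add: k_def)
    qed
    show "k \<in> borel_measurable borel" unfolding k_def[abs_def] by measurable
    show "\<exists>r>0. \<forall>u v. \<bar>u - t\<bar> < r \<longrightarrow> \<bar>v - t\<bar> < r \<longrightarrow> \<bar>F u - F v\<bar> \<le> \<kappa> * \<bar>u - v\<bar>"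
      if t: "0 < t" and \<kappa>: "k t < \<kappa>" for t \<kappa>
    proof -
      \<comment> \<open>the slack \<open>\<kappa> - k t\<close> is spent on the variation of the cosine near \<open>t\<close>\<close>
      define c where "c = cos (pi / 2 * g t) + (\<kappa> - k t) / (pi / 2 * h)"
      have ck: "cos (pi / 2 * g t) < c" using \<kappa> h by (simp add: c_def)
      have "isCont (\<lambda>u. cos (pi / 2 * g u)) t"
        using cg by (intro continuous_intros) (simp add: continuous_on_eq_continuous_at)
      then have "((\<lambda>u. cos (pi / 2 * g u)) \<longlongrightarrow> cos (pi / 2 * g t)) (nhds t)"
        unfolding isCont_def by (rule tendsto_at_iff_tendsto_nhds[where g = "\<lambda>u. cos (pi / 2 * g u)", THEN iffD1])
      then have "\<forall>\<^sub>F u in nhds t. cos (pi / 2 * g u) < c" using ck by (rule order_tendstoD(2))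
      then obtain r1 where r1: "r1 > 0" "\<And>u. dist u t < r1 \<Longrightarrow> cos (pi / 2 * g u) < c"
        by (auto simp: eventually_nhds_metric)
      obtain r2 where r2: "r2 > 0" "\<And>u v. \<bar>u - t\<bar> < r2 \<Longrightarrow> \<bar>v - t\<bar> < r2 \<Longrightarrow> \<bar>g u - g v\<bar> \<le> l t * \<bar>u - v\<bar>"
        using loc[OF t] by blast
      have c0: "0 \<le> c" using ck cos0[of t] by linarith
      have cl: "c * (pi / 2) * l t \<le> \<kappa>"
      proof -
        have "c * (pi / 2) * l t = k t + (\<kappa> - k t) * (l t / h)"
          using h by (simp add: c_def k_def field_simps)
        also have "\<dots> \<le> k t + (\<kappa> - k t) * 1" using \<kappa> l h by (intro add_left_mono mult_left_mono) auto
        finally show ?thesis by simp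
      qed
      show ?thesis
      proof (intro exI[of _ "min r1 r2"] conjI allI impI)
        fix u v assume uv: "\<bar>u - t\<bar> < min r1 r2" "\<bar>v - t\<bar> < min r1 r2"
        have "\<bar>F u - F v\<bar> \<le> c * \<bar>pi / 2 * g u - pi / 2 * g v\<bar>"
          unfolding F_def by (rule abs_sin_diff_le) (use ang uv r1(2)[of u] r1(2)[of v] in \<open>auto simp: dist_real_def\<close>)
        also have "\<dots> = c * (pi / 2) * \<bar>g u - g v\<bar>" by (simp only: right_diff_distrib[symmetric] abs_mult) simp
        also have "\<dots> \<le> c * (pi / 2) * (l t * \<bar>u - v\<bar>)" using c0 uv by (intro mult_left_mono r2) auto
        also have "\<dots> = (c * (pi / 2) * l t) * \<bar>u - v\<bar>" by simp
        also have "\<dots> \<le> \<kappa> * \<bar>u - v\<bar>" using cl by (intro mult_right_mono) auto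
        finally show "\<bar>F u - F v\<bar> \<le> \<kappa> * \<bar>u - v\<bar>" .
      qed (use r1 r2 in auto)
    qed
  qed (use D in \<open>simp add: F_def\<close>)
  also have "(LINT x|lborel. indicator (- K) x * (F (infdist x K))\<^sup>2) = ?D" by (simp add: F_def)
  also have "(LINT x|lborel. indicator (- K) x * (k (infdist x K))\<^sup>2) / ?D \<le> (pi / 2)\<^sup>2 * h\<^sup>2 * (1 - \<delta> / ?D)"
  proof -
    let ?s = "\<lambda>x. indicator (- K) x * (sin (pi / 2 * g (infdist x K)))\<^sup>2"
    let ?H = "\<lambda>x. indicator (- K) x * ((l (infdist x K) / h)\<^sup>2 * (cos (pi / 2 * g (infdist x K)))\<^sup>2 - (sin (pi / 2 * g (infdist x K)))\<^sup>2)"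
    have iS: "integrable lborel ?s"
      by (rule Bochner_Integration.integrable_bound[OF iK[of 1]]) (measurable, auto simp: indicator_def abs_square_le_1)
    have iH: "integrable lborel ?H"
    proof (rule Bochner_Integration.integrable_bound[OF iK[of 1]])
      have "\<bar>(l t / h)\<^sup>2 * (cos y)\<^sup>2 - (sin y)\<^sup>2\<bar> \<le> 1" for t y
        using l h by (intro abs_mult_cos_sq_minus_sin_sq_le) (auto simp: abs_square_le_1)
      then show "AE x in lborel. norm (?H x) \<le> norm (1 * indicator (- K) x :: real)" by (auto simp: indicator_def)
    qed measurable
    have "(\<lambda>x. indicator (- K) x * (k (infdist x K))\<^sup>2) = (\<lambda>x. (pi / 2)\<^sup>2 * h\<^sup>2 * (?H x + ?s x))"
      using h by (auto simp: k_def fun_eq_iff indicator_def power_mult_distrib power_divide field_simps)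
    then have "(LINT x|lborel. indicator (- K) x * (k (infdist x K))\<^sup>2) = (pi / 2)\<^sup>2 * h\<^sup>2 * ((LINT x|lborel. ?H x) + ?D)"
      using Bochner_Integration.integral_add[OF iH iS] by simp
    also have "\<dots> \<le> (pi / 2)\<^sup>2 * h\<^sup>2 * (- \<delta> + ?D)" using H by (intro mult_left_mono) auto
    finally have "(LINT x|lborel. indicator (- K) x * (k (infdist x K))\<^sup>2) / ?D \<le> (pi / 2)\<^sup>2 * h\<^sup>2 * (- \<delta> + ?D) / ?D"
      using D by (intro divide_right_mono) auto
    then show ?thesis using D by (simp add: field_simps)
  qed
  finally show ?thesis by simp
qed

definition chord :: "(real \<Rightarrow> real) \<Rightarrow> real \<Rightarrow> real \<Rightarrow> real \<Rightarrow> real" where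
  "chord G a b t = (if a < t \<and> t < b then G a + (G b - G a) / (b - a) * (t - a) else G t)"

lemma chord_increment:
  assumes ab: "a < b" and G: "\<And>t s. t \<le> s \<Longrightarrow> 0 \<le> G s - G t \<and> G s - G t \<le> h * (s - t)" and ts: "t \<le> s"
  shows "0 \<le> chord G a b s - chord G a b t \<and> chord G a b s - chord G a b t \<le> h * (s - t)"
proof -
  define q where "q = (G b - G a) / (b - a)"
  have q: "0 \<le> q" "q \<le> h" using G[of a b] ab by (auto simp: q_def divide_le_eq)
  have qb: "G b = G a + q * (b - a)" using ab by (simp add: q_def)
  have qx: "0 \<le> q * x" "q * x \<le> h * x" if "0 \<le> x" for x
    using that q by (auto intro: mult_right_mono)
  consider "a < t" "t < b" "a < s" "s < b" | "a < t" "t < b" "b \<le> s" | "t \<le> a" "a < s" "s < b"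
    | "\<not> (a < t \<and> t < b)" "\<not> (a < s \<and> s < b)" using ts by linarith
  then show ?thesis
  proof cases
    case 1
    then have "chord G a b s - chord G a b t = q * (s - t)" by (simp add: chord_def q_def[symmetric] algebra_simps)
    then show ?thesis using qx[of "s - t"] ts by simp
  next
    case 2
    then have "chord G a b s - chord G a b t = (G s - G b) + q * (b - t)"
      using qb by (simp add: chord_def q_def[symmetric] algebra_simps)
    moreover have "h * (s - t) = h * (s - b) + h * (b - t)" by (simp add: algebra_simps)
    ultimately show ?thesis using G[OF 2(3)] qx[of "b - t"] 2(2) by linarith
  next
    case 3
    then have "chord G a b s - chord G a b t = (G a - G t) + q * (s - a)" by (simp add: chord_def q_def[symmetric])
    moreover have "h * (s - t) = h * (a - t) + h * (s - a)" by (simp add: algebra_simps)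
    ultimately show ?thesis using G[OF 3(1)] qx[of "s - a"] 3(2) by linarith
  next
    case 4
    then have "chord G a b s - chord G a b t = G s - G t" by (simp only: chord_def if_False)
    then show ?thesis using G[OF ts] by simp
  qed
qed

text \<open>With \<open>p = q/h\<close> the left hand side is \<open>cos (\<pi> g) - (1 - p\<^sup>2) cos\<^sup>2 (\<pi>/2 \<cdot> g)\<close>, where \<open>g\<close> is
the value of the chord. Here \<open>1 - p\<^sup>2 \<ge> 1 - p\<close>, the squared cosine is at least \<open>1/2\<close> since
\<open>g \<le> 1/8\<close>, and passing from \<open>g\<close> to \<open>G t\<close> costs at most \<open>\<pi> |g - G t| \<le> \<pi> (1 - p)/16\<close>.\<close>

lemma chord_gain:
  assumes h: "0 < h" and t: "a < t" "t < b" and hba: "h * (b - a) = 1 / 16"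
    and G: "\<And>t s. t \<le> s \<Longrightarrow> 0 \<le> G s - G t \<and> G s - G t \<le> h * (s - t)" and Ga: "0 \<le> G a" and Gb: "G b \<le> 1 / 8"
    and q: "q = (G b - G a) / (b - a)"
  shows "(q / h)\<^sup>2 * (cos (pi / 2 * chord G a b t))\<^sup>2 - (sin (pi / 2 * chord G a b t))\<^sup>2
      \<le> cos (pi * G t) - (1 - q / h) * (1 / 2 - pi / 16)"
proof -
  let ?g = "chord G a b t" and ?p = "q / h"
  have ab: "a < b" using t by simp
  have qh: "0 \<le> q" "q \<le> h" using G[of a b] ab by (auto simp: q divide_le_eq)
  have qb: "G b = G a + q * (b - a)" using ab by (simp add: q)
  have p: "0 \<le> ?p" "?p \<le> 1" using qh h by auto
  have gt: "?g = G a + q * (t - a)" using t by (simp add: chord_def q)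
  have "q * (t - a) \<le> q * (b - a)" "0 \<le> q * (t - a)" using t qh by (auto intro: mult_left_mono)
  then have g: "0 \<le> ?g" "?g \<le> 1 / 8" using Ga Gb qb gt by auto
  then have "pi * ?g \<le> pi * (1 / 8)" by (intro mult_left_mono) auto
  then have "0 \<le> cos (pi * ?g)" using g(1) by (intro cos_ge_zero) (auto intro: order_trans[of _ 0])
  then have "1 / 2 \<le> (cos (pi / 2 * ?g))\<^sup>2"
    using cos_sq_minus_sin_sq_half_pi[of ?g] sin_cos_squared_add[of "pi / 2 * ?g"] by linarith
  then have 1: "(1 - ?p) * (1 / 2) \<le> (1 - ?p) * (cos (pi / 2 * ?g))\<^sup>2" using p by (intro mult_left_mono) auto
  have "?p\<^sup>2 \<le> ?p" unfolding power2_eq_square by (rule mult_left_le[OF p(2,1)])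
  then have "?p\<^sup>2 * (cos (pi / 2 * ?g))\<^sup>2 \<le> ?p * (cos (pi / 2 * ?g))\<^sup>2" by (intro mult_right_mono) auto
  then have 2: "?p\<^sup>2 * (cos (pi / 2 * ?g))\<^sup>2 \<le> (cos (pi / 2 * ?g))\<^sup>2 - (1 - ?p) * (1 / 2)"
    using 1 unfolding left_diff_distrib[of 1 ?p "(cos (pi / 2 * ?g))\<^sup>2"] by linarith
  \<comment> \<open>both functions agree at the ends of the interval and have slopes in \<open>[0, h]\<close>, one of them \<open>q\<close>\<close>
  have 3: "\<bar>?g - G t\<bar> \<le> (1 - ?p) / 16"
  proof -
    have "(h - q) * (b - a) = (1 - ?p) * (h * (b - a))" using h by (simp add: field_simps)
    then have hq: "(h - q) * (b - a) = (1 - ?p) / 16" unfolding hba by simp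
    have "(h - q) * (t - a) \<le> (h - q) * (b - a)" "(h - q) * (b - t) \<le> (h - q) * (b - a)"
      using t qh by (auto intro!: mult_left_mono)
    moreover have "G t - ?g \<le> (h - q) * (t - a)"
      using G[of a t] t by (simp add: gt algebra_simps)
    moreover have "?g - G t \<le> (h - q) * (b - t)"
      using G[of t b] t qb by (simp add: gt algebra_simps)
    ultimately show ?thesis unfolding hq by linarith
  qed
  have "cos (pi * ?g) - cos (pi * G t) \<le> \<bar>pi * ?g - pi * G t\<bar>"
    using abs_cos_diff_le[of "pi * ?g" "pi * G t"] by linarith
  also have "\<dots> = pi * \<bar>?g - G t\<bar>" by (simp only: right_diff_distrib[symmetric] abs_mult) simp
  also have "\<dots> \<le> pi * ((1 - ?p) / 16)" by (intro mult_left_mono 3) auto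
  finally have 4: "cos (pi * ?g) - cos (pi * G t) \<le> pi * ((1 - ?p) / 16)" .
  have "(1 - ?p) * (1 / 2 - pi / 16) = (1 - ?p) * (1 / 2) - pi * ((1 - ?p) / 16)" by (simp add: algebra_simps)
  then show ?thesis using 2 4 cos_sq_minus_sin_sq_half_pi[of ?g] by linarith
qed

context
  fixes K \<Omega> :: "'a::euclidean_space set" and P h :: real
  assumes K: "closed K" "K \<noteq> {}" "bounded (- K)" "- K \<subseteq> \<Omega>" and V: "0 < measure lborel (- K)"
    and P: "0 < P" and per: "AE \<tau> in lborel. 0 < \<tau> \<longrightarrow> perimeter {x. \<tau> \<le> infdist x K} \<le> ereal P"
    and h_def: "h = P / measure lborel (- K)"
begin

lemma cheeger_ratio_pos: "0 < h"
  using P V by (simp add: h_def)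

lemmas profile_facts =
  volume_profile_mono[OF K(1-3) V less_imp_le[OF P] per]
  volume_profile_nonpos[OF K(1-3) V less_imp_le[OF P] per]
  volume_profile_le_1[OF K(1-3) V less_imp_le[OF P] per]
  volume_profile_nonneg[OF K(1-3) V less_imp_le[OF P] per]

lemma volume_profile_increment:
  "t \<le> s \<Longrightarrow> 0 \<le> volume_profile K s - volume_profile K t \<and>
     volume_profile K s - volume_profile K t \<le> h * (s - t)"
  using profile_facts(1) volume_profile_lipschitz[OF K(1-3) V less_imp_le[OF P] per] by (simp add: h_def)

lemma null_level_set:
  assumes t: "0 < t"
  shows "{x. infdist x K = t} \<in> null_sets lborel"
proof -
  have "measure lborel {x. t \<le> infdist x K \<and> infdist x K \<le> t} \<le> P * (t - t)"
    by (rule volume_between_levels_le[OF K(1-3) t _ per]) (use P in auto)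
  moreover have "{x. t \<le> infdist x K \<and> infdist x K \<le> t} = {x. infdist x K = t}" by auto
  moreover have "emeasure lborel {x. infdist x K = t} < \<infinity>"
    by (rule emeasure_off_K_finite[OF K(3,1)]) (use t in auto)
  moreover have "{x. infdist x K = t} \<in> sets borel" by measurable
  ultimately show ?thesis by (simp add: null_sets_def measure_le_0_iff emeasure_eq_ennreal_measure)
qed

text \<open>The distance attains a value in between by connectedness, so the set is open and nonempty.\<close>

lemma volume_between_levels_pos:
  assumes ab: "0 < a" "a < b" and Gb: "volume_profile K b < 1"
  shows "0 < measure lborel {x. a < infdist x K \<and> infdist x K < b}" (is "0 < measure lborel ?A")
proof -
  let ?d = "\<lambda>x. infdist x K"
  have openA: "open ?A"
    unfolding Collect_conj_eq by (intro open_Int open_Collect_less continuous_intros)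
  have "\<exists>x. ?d x > b"
  proof (rule ccontr)
    assume "\<not> (\<exists>x. ?d x > b)"
    then have "{x. x \<notin> K \<and> ?d x \<le> b} = - K" by (auto simp: not_less)
    then have "volume_profile K b = 1" using V by (simp add: volume_profile_def)
    then show False using Gb by simp
  qed
  then obtain x1 where x1: "?d x1 > b" by blast
  obtain x0 where x0: "x0 \<in> K" using K(2) by blast
  have "connected (range ?d)" by (intro connected_continuous_image continuous_intros) auto
  then have "(a + b) / 2 \<in> range ?d"
    by (rule connectedD_interval[OF _ rangeI[of ?d x0] rangeI[of ?d x1]]) (use x0 x1 ab in auto)
  then obtain z where "?d z = (a + b) / 2" by auto
  then have "?A \<noteq> {}" using ab by (auto intro!: exI[of _ z])
  then have "\<not> negligible ?A" using openA open_not_negligible by blast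
  moreover have "?A \<in> sets borel" by measurable
  ultimately have "emeasure lborel ?A \<noteq> 0" by (auto simp: negligible_iff_null_sets null_sets_def)
  moreover have "emeasure lborel ?A < \<infinity>"
    by (rule emeasure_off_K_finite[OF K(3,1)]) (use ab in auto)
  ultimately show ?thesis
    by (simp add: measure_def enn2real_positive_iff zero_less_iff_neq_zero)
qed

lemma lambda1_le_of_perimeter_le: "lambda1 \<Omega> \<le> ereal ((pi / 2)\<^sup>2 * h\<^sup>2)"
proof -
  let ?G = "volume_profile K" and ?V = "measure lborel (- K)"
  note cosint = integral_cos_volume_profile[OF K(1-3) V less_imp_le[OF P] per]
  have lip: "\<bar>?G t - ?G s\<bar> \<le> h * \<bar>t - s\<bar>" for t s
    using volume_profile_increment[of t s] volume_profile_increment[of s t] by (cases "t \<le> s") auto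
  have cG: "continuous_on UNIV ?G" by (rule continuous_volume_profile[OF K(1-3) V less_imp_le[OF P] per])
  have [measurable]: "?G \<in> borel_measurable borel" by (rule borel_measurable_continuous_onI[OF cG])
  have [measurable]: "- K \<in> sets borel" using K(1) by simp
  have iK: "integrable lborel (\<lambda>x. indicator (- K) x :: real)"
    by (intro integrable_real_indicator emeasure_bounded_finite K(3)) simp
  have ic: "integrable lborel (\<lambda>x. indicator (- K) x * cos (pi * ?G (infdist x K)))"
    by (rule Bochner_Integration.integrable_bound[OF iK]) (measurable, auto simp: indicator_def)
  have "(LINT x|lborel. indicator (- K) x * (sin (pi / 2 * ?G (infdist x K)))\<^sup>2)
     = (LINT x|lborel. (indicator (- K) x - indicator (- K) x * cos (pi * ?G (infdist x K))) / 2)"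
    by (intro Bochner_Integration.integral_cong) (auto simp: indicator_def cos_double_sin[of "pi / 2 * _", simplified])
  also have "\<dots> = ?V / 2"
    using Bochner_Integration.integral_diff[OF iK ic] cosint K(1) by simp
  finally have D: "(LINT x|lborel. indicator (- K) x * (sin (pi / 2 * ?G (infdist x K)))\<^sup>2) = ?V / 2" .
  have "lambda1 \<Omega> \<le> ereal ((pi / 2)\<^sup>2 * h\<^sup>2 * (1 - 0 / (LINT x|lborel. indicator (- K) x * (sin (pi / 2 * ?G (infdist x K)))\<^sup>2)))"
  proof (rule lambda1_le_sine_profile[OF K(1,2,4,3) cheeger_ratio_pos, where l = "\<lambda>_. h"])
    show "(LINT x|lborel. indicator (- K) x * ((h / h)\<^sup>2 * (cos (pi / 2 * ?G (infdist x K)))\<^sup>2 - (sin (pi / 2 * ?G (infdist x K)))\<^sup>2)) \<le> - 0"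
      using cheeger_ratio_pos cosint by (simp add: cos_sq_minus_sin_sq_half_pi[simplified])
  qed (use profile_facts lip cheeger_ratio_pos D V in \<open>auto intro: exI[of _ 1]\<close>)
  then show ?thesis by simp
qed

lemma lambda1_less_of_perimeter_less:
  assumes strict: "AE \<tau> in lborel. 0 < \<tau> \<longrightarrow> perimeter {x. \<tau> \<le> infdist x K} < ereal P"
  shows "lambda1 \<Omega> < ereal ((pi / 2)\<^sup>2 * h\<^sup>2)"
proof -
  let ?G = "volume_profile K" and ?V = "measure lborel (- K)" and ?d = "\<lambda>x. infdist x K"
  note cosint = integral_cos_volume_profile[OF K(1-3) V less_imp_le[OF P] per]
  \<comment> \<open>short enough for \<open>chord_gain\<close>, and close enough to \<open>K\<close> that \<open>G b \<le> 1/8\<close>\<close>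
  define b where "b = 1 / (8 * h)"
  define a where "a = b / 2"
  have "0 < b" using cheeger_ratio_pos by (simp add: b_def)
  then have ab: "0 < a" "a < b" by (auto simp: a_def)
  have hba: "h * (b - a) = 1 / 16" "h * b = 1 / 8" using cheeger_ratio_pos by (auto simp: a_def b_def field_simps)
  have G0: "?G 0 = 0" by (rule profile_facts(2)) simp
  have Gb: "?G b \<le> 1 / 8" using volume_profile_increment[of 0 b] G0 ab hba(2) by simp
  let ?A = "{x. a < ?d x \<and> ?d x < b}"
  have AK: "?A \<subseteq> - K" using ab by auto
  have mA: "?A \<in> sets borel" by measurable
  have posA: "0 < measure lborel ?A" by (rule volume_between_levels_pos[OF ab]) (use Gb in simp)
  have mless: "measure lborel ?A < P * (b - a)"
    by (rule volume_between_null_levels(2)[OF K(1-3) ab null_level_set null_level_set per strict]) (use ab in auto)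
  have Gdiff: "?G b - ?G a = measure lborel ?A / ?V"
  proof -
    have "{x. x \<notin> K \<and> a < ?d x \<and> ?d x \<le> b} = ?A \<union> {x. ?d x = b}" using ab by auto
    moreover have "measure lborel (?A \<union> {x. ?d x = b}) = measure lborel ?A"
      by (rule measure_Un_null_set) (use mA null_level_set ab in auto)
    ultimately show ?thesis
      using volume_profile_diff[OF K(1-3) V less_imp_le[OF P] per, of a b] ab by simp
  qed
  define q where "q = (?G b - ?G a) / (b - a)"
  have q0: "0 \<le> q" using profile_facts(1)[of a b] ab by (simp add: q_def)
  have qh: "q < h"
  proof -
    have "?G b - ?G a < P * (b - a) / ?V" unfolding Gdiff using mless V by (intro divide_strict_right_mono)
    then show ?thesis using ab by (simp add: q_def h_def divide_less_eq)
  qed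
  define g where "g = chord ?G a b"
  define l where "l t = (if a < t \<and> t < b then q else h)" for t
  have inc: "0 \<le> g s - g t \<and> g s - g t \<le> h * (s - t)" if "t \<le> s" for t s
    unfolding g_def by (rule chord_increment[OF ab(2) volume_profile_increment that])
  have glip: "\<bar>g t - g s\<bar> \<le> h * \<bar>t - s\<bar>" for t s
    using inc[of t s] inc[of s t] by (cases "t \<le> s") auto
  have g_off: "g t = ?G t" if "\<not> (a < t \<and> t < b)" for t unfolding g_def chord_def if_not_P[OF that] ..
  have g0: "g t = 0" if "t \<le> 0" for t using that ab profile_facts(2) g_off by simp
  have gn: "0 \<le> g t" for t using inc[of 0 t] g0[of 0] g0[of t] by (cases "0 \<le> t") auto
  have g1: "g t \<le> 1" for t
  proof (cases "a < t \<and> t < b")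
    case True
    then show ?thesis using Gb inc[of t b] g_off[of b] by simp
  next
    case False
    show ?thesis unfolding g_off[OF False] by (rule profile_facts(3))
  qed
  define c where "c = (1 - q / h) * (1 / 2 - pi / 16)"
  have cpos: "0 < c" unfolding c_def using qh cheeger_ratio_pos pi_less_4 by (intro mult_pos_pos) auto
  have key: "(l t / h)\<^sup>2 * (cos (pi / 2 * g t))\<^sup>2 - (sin (pi / 2 * g t))\<^sup>2
      \<le> cos (pi * ?G t) - c * (if a < t \<and> t < b then 1 else 0)" for t
  proof (cases "a < t \<and> t < b")
    case False
    then have "l t = h" by (simp only: l_def if_False)
    then show ?thesis unfolding if_not_P[OF False] g_off[OF False]
      using cheeger_ratio_pos by (simp add: cos_sq_minus_sin_sq_half_pi[simplified])
  next
    case True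
    then show ?thesis
      using chord_gain[OF cheeger_ratio_pos _ _ hba(1) volume_profile_increment profile_facts(4) Gb q_def, of t]
      by (simp add: l_def c_def g_def)
  qed
  have cg: "continuous_on UNIV g"
  proof -
    have "h-lipschitz_on UNIV g" by (rule lipschitz_onI) (use glip cheeger_ratio_pos in \<open>auto simp: dist_real_def\<close>)
    then show ?thesis by (rule lipschitz_on_continuous_on)
  qed
  have cG: "continuous_on UNIV ?G" by (rule continuous_volume_profile[OF K(1-3) V less_imp_le[OF P] per])
  have ml [measurable]: "l \<in> borel_measurable borel" unfolding l_def[abs_def] by measurable
  have [measurable]: "g \<in> borel_measurable borel" "?G \<in> borel_measurable borel"
    by (intro borel_measurable_continuous_onI cg cG)+
  have [measurable]: "- K \<in> sets borel" using K(1) by simp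
  have iK: "integrable lborel (\<lambda>x. indicator (- K) x :: real)"
    by (intro integrable_real_indicator emeasure_bounded_finite K(3)) simp
  have iA: "integrable lborel (\<lambda>x. c * indicator ?A x)"
    using mA emeasure_off_K_finite[OF K(3,1) AK] by (intro integrable_mult_right integrable_real_indicator) auto
  have ic: "integrable lborel (\<lambda>x. indicator (- K) x * cos (pi * ?G (?d x)))"
    by (rule Bochner_Integration.integrable_bound[OF iK]) (measurable, auto simp: indicator_def)
  let ?H = "\<lambda>x. (l (?d x) / h)\<^sup>2 * (cos (pi / 2 * g (?d x)))\<^sup>2 - (sin (pi / 2 * g (?d x)))\<^sup>2"
  let ?s = "\<lambda>x. indicator (- K) x * (sin (pi / 2 * g (?d x)))\<^sup>2"
  have l1: "(l t / h)\<^sup>2 \<le> 1" for t using q0 qh cheeger_ratio_pos by (auto simp: l_def abs_square_le_1)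
  have Hbound: "\<bar>(l t / h)\<^sup>2 * (cos y)\<^sup>2 - (sin y)\<^sup>2\<bar> \<le> 1" for t y
    using l1 by (intro abs_mult_cos_sq_minus_sin_sq_le) auto
  have iH: "integrable lborel (\<lambda>x. indicator (- K) x * ?H x)"
    by (rule Bochner_Integration.integrable_bound[OF iK]) (measurable, use Hbound in \<open>auto simp: indicator_def\<close>)
  have iS: "integrable lborel ?s"
    by (rule Bochner_Integration.integrable_bound[OF iK]) (measurable, auto simp: indicator_def abs_square_le_1)
  have "(LINT x|lborel. indicator (- K) x * ?H x) \<le> (LINT x|lborel. indicator (- K) x * cos (pi * ?G (?d x)) - c * indicator ?A x)"
  proof (rule Bochner_Integration.integral_mono[OF iH Bochner_Integration.integrable_diff[OF ic iA]])
    fix x show "indicator (- K) x * ?H x \<le> indicator (- K) x * cos (pi * ?G (?d x)) - c * indicator ?A x"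
    proof (cases "x \<in> K")
      case True
      then have "x \<notin> ?A" using AK by blast
      then show ?thesis using True by simp
    next
      case False
      then show ?thesis using key[of "?d x"] by (auto simp: indicator_def)
    qed
  qed
  also have "\<dots> = - (c * measure lborel ?A)"
    unfolding Bochner_Integration.integral_diff[OF ic iA] cosint using mA by simp
  finally have H: "(LINT x|lborel. indicator (- K) x * ?H x) \<le> - (c * measure lborel ?A)" .
  have cA: "0 < c * measure lborel ?A" using cpos posA by simp
  have D: "0 < (LINT x|lborel. ?s x)"
  proof -
    have "- (LINT x|lborel. ?s x) = (LINT x|lborel. - ?s x)" by simp
    also have "\<dots> \<le> (LINT x|lborel. indicator (- K) x * ?H x)"
      by (rule Bochner_Integration.integral_mono[OF _ iH]) (use iS in \<open>auto simp: indicator_def\<close>)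
    finally show ?thesis using H cA by linarith
  qed
  have "lambda1 \<Omega> \<le> ereal ((pi / 2)\<^sup>2 * h\<^sup>2 * (1 - (c * measure lborel ?A) / (LINT x|lborel. ?s x)))"
  proof (rule lambda1_le_sine_profile[OF K(1,2,4,3) cheeger_ratio_pos gn g1 g0 glip _ _ ml _ D H])
    show "0 \<le> l t" "l t \<le> h" for t using q0 qh cheeger_ratio_pos by (auto simp: l_def)
    show "\<exists>r>0. \<forall>u v. \<bar>u - t\<bar> < r \<longrightarrow> \<bar>v - t\<bar> < r \<longrightarrow> \<bar>g u - g v\<bar> \<le> l t * \<bar>u - v\<bar>" for t
    proof (cases "a < t \<and> t < b")
      case True
      have "\<bar>g u - g v\<bar> \<le> l t * \<bar>u - v\<bar>" if "\<bar>u - t\<bar> < min (t - a) (b - t)" "\<bar>v - t\<bar> < min (t - a) (b - t)" for u v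
      proof -
        have "a < u" "u < b" "a < v" "v < b" using that by (auto simp: abs_less_iff)
        then have "g u - g v = q * (u - v)" by (simp add: g_def chord_def q_def[symmetric] algebra_simps)
        then show ?thesis using True q0 by (simp add: l_def abs_mult)
      qed
      then show ?thesis using True by (intro exI[of _ "min (t - a) (b - t)"]) auto
    next
      case False
      then have "l t = h" by (simp only: l_def if_False)
      then show ?thesis using glip by (intro exI[of _ 1]) auto
    qed
  qed
  also have "\<dots> < ereal ((pi / 2)\<^sup>2 * h\<^sup>2)"
  proof -
    have "(pi / 2)\<^sup>2 * h\<^sup>2 * (1 - (c * measure lborel ?A) / (LINT x|lborel. ?s x)) < (pi / 2)\<^sup>2 * h\<^sup>2 * 1"
      using cheeger_ratio_pos cA D by (intro mult_strict_left_mono) (auto intro!: divide_pos_pos)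
    then show ?thesis by simp
  qed
  finally show ?thesis .
qed

end

section \<open>Cheeger sets\<close>

text \<open>The segment from \<open>x\<close> to a nearest point outside the interior meets the boundary of \<open>C\<close>. The
boundary of the interior may be smaller than that of \<open>C\<close>, but the distances agree.\<close>

lemma infdist_frontier_eq:
  fixes C :: "'a::euclidean_space set"
  assumes "C \<noteq> UNIV" "x \<in> C"
  shows "infdist x (frontier C) = infdist x (- interior C)"
proof (rule antisym)
  have ne: "frontier C \<noteq> {}" using assms frontier_not_empty by blast
  have sub: "frontier C \<subseteq> - interior C" by (auto simp: frontier_def)
  show "infdist x (- interior C) \<le> infdist x (frontier C)"
    by (rule infdist_mono[OF sub ne])
  have "closed (- interior C)" "- interior C \<noteq> {}" using sub ne by auto
  then obtain y where y: "y \<in> - interior C" "infdist x (- interior C) = dist x y"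
    using infdist_attains_inf by metis
  have "\<exists>z\<in>frontier C. dist x z \<le> dist x y"
  proof (cases "y \<in> C")
    case True
    then have "y \<in> frontier C" using y(1) closure_subset[of C] by (auto simp: frontier_def)
    then show ?thesis by blast
  next
    case False
    have "closed_segment x y \<inter> frontier C \<noteq> {}"
      by (rule connected_Int_frontier) (use assms(2) False in auto)
    then obtain z where "z \<in> closed_segment x y" "z \<in> frontier C" by blast
    then show ?thesis using segment_bound(1)[of z x y] by (auto simp: dist_norm norm_minus_commute)
  qed
  then show "infdist x (frontier C) \<le> infdist x (- interior C)"
    unfolding y(2) using infdist_le order_trans by metis
qed

lemma superlevel_eq_inner_parallel:
  fixes C :: "'a::euclidean_space set"
  assumes "C \<noteq> UNIV" "0 < t"
  shows "{x. t \<le> infdist x (- interior C)} = inner_parallel C t"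
proof -
  have "x \<in> C" if "t \<le> infdist x (- interior C)" for x
  proof (rule ccontr)
    assume "x \<notin> C"
    then have "x \<in> - interior C" using interior_subset by blast
    then show False using that assms(2) by simp
  qed
  then show ?thesis using infdist_frontier_eq[OF assms(1)] by (auto simp: inner_parallel_def)
qed

text \<open>Above the inradius the inner parallel sets are empty; the inradius itself is a single level.\<close>

lemma AE_inner_parallel:
  fixes C :: "'a::euclidean_space set"
  assumes C: "C \<noteq> UNIV" and Q0: "Q {}"
    and Q: "AE t in (lebesgue :: real measure). 0 < t \<and> ereal t < inradius C \<longrightarrow> Q (inner_parallel C t)"
  shows "AE t in lborel. 0 < t \<longrightarrow> Q {x. t \<le> infdist x (- interior C)}"
proof -
  have "AE t in lborel. 0 < t \<and> ereal t < inradius C \<longrightarrow> Q (inner_parallel C t)"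
    using Q by (simp add: AE_completion_iff)
  moreover have "AE t in lborel. t \<noteq> real_of_ereal (inradius C)" by (rule AE_lborel_singleton)
  ultimately show ?thesis
  proof eventually_elim
    case (elim t)
    show ?case
    proof
      assume t: "0 < t"
      have "inner_parallel C t = {}" if "\<not> ereal t < inradius C"
      proof -
        have "ereal t \<noteq> inradius C" using elim(2) by (metis real_of_ereal.simps(1))
        with that have *: "inradius C < ereal t" by simp
        have "infdist x (frontier C) < t" if "x \<in> C" for x
        proof -
          have "ereal (infdist x (frontier C)) \<le> inradius C"
            unfolding inradius_def using that by (rule SUP_upper)
          also note *
          finally show ?thesis by simp
        qed
        then show ?thesis by (auto simp: inner_parallel_def not_le[symmetric])
      qed
      then show "Q {x. t \<le> infdist x (- interior C)}"
        unfolding superlevel_eq_inner_parallel[OF C t] using elim(1) t Q0 by (cases "ereal t < inradius C") auto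
    qed
  qed
qed

text \<open>Otherwise the volume profile would be constant, although it increases from \<open>0\<close> to \<open>1\<close>.\<close>

lemma perimeter_pos:
  fixes K :: "'a::euclidean_space set"
  assumes K: "closed K" "K \<noteq> {}" "bounded (- K)" and V: "0 < measure lborel (- K)" and P: "0 \<le> P"
    and per: "AE \<tau> in lborel. 0 < \<tau> \<longrightarrow> perimeter {x. \<tau> \<le> infdist x K} \<le> ereal P"
  shows "0 < P"
proof (rule ccontr)
  assume "\<not> 0 < P"
  then have "P = 0" using P by simp
  obtain T where T: "T > 0" "volume_profile K T = 1" using volume_profile_eq_1[OF K V P per] by blast
  have "volume_profile K T - volume_profile K 0 \<le> P / measure lborel (- K) * (T - 0)"
    by (rule volume_profile_lipschitz[OF K V P per]) (use T in auto)
  then show False using T \<open>P = 0\<close> volume_profile_nonpos[OF K V P per, of 0] by simp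
qed

theorem proposition3p8:
  fixes \<Omega> C :: "(real ^ 'n) set"
  assumes "open \<Omega>" and "bounded \<Omega>" and "\<Omega> \<noteq> {}"
    and "is_cheeger_set \<Omega> C"
    and "null_boundary_representative C"
    and "perimeter_regular C"
  shows "J \<Omega> \<le> ereal (pi\<^sup>2 / 4) \<and>
         (strictly_perimeter_regular C \<longrightarrow> J \<Omega> < ereal (pi\<^sup>2 / 4))"
proof -
  define K where "K = - interior C"
  have CO: "C \<subseteq> \<Omega>" "C \<in> sets lebesgue" "0 < measure lebesgue C"
    and chee: "cheeger_constant \<Omega> = perimeter C / ereal (measure lebesgue C)"
    using assms(4) by (auto simp: is_cheeger_set_def cheeger_competitors_def)
  have bC: "bounded C" using assms(2) CO(1) by (rule bounded_subset)
  have CU: "C \<noteq> UNIV" using bC not_bounded_UNIV by auto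
  have mK: "- K = interior C" by (simp add: K_def)
  have K: "closed K" "K \<noteq> {}" "bounded (- K)" "- K \<subseteq> \<Omega>"
    using CU bC CO(1) interior_subset[of C] by (auto simp: K_def intro: bounded_subset)
  have V: "measure lborel (- K) = measure lebesgue C"
  proof -
    have "C = interior C \<union> (C \<inter> frontier C)"
      using interior_subset[of C] closure_subset[of C] by (auto simp: frontier_def)
    then have "measure lebesgue C = measure lebesgue (interior C \<union> (C \<inter> frontier C))" by simp
    also have "\<dots> = measure lebesgue (interior C)"
      by (rule measure_Un_null_set) (use assms(5) in \<open>auto simp: null_boundary_representative_def\<close>)
    also have "\<dots> = measure lborel (interior C)" by simp
    finally show ?thesis by (simp add: mK)
  qed
  have V0: "0 < measure lborel (- K)" using CO(3) V by simp
  show ?thesis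
  proof (cases "perimeter C = \<infinity>")
    case True
    \<comment> \<open>then \<open>J\<close> is \<open>0\<close> by the convention \<open>x / \<infinity> = 0\<close>\<close>
    then have "cheeger_constant \<Omega> = \<infinity>" unfolding chee using CO(3) by (simp add: divide_ereal_def)
    then have "J \<Omega> = 0" by (simp add: J_def power2_eq_square)
    then show ?thesis by simp
  next
    case False
    define P where "P = real_of_ereal (perimeter C)"
    have P: "perimeter C = ereal P" "0 \<le> P"
      using False perimeter_nonneg[of C] by (auto simp: P_def ereal_real' real_of_ereal_pos)
    have per: "AE \<tau> in lborel. 0 < \<tau> \<longrightarrow> perimeter {x. \<tau> \<le> infdist x K} \<le> ereal P"
      unfolding K_def by (rule AE_inner_parallel[OF CU, where Q = "\<lambda>E. perimeter E \<le> ereal P"])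
        (use assms(6) P in \<open>auto simp: perimeter_regular_def perimeter_empty\<close>)
    have P0: "0 < P" by (rule perimeter_pos[OF K(1-3) V0 P(2) per])
    define h where "h = P / measure lborel (- K)"
    have h: "0 < h" using P0 V0 by (simp add: h_def)
    have J: "J \<Omega> = lambda1 \<Omega> / ereal (h\<^sup>2)"
      unfolding J_def chee P(1) V[symmetric] using V0 by (simp add: h_def)
    have eq: "(pi / 2)\<^sup>2 * h\<^sup>2 / h\<^sup>2 = pi\<^sup>2 / 4" using h by (simp add: power_divide)
    have "J \<Omega> \<le> ereal ((pi / 2)\<^sup>2 * h\<^sup>2) / ereal (h\<^sup>2)"
      unfolding J using lambda1_le_of_perimeter_le[OF K V0 P0 per h_def] h by (intro ereal_divide_right_mono) auto
    then have 1: "J \<Omega> \<le> ereal (pi\<^sup>2 / 4)" using eq h by simp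
    have 2: "J \<Omega> < ereal (pi\<^sup>2 / 4)" if "strictly_perimeter_regular C"
    proof -
      have "AE \<tau> in lborel. 0 < \<tau> \<longrightarrow> perimeter {x. \<tau> \<le> infdist x K} < ereal P"
        unfolding K_def by (rule AE_inner_parallel[OF CU, where Q = "\<lambda>E. perimeter E < ereal P"])
          (use that P P0 in \<open>auto simp: strictly_perimeter_regular_def perimeter_empty\<close>)
      from lambda1_less_of_perimeter_less[OF K V0 P0 per h_def this] have "lambda1 \<Omega> < ereal (pi\<^sup>2 / 4) * ereal (h\<^sup>2)" by (simp add: power_divide)
      then show ?thesis unfolding J using h by (subst ereal_divide_less_iff) auto
    qed
    from 1 2 show ?thesis by blast
  qed
qed

end
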